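(* Let $P(K)$ be a projection of a knot $K$ that is in spiral form. Let $o$ be the number of o-circles and $i$ the number of i-circles among the Seifert circles of $P(K)$. Then the spiral number of the projection satisfies $sp(P(K)) = o - i$.
   Context: A knot is an oriented smooth simple closed curve $K$ in $\mathbb{R}^3$. A smooth projection $P(K)$ is the orthogonal projection of $K$ to a plane, an immersed closed curve whose only multiple points are finitely many transverse double points (crossings). An inflection point of the projection is a point where the planar curvature vanishes; inflection points are assumed isolated. An inflection point is an $s$-inflection point if the signed planar curvature changes sign there. The projection is in spiral form if it has no $s$-inflection points; equivalently, its signed planar curvature is everywhere $\ge 0$ or everywhere $\le 0$. A projection in spiral form has the same number of local maxima with respect to every direction in the plane; this number is its spiral number $sp(P(K))$. The Seifert circles of the oriented diagram are the piecewise smooth simple closed curves obtained by smoothing every crossing consistently with the orientation, without rounding the corners. The vertices of a Seifert circle are its corners at smoothed crossings, and its sides are the arcs of the diagram between consecutive vertices (a Seifert circle without vertices has a single closed side). A Seifert circle is an o-circle if all of its sides curve towards its inside (wherever the curvature of a side is nonzero, the curvature vector points to the side of the bounded region enclosed by the Seifert circle). It is an i-circle if all of its sides curve away from its inside (wherever the curvature is nonzero, the curvature vector points to the unbounded side). *)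

theory Defs
  imports "HOL-Analysis.Analysis" "HOL-Combinatorics.Orbits"
begin

(* Closed curves are functions on the real line of period 1, so that the parameter circle is
   R/Z; {0..<1} is used as a set of representatives.  The orientation is that of increasing
   parameter. *)

definition smooth :: "(real \<Rightarrow> 'a::real_normed_vector) \<Rightarrow> bool" where
  "smooth f \<longleftrightarrow>
     (\<exists>D. D 0 = f \<and> (\<forall>n t. (D n has_vector_derivative D (Suc n) t) (at t)))"

definition velocity :: "(real \<Rightarrow> 'a::real_normed_vector) \<Rightarrow> real \<Rightarrow> 'a" where
  "velocity f t = vector_derivative f (at t)"

definition knot :: "(real \<Rightarrow> real^3) \<Rightarrow> bool" where
  "knot K \<longleftrightarrow> smooth K \<and> (\<forall>t. K (t + 1) = K t) \<and> (\<forall>t. velocity K t \<noteq> 0) \<and> inj_on K {0..<1}"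

(* The plane through a spanned by the orthonormal vectors u, v is identified with the complex
   plane by the isometry a + x u + y v |-> x + i y. *)
definition orthogonal_projection_of :: "(real \<Rightarrow> complex) \<Rightarrow> (real \<Rightarrow> real^3) \<Rightarrow> bool" where
  "orthogonal_projection_of P K \<longleftrightarrow>
     (\<exists>a u v. norm u = 1 \<and> norm v = 1 \<and> u \<bullet> v = 0 \<and>
              P = (\<lambda>t. Complex ((K t - a) \<bullet> u) ((K t - a) \<bullet> v)))"

definition multiple_points :: "(real \<Rightarrow> complex) \<Rightarrow> complex set" where
  "multiple_points P = {z. \<exists>s\<in>{0..<1}. \<exists>t\<in>{0..<1}. s \<noteq> t \<and> P s = z \<and> P t = z}"

definition transverse_double_point :: "(real \<Rightarrow> complex) \<Rightarrow> complex \<Rightarrow> bool" where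
  "transverse_double_point P z \<longleftrightarrow>
     card {t\<in>{0..<1}. P t = z} = 2 \<and>
     (\<forall>s\<in>{0..<1}. \<forall>t\<in>{0..<1}. s \<noteq> t \<and> P s = z \<and> P t = z \<longrightarrow>
        velocity P s \<notin> span {velocity P t})"

definition unit_tangent :: "(real \<Rightarrow> complex) \<Rightarrow> real \<Rightarrow> complex" where
  "unit_tangent P t = sgn (velocity P t)"

(* (x' y'' - y' x'') / |P'|^3 for P = x + i y *)
definition signed_curvature :: "(real \<Rightarrow> complex) \<Rightarrow> real \<Rightarrow> real" where
  "signed_curvature P t =
     (Re (velocity P t) * Im (velocity (velocity P) t)
      - Im (velocity P t) * Re (velocity (velocity P) t)) / norm (velocity P t) ^ 3"

(* signed curvature times the unit normal to the left of the unit tangent *)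
definition curvature_vector :: "(real \<Rightarrow> complex) \<Rightarrow> real \<Rightarrow> complex" where
  "curvature_vector P t = signed_curvature P t *\<^sub>R (\<i> * unit_tangent P t)"

definition inflection_points :: "(real \<Rightarrow> complex) \<Rightarrow> real set" where
  "inflection_points P = {t. signed_curvature P t = 0}"

definition smooth_projection :: "(real \<Rightarrow> real^3) \<Rightarrow> (real \<Rightarrow> complex) \<Rightarrow> bool" where
  "smooth_projection K P \<longleftrightarrow>
     orthogonal_projection_of P K \<and>
     (\<forall>t. velocity P t \<noteq> 0) \<and>
     finite (multiple_points P) \<and>
     (\<forall>z\<in>multiple_points P. transverse_double_point P z) \<and>
     discrete (inflection_points P)"

definition s_inflection_point :: "(real \<Rightarrow> complex) \<Rightarrow> real \<Rightarrow> bool" where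
  "s_inflection_point P t \<longleftrightarrow>
     t \<in> inflection_points P \<and>
     (\<exists>\<epsilon>>0. \<forall>r\<in>{t-\<epsilon><..<t}. \<forall>s\<in>{t<..<t+\<epsilon>}. signed_curvature P r * signed_curvature P s < 0)"

definition spiral_form :: "(real \<Rightarrow> complex) \<Rightarrow> bool" where
  "spiral_form P \<longleftrightarrow> (\<nexists>t. s_inflection_point P t)"

definition local_maxima :: "(real \<Rightarrow> complex) \<Rightarrow> complex \<Rightarrow> real set" where
  "local_maxima P w = {t\<in>{0..<1}. \<forall>\<^sub>F s in at t. P s \<bullet> w \<le> P t \<bullet> w}"

(* the common number of local maxima with respect to all directions *)
definition spiral_number :: "(real \<Rightarrow> complex) \<Rightarrow> nat" where
  "spiral_number P =
     (THE n. \<forall>w. norm w = 1 \<longrightarrow> finite (local_maxima P w) \<and> card (local_maxima P w) = n)"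

(* All parameters, not only those in {0..<1}, at which the curve passes through a crossing. *)
definition crossing_params :: "(real \<Rightarrow> complex) \<Rightarrow> real set" where
  "crossing_params P = {t. \<exists>s. s - t \<notin> \<int> \<and> P s = P t}"

definition next_crossing :: "(real \<Rightarrow> complex) \<Rightarrow> real \<Rightarrow> real" where
  "next_crossing P t = (LEAST s. s \<in> crossing_params P \<and> t < s)"

(* the parameter in {0..<1} of the other strand through the crossing at P t *)
definition other_strand :: "(real \<Rightarrow> complex) \<Rightarrow> real \<Rightarrow> real" where
  "other_strand P t = (THE s. s \<in> {0..<1} \<and> s - t \<notin> \<int> \<and> P s = P t)"

(* Smoothing a crossing consistently with the orientation: having traversed the arc of the
   diagram that starts at t, arrive at the next crossing and leave it, again in the direction of
   the orientation, along the other strand.  The value is the starting parameter of the arc that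
   follows on the same Seifert circle. *)
definition seifert_step :: "(real \<Rightarrow> complex) \<Rightarrow> real \<Rightarrow> real" where
  "seifert_step P t = other_strand P (next_crossing P t)"

(* A Seifert circle is represented by the set of its sides, and a side by the open parameter
   interval of the corresponding arc of the diagram; a knot diagram without crossings has a single
   Seifert circle, whose only side is the whole (closed) curve.  Arcs are started in {0..<1}, so
   different parameter intervals are different arcs. *)
definition seifert_circles :: "(real \<Rightarrow> complex) \<Rightarrow> real set set set" where
  "seifert_circles P =
     (if crossing_params P = {} then {{UNIV}}
      else (\<lambda>t. (\<lambda>s. {s<..<next_crossing P s}) ` orbit (seifert_step P) t)
             ` (crossing_params P \<inter> {0..<1}))"

definition circle_trace :: "(real \<Rightarrow> complex) \<Rightarrow> real set set \<Rightarrow> complex set" where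
  "circle_trace P S = (\<Union>I\<in>S. P ` closure I)"

(* A vector v at z points to the region R if z + e v lies in R for all sufficiently small e > 0. *)
definition points_to :: "complex \<Rightarrow> complex \<Rightarrow> complex set \<Rightarrow> bool" where
  "points_to z v R \<longleftrightarrow> (\<forall>\<^sub>F \<epsilon> in at_right 0. z + \<epsilon> *\<^sub>R v \<in> R)"

(* The curving of a side is tested away from its end points, since at a corner with acute interior
   angle the normals of the two sides do not tell the two sides of the circle apart. *)
definition o_circle :: "(real \<Rightarrow> complex) \<Rightarrow> real set set \<Rightarrow> bool" where
  "o_circle P S \<longleftrightarrow>
     (\<forall>I\<in>S. \<forall>t\<in>I. signed_curvature P t \<noteq> 0 \<longrightarrow>
        points_to (P t) (curvature_vector P t) (inside (circle_trace P S)))"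

definition i_circle :: "(real \<Rightarrow> complex) \<Rightarrow> real set set \<Rightarrow> bool" where
  "i_circle P S \<longleftrightarrow>
     (\<forall>I\<in>S. \<forall>t\<in>I. signed_curvature P t \<noteq> 0 \<longrightarrow>
        points_to (P t) (curvature_vector P t) (outside (circle_trace P S)))"

end

theory Submission
  imports Defs "HOL-Complex_Analysis.Complex_Analysis"
begin

text \<open>
  Let \<open>\<sigma>\<close> be the sign of the curvature and \<open>2 \<pi> R\<close> the total turning of the tangent of \<open>P\<close>.  The
  tangent angle is strictly monotone, so every direction has \<open>\<sigma> R\<close> local maxima.  Distributing the
  turning over the Seifert circles gives \<open>2 \<pi> R = \<Sum> 2 \<pi> W\<close>, where \<open>2 \<pi> W\<close> is the turning of a Seifert
  circle including its exterior angles, because the two exterior angles at a crossing cancel.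

  A Seifert circle is a simple loop \<open>\<gamma>\<close>, and \<open>W = \<plusminus>1\<close> follows in the manner of Hopf: on the strip of
  parameters \<open>s < t < s + m\<close> the secant \<open>\<gamma> t - \<gamma> s\<close> has a continuous logarithm, and replacing
  \<open>(s, t)\<close> by \<open>(t, s + m)\<close> changes it by \<open>\<i> \<pi> W\<close>.  Letting a point approach \<open>\<gamma>\<close> from the left or from
  the right expresses its winding number as \<open>(W + 1) / 2\<close> or \<open>(W - 1) / 2\<close>; since a Jordan curve has
  winding numbers \<open>0\<close> and \<open>\<plusminus>1\<close> only, \<open>W = \<plusminus>1\<close>, and the left side is the inside iff \<open>W = 1\<close>.
  Hence \<open>\<sigma> W = 1\<close> for an o-circle and \<open>\<sigma> W = - 1\<close> for an i-circle, and every Seifert circle is one of them.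
\<close>

section \<open>Logarithms and half-planes\<close>

text \<open>The overview takes for granted that a Seifert circle is a simple loop, although a cycle
  of \<open>seifert_step\<close> might a priori pass through one crossing along both strands.
  Excluding this is the main obstacle. It is why turning and winding numbers are studied for
  abstract loops, before Seifert circles are known to be simple: the closed part cut off by an
  earliest return is such a loop too, and its winding numbers give the contradiction. Corners are
  the second obstacle, since Hopf's argument uses tangents as limits of secants and a corner has no
  tangent. The secant logarithm is therefore never extended to the diagonal of the whole strip. Its
  limits are taken along each side separately, and across a corner the secants stay in a half-plane,
  so that a principal argument measures the change; transversality keeps exterior angles away from
  pi. Finally, o- and i-circles are defined by implications that could hold vacuously. As inflection
  points are isolated, every side has points of nonzero curvature, so no circle is of both
  kinds.\<close>

lemma continuous_logs_differ_by_constant: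
  fixes g1 g2 :: "'a::topological_space \<Rightarrow> complex"
  assumes "connected S" "continuous_on S g1" "continuous_on S g2"
    and eq: "\<And>x. x \<in> S \<Longrightarrow> exp (g1 x) = c * exp (g2 x)"
  obtains d where "\<And>x. x \<in> S \<Longrightarrow> g1 x = g2 x + d"
proof -
  have "(\<lambda>x. g1 x - g2 x) constant_on S"
  proof (rule continuous_discrete_range_constant)
    show "continuous_on S (\<lambda>x. g1 x - g2 x)"
      by (intro continuous_intros assms)
    fix x assume x: "x \<in> S"
    \<comment> \<open>The difference has constant exponential, so its values lie in one translate of
      the multiples of 2 pi i, whose points are at least 2 pi apart.\<close>
    show "\<exists>e>0. \<forall>y. y \<in> S \<and> g1 y - g2 y \<noteq> g1 x - g2 x \<longrightarrow> e \<le> norm ((g1 y - g2 y) - (g1 x - g2 x))"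
    proof (intro exI[of _ "2*pi"] conjI allI impI)
      fix y assume y: "y \<in> S \<and> g1 y - g2 y \<noteq> g1 x - g2 x"
      have "exp (g1 y - g2 y) = exp (g1 x - g2 x)"
        using eq[OF x] eq[of y] y by (simp add: exp_diff)
      then obtain n :: int where n: "g1 y - g2 y = g1 x - g2 x + (of_int (2 * n) * pi) * \<i>"
        by (auto simp: exp_eq)
      then have "n \<noteq> 0" using y by auto
      then have "1 \<le> \<bar>real_of_int n\<bar>" by linarith
      then show "2*pi \<le> norm ((g1 y - g2 y) - (g1 x - g2 x))"
        using n by (simp add: norm_mult)
    qed auto
  qed (use assms in auto)
  then obtain d where "\<And>x. x \<in> S \<Longrightarrow> g1 x - g2 x = d" by (auto simp: constant_on_def)
  with that[of d] show thesis by (simp add: algebra_simps)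
qed

text \<open>The bisector of the angle between \<open>u\<close> and \<open>v\<close> serves as
  \<open>h\<close>: with \<open>s\<close> the principal square root of \<open>v / u\<close>, which
  has positive real part because the two are not opposite, \<open>h = u * s\<close> gives the
  quotients \<open>inverse s\<close> and \<open>s\<close>.\<close>

lemma half_plane_containing_two:
  fixes u v :: complex
  assumes "v / u \<notin> \<real>\<^sub>\<le>\<^sub>0"
  obtains h where "0 < Re (u / h)" "0 < Re (v / h)" "h \<noteq> 0"
proof -
  define s where "s = csqrt (v / u)"
  have u: "u \<noteq> 0" and v: "v \<noteq> 0" using assms by auto
  have s: "0 < Re s"
    unfolding s_def using assms csqrt_principal[of "v / u"]
    by (smt (verit) complex_nonpos_Reals_iff csqrt_in_nonpos_Reals_iff nonpos_Reals_zero_I Re_csqrt Im_csqrt_eq_0_iff complex_nonneg_Reals_iff power2_csqrt power2_eq_square mult_minus_left Re_power2 Im_power2 zero_power2)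
  have ss: "s * s = v / u" unfolding s_def by (metis power2_csqrt power2_eq_square)
  have s0: "s \<noteq> 0" using s by auto
  have "u / (u * s) = inverse s" using u s0 by (simp add: field_simps)
  moreover have "v / (u * s) = s" using ss u s0 by (simp add: field_simps)
  moreover have "0 < Re (inverse s)" using s by (simp add: sum_power2_gt_zero_iff)
  ultimately show thesis using that[of "u * s"] s u s0 by auto
qed

text \<open>Both arguments are smaller than pi/2 in modulus, so their difference stays in the
  principal range.\<close>

lemma Arg_divide_half_plane:
  fixes a b h :: complex
  assumes "0 < Re (a / h)" "0 < Re (b / h)"
  shows "Arg (b / a) = Arg (b / h) - Arg (a / h)"
proof -
  have h: "h \<noteq> 0" "a \<noteq> 0" "b \<noteq> 0" using assms by auto
  have *: "\<bar>Arg (a / h)\<bar> < pi/2" "\<bar>Arg (b / h)\<bar> < pi/2" using assms Arg_Re_pos by blast+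
  have "b / a = (b / h) / (a / h)" using h by simp
  then show ?thesis
    using Arg_divide'[of "b / h" "a / h"] h * by auto
qed

text \<open>On a half-plane the principal logarithm, rotated by \<open>h\<close>, is continuous, and
  \<open>g\<close> differs from it by a constant. Hence the change of \<open>g\<close> depends only
  on the two end values and involves no extra multiple of 2 pi.\<close>

lemma log_change_half_plane:
  fixes g :: "'a::topological_space \<Rightarrow> complex"
  assumes S: "connected S" "continuous_on S g"
    and h: "\<And>x. x \<in> S \<Longrightarrow> 0 < Re (exp (g x) / h)"
    and xy: "x \<in> S" "y \<in> S"
  shows "Im (g y) - Im (g x) = Arg (exp (g y) / exp (g x))"
proof -
  have h0: "h \<noteq> 0" using h[OF xy(1)] by auto
  have np: "exp (g x) / h \<notin> \<real>\<^sub>\<le>\<^sub>0" if "x \<in> S" for x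
    using h[OF that] by (auto simp: complex_nonpos_Reals_iff)
  obtain d where d: "\<And>x. x \<in> S \<Longrightarrow> Ln (exp (g x) / h) = g x + d"
  proof (rule continuous_logs_differ_by_constant)
    show "continuous_on S (\<lambda>x. Ln (exp (g x) / h))"
      by (intro continuous_intros S) (use np h0 in auto)
    show "exp (Ln (exp (g x) / h)) = inverse h * exp (g x)" if "x \<in> S" for x
      using h0 by (simp add: field_simps)
  qed (use S in auto)
  have "Arg (exp (g x) / h) = Im (g x) + Im d" if "x \<in> S" for x
    using d[OF that] h0 by (simp add: Arg_eq_Im_Ln)
  then show ?thesis
    using Arg_divide_half_plane[OF h[OF xy(1)] h[OF xy(2)]] xy by simp
qed

text \<open>A vertex is an extreme point: the sum of the coordinates is positive elsewhere, and a
  convex combination keeps it positive. The convexity is used for connectedness of domains of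
  logarithms.\<close>

lemma convex_square_minus_vertex:
  "convex ({0..a} \<times> {0..b} - {(0::real, 0::real)})"
proof (rule convexI)
  fix x y :: "real \<times> real" and u v :: real
  assume x: "x \<in> {0..a} \<times> {0..b} - {(0, 0)}" and y: "y \<in> {0..a} \<times> {0..b} - {(0, 0)}"
    and uv: "0 \<le> u" "0 \<le> v" "u + v = 1"
  have "convex ({0..a} \<times> {0..b})" by (intro convex_Times) auto
  then have "u *\<^sub>R x + v *\<^sub>R y \<in> {0..a} \<times> {0..b}" using x y uv by (auto dest: convexD)
  moreover have "u *\<^sub>R x + v *\<^sub>R y \<noteq> (0, 0)"
  proof -
    have ne: "u * p + v * q > 0" if "0 \<le> p" "0 \<le> q" "0 < p + q" "u = 0 \<longrightarrow> q > 0" "v = 0 \<longrightarrow> p > 0" for p q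
      using that uv by (smt (verit) mult_nonneg_nonneg mult_pos_pos)
    have "u * (fst x + snd x) + v * (fst y + snd y) > 0"
      using x y uv by (intro ne) (auto simp: prod_eq_iff add_nonneg_pos add_pos_nonneg)
    then show ?thesis by (auto simp: prod_eq_iff algebra_simps)
  qed
  ultimately show "u *\<^sub>R x + v *\<^sub>R y \<in> {0..a} \<times> {0..b} - {(0, 0)}" by auto
qed

section \<open>Two branches at a point and the argument between them\<close>

lemma eventually_direction_half_plane:
  fixes p :: "real \<Rightarrow> complex"
  assumes "((\<lambda>t. p t / of_real t) \<longlongrightarrow> v) (at_right 0)" "0 < Re (v / h)"
  shows "\<forall>\<^sub>F t in at_right 0. 0 < Re (p t / h)"
proof -
  have "((\<lambda>t. Re (p t / of_real t / h)) \<longlongrightarrow> Re (v / h)) (at_right 0)"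
    by (intro tendsto_intros assms) (use assms in auto)
  then have "\<forall>\<^sub>F t in at_right 0. 0 < Re (p t / of_real t / h)"
    using assms(2) order_tendstoD(1) by blast
  moreover have "\<forall>\<^sub>F t in at_right (0::real). 0 < t" by (rule eventually_at_right_less)
  ultimately show ?thesis
  proof eventually_elim
    case (elim t)
    have "Re (p t / of_real t / h) = Re (p t / h) / t"
      by (simp add: divide_divide_eq_left mult.commute flip: Re_divide_of_real)
    then show ?case using elim by (simp add: zero_less_divide_iff)
  qed
qed

text \<open>If the one-sided tangents \<open>v\<close> and \<open>w\<close> are not opposite, short
  pieces of both curves, and with them all sums \<open>p s + q t\<close>, lie in one open
  half-plane. The bound \<open>d\<close> depends on the curves only and \<open>g\<close> is
  arbitrary, so the result applies to logarithms obtained globally. It is used both for secants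
  across a corner and for a point moving off a curve.\<close>

lemma cone_log:
  fixes p q :: "real \<Rightarrow> complex"
  assumes p: "((\<lambda>t. p t / of_real t) \<longlongrightarrow> v) (at_right 0)" "p 0 = 0"
    and q: "((\<lambda>t. q t / of_real t) \<longlongrightarrow> w) (at_right 0)" "q 0 = 0"
    and vw: "w / v \<notin> \<real>\<^sub>\<le>\<^sub>0"
  obtains d where "0 < d"
    and "\<And>s t. \<lbrakk>0 \<le> s; s \<le> d; 0 \<le> t; t \<le> d; s \<noteq> 0 \<or> t \<noteq> 0\<rbrakk> \<Longrightarrow> p s + q t \<noteq> 0"
    and "\<And>(g :: real \<times> real \<Rightarrow> complex) a b s t. \<lbrakk>continuous_on ({0..a} \<times> {0..b} - {(0, 0)}) g;
           \<And>s t. \<lbrakk>0 \<le> s; s \<le> a; 0 \<le> t; t \<le> b; s \<noteq> 0 \<or> t \<noteq> 0\<rbrakk> \<Longrightarrow> exp (g (s, t)) = p s + q t;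
           0 < s; s \<le> a; 0 < t; t \<le> b; a \<le> d; b \<le> d\<rbrakk> \<Longrightarrow> Im (g (0, t)) - Im (g (s, 0)) = Arg (q t / p s)"
proof -
  obtain h where h: "0 < Re (v / h)" "0 < Re (w / h)" "h \<noteq> 0"
    using half_plane_containing_two[OF vw] by blast
  obtain d1 where d1: "d1 > 0" "\<And>t. 0 < t \<Longrightarrow> t < d1 \<Longrightarrow> 0 < Re (p t / h)"
    using eventually_direction_half_plane[OF p(1) h(1)] by (auto simp: eventually_at_right_field)
  obtain d2 where d2: "d2 > 0" "\<And>t. 0 < t \<Longrightarrow> t < d2 \<Longrightarrow> 0 < Re (q t / h)"
    using eventually_direction_half_plane[OF q(1) h(2)] by (auto simp: eventually_at_right_field)
  \<comment> \<open>Halving leaves room for the closed intervals inside the open ranges of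
    \<open>d1\<close> and \<open>d2\<close>.\<close>
  define d where "d = min d1 d2 / 2"
  have d: "0 < d" "d < d1" "d < d2" using d1 d2 by (auto simp: d_def)
  have pos: "0 < Re ((p s + q t) / h)" if "0 \<le> s" "s \<le> d" "0 \<le> t" "t \<le> d" "s \<noteq> 0 \<or> t \<noteq> 0" for s t
  proof -
    have "0 \<le> Re (p s / h)" "0 \<le> Re (q t / h)" "0 < Re (p s / h) \<or> 0 < Re (q t / h)"
      using that d d1(2)[of s] d2(2)[of t] p(2) q(2) by (cases "s = 0"; cases "t = 0"; force)+
    then show ?thesis by (auto simp: add_divide_distrib)
  qed
  show thesis
  proof (rule that)
    show "0 < d" by fact
    show "p s + q t \<noteq> 0" if "0 \<le> s" "s \<le> d" "0 \<le> t" "t \<le> d" "s \<noteq> 0 \<or> t \<noteq> 0" for s t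
      using pos[OF that] by auto
    fix g :: "real \<times> real \<Rightarrow> complex" and a b s t
    assume g: "continuous_on ({0..a} \<times> {0..b} - {(0, 0)}) g"
      "\<And>s t. \<lbrakk>0 \<le> s; s \<le> a; 0 \<le> t; t \<le> b; s \<noteq> 0 \<or> t \<noteq> 0\<rbrakk> \<Longrightarrow> exp (g (s, t)) = p s + q t"
      and st: "0 < s" "s \<le> a" "0 < t" "t \<le> b" "a \<le> d" "b \<le> d"
    have "Im (g (0, t)) - Im (g (s, 0)) = Arg (exp (g (0, t)) / exp (g (s, 0)))"
    proof (rule log_change_half_plane[where h = h, OF convex_connected[OF convex_square_minus_vertex] g(1)])
      fix x assume x: "x \<in> {0..a} \<times> {0..b} - {(0, 0)}"
      then have *: "0 \<le> fst x" "fst x \<le> a" "0 \<le> snd x" "snd x \<le> b" "fst x \<noteq> 0 \<or> snd x \<noteq> 0"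
        by (auto simp: prod_eq_iff)
      then show "0 < Re (exp (g x) / h)"
        using g(2)[OF *] pos[of "fst x" "snd x"] st by auto
    qed (use st in auto)
    then show "Im (g (0, t)) - Im (g (s, 0)) = Arg (q t / p s)"
      using st by (simp add: g(2) p(2) q(2))
  qed
qed

text \<open>For \<open>w\<close> to the left of both directions, \<open>Arg (w / a)\<close> and
  \<open>Arg (w / b)\<close> lie between 0 and pi; their difference needs no correction, and
  reversing \<open>w\<close> subtracts exactly pi. In the application \<open>a\<close> and
  \<open>b\<close> are the incoming and outgoing chords at a point of a loop and \<open>w\<close> is
  the displacement off it. This half turn is what distinguishes the two sides.\<close>

lemma Arg_around_left:
  fixes a b w :: complex
  assumes "0 < Im (w / a)" "0 < Im (w / b)"
  shows "Arg (w / a) - Arg (b / a) - Arg (- w / b) = pi"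
proof -
  have nz: "w \<noteq> 0" "a \<noteq> 0" "b \<noteq> 0" using assms by auto
  have 1: "0 < Arg (w / a)" "Arg (w / a) < pi" "0 < Arg (w / b)" "Arg (w / b) < pi"
    using Arg_lt_pi assms by blast+
  have "b / a = (w / a) / (w / b)" using nz by simp
  then have "Arg (b / a) = Arg (w / a) - Arg (w / b)"
    using Arg_divide'[of "w / a" "w / b"] nz 1 by auto
  moreover have "Arg (- w / b) = Arg (w / b) - pi"
    using Arg_minus[of "w / b"] nz 1 by auto
  ultimately show ?thesis by simp
qed

lemma Arg_around_right:
  fixes a b w :: complex
  assumes "Im (w / a) < 0" "Im (w / b) < 0"
  shows "Arg (w / a) - Arg (b / a) - Arg (- w / b) = - pi"
proof -
  have nz: "w \<noteq> 0" "a \<noteq> 0" "b \<noteq> 0" using assms by auto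
  have 1: "Arg (w / a) < 0" "- pi < Arg (w / a)" "Arg (w / b) < 0" "- pi < Arg (w / b)"
    using Arg_neg_iff assms mpi_less_Arg by blast+
  have "b / a = (w / a) / (w / b)" using nz by simp
  then have "Arg (b / a) = Arg (w / a) - Arg (w / b)"
    using Arg_divide'[of "w / a" "w / b"] nz 1 by auto
  moreover have "Arg (- w / b) = Arg (w / b) + pi"
    using Arg_minus[of "w / b"] nz 1 by auto
  ultimately show ?thesis by simp
qed

lemma winding_number_eq_log_change:
  fixes g :: "real \<Rightarrow> complex"
  assumes g: "continuous_on {0..1} g" and eq: "\<And>t. t \<in> {0..1} \<Longrightarrow> p t = z + exp (g t)"
  shows "2 * pi * \<i> * winding_number p z = g 1 - g 0"
proof -
  have "winding_number (exp \<circ> g) 0 = (pathfinish g - pathstart g) / (2 * of_real pi * \<i>)"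
    by (rule winding_number_compose_exp) (use g in \<open>simp add: path_def\<close>)
  moreover have "winding_number p z = winding_number (\<lambda>t. p t - z) 0"
    by (rule winding_number_offset)
  moreover have "winding_number (\<lambda>t. p t - z) 0 = winding_number (exp \<circ> g) 0"
    by (rule winding_number_cong) (simp add: eq)
  ultimately show ?thesis by (simp add: pathfinish_def pathstart_def)
qed

section \<open>Turning of a piecewise smooth simple loop\<close>

lemma has_vector_derivative_difference_quotient:
  fixes f :: "real \<Rightarrow> complex"
  assumes "(f has_vector_derivative D) (at x)"
  shows "((\<lambda>t. (f (x + t) - f x) / of_real t) \<longlongrightarrow> D) (at 0)"
proof -
  have "(f has_derivative (\<lambda>t. t *\<^sub>R D)) (at x)"
    using assms by (simp add: has_vector_derivative_def)
  then have "((\<lambda>h. norm (f (x + h) - f x - h *\<^sub>R D) / norm h) \<longlongrightarrow> 0) (at 0)"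
    by (simp add: has_derivative_at)
  then have "((\<lambda>h. norm ((f (x + h) - f x) / of_real h - D)) \<longlongrightarrow> 0) (at 0)"
  proof (rule Lim_transform_eventually)
    have "\<forall>\<^sub>F h in at (0::real). h \<noteq> 0" by (simp add: eventually_at_filter)
    then show "\<forall>\<^sub>F h in at 0. norm (f (x + h) - f x - h *\<^sub>R D) / norm h
                = norm ((f (x + h) - f x) / of_real h - D)"
    proof eventually_elim
      case (elim h)
      have "(f (x + h) - f x) / of_real h - D = (f (x + h) - f x - h *\<^sub>R D) / of_real h"
        using elim by (simp add: field_simps scaleR_conv_of_real)
      then show ?case by (simp add: norm_divide)
    qed
  qed
  then show ?thesis by (rule LIM_zero_cancel[OF tendsto_norm_zero_cancel])
qed

text \<open>The quotient is the average of the derivative over the segment from x to y.\<close>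

lemma continuous_on_difference_quotient:
  fixes f f' :: "real \<Rightarrow> complex"
  assumes d: "\<And>x. (f has_vector_derivative f' x) (at x)" and c: "continuous_on UNIV f'"
  shows "continuous_on S (\<lambda>(x, y). if x = y then f' x else (f y - f x) / of_real (y - x))"
proof -
  have "continuous_on S (\<lambda>z. integral (cbox 0 1) (\<lambda>r. f' (fst z + r * (snd z - fst z))))"
  proof (rule integral_continuous_on_param)
    show "continuous_on (S \<times> cbox 0 1) (\<lambda>(z, r). f' (fst z + r * (snd z - fst z)))"
      unfolding case_prod_beta
      by (intro continuous_on_compose2[OF c] continuous_intros) auto
  qed
  moreover have "integral (cbox 0 1) (\<lambda>r. f' (x + r * (y - x)))
                   = (if x = y then f' x else (f y - f x) / of_real (y - x))" for x y
  proof (cases "x = y")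
    case False
    have "((\<lambda>r. (y - x) *\<^sub>R f' (x + r * (y - x))) has_integral
            (f (x + 1 * (y - x)) - f (x + 0 * (y - x)))) {0..1}"
    proof (rule fundamental_theorem_of_calculus)
      fix r :: real
      have "((\<lambda>r. x + r * (y - x)) has_vector_derivative (y - x)) (at r within {0..1})"
        by (auto intro!: derivative_eq_intros)
      then have "((f \<circ> (\<lambda>r. x + r * (y - x))) has_vector_derivative (y - x) *\<^sub>R f' (x + r * (y - x))) (at r within {0..1})"
        by (rule vector_diff_chain_within) (rule has_vector_derivative_at_within[OF d])
      then show "((\<lambda>r. f (x + r * (y - x))) has_vector_derivative (y - x) *\<^sub>R f' (x + r * (y - x))) (at r within {0..1})"
        by (simp add: o_def)
    qed simp
    then have "((\<lambda>r. inverse (y - x) *\<^sub>R ((y - x) *\<^sub>R f' (x + r * (y - x)))) has_integral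
            inverse (y - x) *\<^sub>R (f y - f x)) {0..1}"
      by (intro has_integral_cmul) simp
    moreover have "inverse (y - x) *\<^sub>R ((y - x) *\<^sub>R z) = z" for z :: complex
      using False by simp
    moreover have "inverse (y - x) *\<^sub>R (f y - f x) = (f y - f x) / of_real (y - x)"
      unfolding scaleR_conv_of_real of_real_inverse by (simp only: divide_inverse mult.commute)
    ultimately have "((\<lambda>r. f' (x + r * (y - x))) has_integral ((f y - f x) / of_real (y - x))) {0..1}"
      by simp
    then show ?thesis using False by (simp add: integral_unique)
  qed simp
  ultimately show ?thesis by (simp add: case_prod_beta)
qed

lemma convex_diff_vimage:
  "convex S \<Longrightarrow> convex {z :: real \<times> real. snd z - fst z \<in> S}"
  using convex_linear_vimage[of "\<lambda>z :: real \<times> real. snd z - fst z" S]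
  by (simp add: vimage_def linear_compose_sub linear_fst linear_snd)

text \<open>The sides are indexed by all integers with period \<open>m\<close>, and each is defined
  on the whole line although only the unit interval belongs to the loop, so that tangents at corners
  are ordinary derivatives. By \<open>no_cusp\<close> no exterior angle is pi, hence
  \<open>Arg\<close> of the quotient is the exterior angle. In \<open>simple\<close> the parameter
  \<open>x\<close> is the point \<open>frac x\<close> of side \<open>\<lfloor>x\<rfloor>\<close>.
  The case \<open>m = 1\<close> covers a smooth closed curve.\<close>

locale piecewise_loop =
  fixes G G' :: "int \<Rightarrow> real \<Rightarrow> complex" and m :: nat
  assumes m_pos: "0 < m"
    and deriv: "\<And>k x. (G k has_vector_derivative G' k x) (at x)"
    and cont_deriv: "\<And>k. continuous_on UNIV (G' k)"
    and deriv_nonzero: "\<And>k x. G' k x \<noteq> 0"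
    and period: "\<And>k. G (k + int m) = G k" "\<And>k. G' (k + int m) = G' k"
    and joint: "\<And>k. G k 1 = G (k + 1) 0"
    and no_cusp: "\<And>k. G' (k + 1) 0 / G' k 1 \<notin> \<real>\<^sub>\<le>\<^sub>0"
    and simple: "\<And>x y. G \<lfloor>x\<rfloor> (frac x) = G \<lfloor>y\<rfloor> (frac y) \<Longrightarrow> \<exists>n::int. x - y = of_int n * real m"
begin

section \<open>The glued curve and its one-sided tangents\<close>

definition curve :: "real \<Rightarrow> complex" where
  "curve x = G \<lfloor>x\<rfloor> (frac x)"

definition out_dir :: "real \<Rightarrow> complex" where
  "out_dir x = G' \<lfloor>x\<rfloor> (frac x)"

text \<open>With \<open>\<lceil>x\<rceil> - 1\<close> instead of the floor, an integer counts as the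
  end of the preceding side, which makes this the tangent from the left.\<close>

definition in_dir :: "real \<Rightarrow> complex" where
  "in_dir x = G' (\<lceil>x\<rceil> - 1) (x - of_int (\<lceil>x\<rceil> - 1))"

lemma curve_on_side:
  assumes "of_int k \<le> x" "x \<le> of_int k + 1"
  shows "curve x = G k (x - of_int k)"
proof (cases "x = of_int k + 1")
  case True
  then show ?thesis using joint[of k] by (simp add: curve_def frac_def)
next
  case False
  then have "\<lfloor>x\<rfloor> = k" using assms by (simp add: floor_eq_iff)
  then show ?thesis by (simp add: curve_def frac_def)
qed

lemma curve_int [simp]: "curve (of_int k) = G k 0"
  by (simp add: curve_def)

lemma G_period: "G (k + n * int m) = G k"
proof (induction n rule: int_induct[where k = 0])
  case (step1 i)
  then show ?case using period(1)[of "k + i * int m"] by (simp add: algebra_simps)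
next
  case (step2 i)
  then show ?case using period(1)[of "k + (i - 1) * int m"] by (simp add: algebra_simps)
qed simp

lemma curve_period: "curve (x + of_int n * real m) = curve x"
proof -
  have *: "x + of_int n * real m = x + of_int (n * int m)" by simp
  have f: "\<lfloor>x + real_of_int (n * int m)\<rfloor> = \<lfloor>x\<rfloor> + n * int m" by (rule floor_add_int[symmetric])
  have "frac (x + real_of_int (n * int m)) = frac x" unfolding frac_def f by simp
  then show ?thesis unfolding curve_def * f G_period by simp
qed

lemma curve_period1: "curve (x + real m) = curve x"
  using curve_period[of x 1] by simp

lemma curve_neq: "x < y \<Longrightarrow> y < x + real m \<Longrightarrow> curve x \<noteq> curve y"
proof
  assume xy: "x < y" "y < x + real m" and "curve x = curve y"
  then obtain n :: int where n: "y - x = of_int n * real m"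
    using simple[of y x] by (auto simp: curve_def)
  then have "0 < of_int n * real m" "of_int n * real m < 1 * real m"
    using xy unfolding n[symmetric] by auto
  then have "0 < real_of_int n" "real_of_int n < 1"
    using m_pos by (blast intro: zero_less_mult_pos2 of_nat_0_less_iff[THEN iffD2]
        mult_less_cancel_right_pos[THEN iffD1])+
  then show False by simp
qed

lemma continuous_side: "continuous_on S (G k)"
  using deriv by (meson continuous_at_imp_continuous_on has_vector_derivative_continuous)

lemma continuous_curve: "continuous_on S curve"
proof -
  have side: "continuous_on {of_int k..of_int k + 1} curve" for k
  proof -
    have "continuous_on {of_int k..of_int k + 1} (\<lambda>x. G k (x - of_int k))"
      by (intro continuous_on_compose2[OF continuous_side[of UNIV]] continuous_intros) auto
    then show ?thesis by (rule continuous_on_eq) (auto simp: curve_on_side)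
  qed
  have "isCont curve x" for x
  proof -
    define k where "k = \<lfloor>x\<rfloor>"
    have "continuous_on ({of_int (k - 1)..of_int (k - 1) + 1} \<union> {of_int k..of_int k + 1}) curve"
      by (intro continuous_on_closed_Un side) auto
    also have "{of_int (k - 1)..of_int (k - 1) + 1} \<union> {of_int k..of_int k + 1} = {of_int k - 1..of_int k + 1::real}"
      by auto
    finally show ?thesis
      by (rule continuous_on_interior) (simp add: k_def, linarith)
  qed
  then show ?thesis by (simp add: continuous_at_imp_continuous_on)
qed

lemma out_dir_limit: "((\<lambda>t. (curve (x + t) - curve x) / of_real t) \<longlongrightarrow> out_dir x) (at_right 0)"
proof -
  have "((\<lambda>t. (G \<lfloor>x\<rfloor> (frac x + t) - G \<lfloor>x\<rfloor> (frac x)) / of_real t) \<longlongrightarrow> out_dir x) (at_right 0)"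
    unfolding out_dir_def
    by (rule filterlim_at_split[THEN iffD1, THEN conjunct2])
      (rule has_vector_derivative_difference_quotient[OF deriv])
  then show ?thesis
  proof (rule Lim_transform_eventually)
    have "\<forall>\<^sub>F t in at_right 0. t < 1 - frac x"
      using frac_lt_1[of x] by (intro eventually_at_rightI[of 0 "1 - frac x"]) auto
    moreover have "\<forall>\<^sub>F t in at_right (0::real). 0 < t" by (rule eventually_at_right_less)
    ultimately show "\<forall>\<^sub>F t in at_right 0. (G \<lfloor>x\<rfloor> (frac x + t) - G \<lfloor>x\<rfloor> (frac x)) / of_real t
        = (curve (x + t) - curve x) / of_real t"
    proof eventually_elim
      case (elim t)
      then have "curve (x + t) = G \<lfloor>x\<rfloor> (x + t - of_int \<lfloor>x\<rfloor>)"
        by (intro curve_on_side) (auto simp: frac_def, linarith)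
      then show ?case by (simp add: curve_def frac_def algebra_simps)
    qed
  qed
qed

lemma in_dir_limit: "((\<lambda>t. (curve x - curve (x - t)) / of_real t) \<longlongrightarrow> in_dir x) (at_right 0)"
proof -
  define k where "k = \<lceil>x\<rceil> - 1"
  have k: "of_int k < x" "x \<le> of_int k + 1" unfolding k_def by linarith+
  have "((\<lambda>t. (G k (x - of_int k + t) - G k (x - of_int k)) / of_real t) \<longlongrightarrow> in_dir x) (at_left 0)"
    unfolding in_dir_def k_def
    by (rule filterlim_at_split[THEN iffD1, THEN conjunct1])
      (rule has_vector_derivative_difference_quotient[OF deriv])
  then have "((\<lambda>t. (G k (x - of_int k + - t) - G k (x - of_int k)) / of_real (- t)) \<longlongrightarrow> in_dir x) (at_right 0)"
    by (simp add: filterlim_at_left_to_right)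
  then show ?thesis
  proof (rule Lim_transform_eventually)
    have "\<forall>\<^sub>F t in at_right 0. t < x - of_int k"
      using k by (intro eventually_at_rightI[of 0 "x - of_int k"]) auto
    moreover have "\<forall>\<^sub>F t in at_right (0::real). 0 < t" by (rule eventually_at_right_less)
    ultimately show "\<forall>\<^sub>F t in at_right 0. (G k (x - of_int k + - t) - G k (x - of_int k)) / of_real (- t)
        = (curve x - curve (x - t)) / of_real t"
    proof eventually_elim
      case (elim t)
      then have "curve (x - t) = G k (x - t - of_int k)" "curve x = G k (x - of_int k)"
        using k by (auto intro!: curve_on_side)
      then show ?case using elim by (simp add: field_simps)
    qed
  qed
qed

lemma dir_nonzero: "out_dir x \<noteq> 0" "in_dir x \<noteq> 0"
  by (auto simp: out_dir_def in_dir_def deriv_nonzero)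

lemma dir_int: "out_dir (of_int k) = G' k 0" "in_dir (of_int k) = G' (k - 1) 1"
  by (auto simp: out_dir_def in_dir_def)

lemma dir_side:
  assumes "of_int k < x" "x < of_int k + 1"
  shows "out_dir x = G' k (x - of_int k)" "in_dir x = G' k (x - of_int k)"
proof -
  have "\<lfloor>x\<rfloor> = k" "\<lceil>x\<rceil> = k + 1" using assms by (simp_all add: floor_eq_iff ceiling_eq_iff)
  then show "out_dir x = G' k (x - of_int k)" "in_dir x = G' k (x - of_int k)"
    by (auto simp: out_dir_def in_dir_def frac_def)
qed

lemma dir_no_cusp: "out_dir x / in_dir x \<notin> \<real>\<^sub>\<le>\<^sub>0"
proof (cases "x \<in> \<int>")
  case True
  then obtain k where "x = of_int k" by (auto elim: Ints_cases)
  then show ?thesis using no_cusp[of "k - 1"] by (simp add: dir_int)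
next
  case False
  then have "of_int \<lfloor>x\<rfloor> < x" "x < of_int \<lfloor>x\<rfloor> + 1"
    by (metis Ints_of_int of_int_floor_le order_less_le, linarith)
  then have "out_dir x = in_dir x" using dir_side by metis
  then show ?thesis using dir_nonzero[of x] by (auto simp: complex_nonpos_Reals_iff)
qed

text \<open>Carrying a secant halfway around the loop reverses it and changes its argument
  by an odd multiple of \<open>pi\<close>; twice that change is the total rotation of the tangent.\<close>

definition secant_log :: "(real \<times> real \<Rightarrow> complex) \<Rightarrow> int \<Rightarrow> bool" where
  "secant_log L W \<longleftrightarrow> continuous_on {z. snd z - fst z \<in> {0<..<real m}} L \<and>
     (\<forall>s t. s < t \<and> t < s + real m \<longrightarrow>
        exp (L (s, t)) = curve t - curve s \<and> L (t, s + real m) = L (s, t) + of_int W * pi * \<i>)"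

lemma secant_logD:
  assumes "secant_log L W"
  shows "continuous_on {z. snd z - fst z \<in> {0<..<real m}} L"
    and "s < t \<Longrightarrow> t < s + real m \<Longrightarrow> exp (L (s, t)) = curve t - curve s"
    and "s < t \<Longrightarrow> t < s + real m \<Longrightarrow> L (t, s + real m) = L (s, t) + of_int W * pi * \<i>"
  using assms by (auto simp: secant_log_def)

text \<open>The strip is convex and the secant vanishes nowhere on it, which gives a continuous
  logarithm. The map from \<open>(s, t)\<close> to \<open>(t, s + m)\<close> preserves the strip and
  negates the secant, so it changes the logarithm by a constant whose exponential is -1.\<close>

lemma ex_secant_log: "\<exists>L W. secant_log L W"
proof -
  define T where "T = {z. snd z - fst z \<in> {0<..<real m}}"
  have convT: "convex T" unfolding T_def by (rule convex_diff_vimage) simp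
  have "continuous_on T (\<lambda>z. curve (snd z) - curve (fst z))"
    by (intro continuous_intros continuous_on_compose2[OF continuous_curve[of UNIV]]) auto
  then obtain L where L: "continuous_on T L" "\<And>z. z \<in> T \<Longrightarrow> curve (snd z) - curve (fst z) = exp (L z)"
  proof (rule continuous_logarithm_on_contractible)
    show "contractible T" by (rule convex_imp_contractible[OF convT])
    show "curve (snd z) - curve (fst z) \<noteq> 0" if "z \<in> T" for z
      using curve_neq[of "fst z" "snd z"] that by (auto simp: T_def)
  qed blast
  have swap: "(snd z, fst z + real m) \<in> T" if "z \<in> T" for z using that by (auto simp: T_def)
  obtain d where d: "\<And>z. z \<in> T \<Longrightarrow> L (snd z, fst z + real m) = L z + d"
  proof (rule continuous_logs_differ_by_constant)
    show "connected T" by (rule convex_connected[OF convT])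
    show "continuous_on T (\<lambda>z. L (snd z, fst z + real m))"
      by (intro continuous_on_compose2[OF L(1)] continuous_intros) (use swap in auto)
    show "exp (L (snd z, fst z + real m)) = - 1 * exp (L z)" if "z \<in> T" for z
      unfolding L(2)[OF that, symmetric] L(2)[OF swap[OF that], symmetric] by (simp add: curve_period1)
  qed (use L in auto)
  have z0: "(0, real m / 2) \<in> T" using m_pos by (simp add: T_def)
  have "exp (L (0, real m / 2)) * exp d = exp (L (real m / 2, real m))"
    using d[OF z0] by (simp add: exp_add)
  also have "\<dots> = - exp (L (0, real m / 2))"
    using L(2)[OF z0, symmetric] L(2)[OF swap[OF z0], symmetric] curve_period1[of 0] by simp
  finally have "exp (L (0, real m / 2)) * exp d = - exp (L (0, real m / 2))" .
  then have "exp d = - 1" by (metis exp_not_eq_zero mult.right_neutral mult_left_cancel mult_minus_right)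
  then have "exp (d - pi * \<i>) = 1" by (simp add: exp_diff exp_pi_i)
  then obtain n :: int where "Re (d - pi * \<i>) = 0" "Im (d - pi * \<i>) = of_int (2 * n) * pi"
    unfolding exp_eq_1 by blast
  then have "d - pi * \<i> = of_int (2 * n) * pi * \<i>"
    by (auto simp: complex_eq_iff)
  then have "d = of_int (2 * n + 1) * pi * \<i>" by (simp add: algebra_simps)
  then have "secant_log L (2 * n + 1)"
    unfolding secant_log_def using L d by (auto simp: T_def)
  then show ?thesis by blast
qed

text \<open>The secant from \<open>x - s\<close> to \<open>x + t\<close> is the sum of the chords
  into and out of \<open>x\<close>, so \<open>cone_log\<close> applies to the secant logarithm in
  the coordinates \<open>(s, t)\<close>. At a smooth point the argument on the right tends to 0, at
  a corner to the exterior angle.\<close>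

lemma secant_log_corner:
  assumes "secant_log L W"
  shows "\<forall>\<^sub>F t in at_right 0. Im (L (x, x + t)) - Im (L (x - t, x))
           = Arg ((curve (x + t) - curve x) / (curve x - curve (x - t)))"
proof -
  obtain d where d: "0 < d" "\<And>(g :: real \<times> real \<Rightarrow> complex) a b s t. \<lbrakk>continuous_on ({0..a} \<times> {0..b} - {(0, 0)}) g;
           \<And>s t. \<lbrakk>0 \<le> s; s \<le> a; 0 \<le> t; t \<le> b; s \<noteq> 0 \<or> t \<noteq> 0\<rbrakk>
              \<Longrightarrow> exp (g (s, t)) = (curve x - curve (x - s)) + (curve (x + t) - curve x);
           0 < s; s \<le> a; 0 < t; t \<le> b; a \<le> d; b \<le> d\<rbrakk>
          \<Longrightarrow> Im (g (0, t)) - Im (g (s, 0)) = Arg ((curve (x + t) - curve x) / (curve x - curve (x - s)))"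
    by (rule cone_log[OF in_dir_limit _ out_dir_limit _ dir_no_cusp]) auto
  \<comment> \<open>With \<open>s\<close> and \<open>t\<close> at most \<open>m / 3\<close>, the
    parameter difference \<open>s + t\<close> stays below \<open>m\<close>, inside the
    strip.\<close>
  define a where "a = min d (real m / 3)"
  have a: "0 < a" "a \<le> d" "a \<le> real m / 3" using d m_pos by (auto simp: a_def)
  note L = secant_logD[OF assms]
  have "Im (L (x, x + t)) - Im (L (x - t, x)) = Arg ((curve (x + t) - curve x) / (curve x - curve (x - t)))"
    if t: "0 < t" "t < a" for t
  proof -
    have "Im ((\<lambda>z. L (x - fst z, x + snd z)) (0, t)) - Im ((\<lambda>z. L (x - fst z, x + snd z)) (t, 0))
        = Arg ((curve (x + t) - curve x) / (curve x - curve (x - t)))"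
    proof (rule d(2))
      show "continuous_on ({0..a} \<times> {0..a} - {(0, 0)}) (\<lambda>z. L (x - fst z, x + snd z))"
      proof (intro continuous_on_compose2[OF L(1)] continuous_intros image_subsetI)
        fix z assume "z \<in> {0..a} \<times> {0..a} - {(0::real, 0::real)}"
        then have "0 \<le> fst z" "0 \<le> snd z" "fst z \<le> a" "snd z \<le> a" "fst z \<noteq> 0 \<or> snd z \<noteq> 0"
          by (auto simp: prod_eq_iff)
        then show "(x - fst z, x + snd z) \<in> {z. snd z - fst z \<in> {0<..<real m}}"
          using a m_pos by auto
      qed
    qed (use t a m_pos in \<open>auto simp: L(2)\<close>)
    then show ?thesis by simp
  qed
  then show ?thesis using a by (intro eventually_at_rightI[of 0 a]) auto
qed

text \<open>Within one side the secant divided by the parameter difference extends to the diagonal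
  by the derivative. Its logarithm \<open>M\<close> has the same imaginary part as \<open>L\<close>
  up to a constant, because the divisor is positive, and on the diagonal it follows the tangent
  angle. The same \<open>c\<close> at both ends is the point: the secant argument changes along the
  side by \<open>th 1 - th 0\<close>.\<close>

lemma secant_log_side:
  assumes sl: "secant_log L W"
    and th: "continuous_on {0..1} th" "\<And>x. x \<in> {0..1} \<Longrightarrow> G' k x = of_real (norm (G' k x)) * cis (th x)"
  shows "\<exists>c. ((\<lambda>t. Im (L (of_int k, of_int k + t))) \<longlongrightarrow> c + th 0) (at_right 0) \<and>
             ((\<lambda>t. Im (L (of_int k + 1 - t, of_int k + 1))) \<longlongrightarrow> c + th 1) (at_right 0)"
proof -
  note L = secant_logD[OF sl]
  have m1: "1 \<le> real m" using m_pos by simp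
  define H where "H = (\<lambda>(x, y). if x = y then G' k x else (G k y - G k x) / of_real (y - x))"
  \<comment> \<open>The difference 1, that is the point \<open>(0, 1)\<close>, is left out because
    for \<open>m = 1\<close> the side closes up and \<open>H\<close> vanishes there.\<close>
  define D :: "(real \<times> real) set" where "D = {0..1} \<times> {0..1} \<inter> {z. snd z - fst z \<in> {0..<1}}"
  define E :: "(real \<times> real) set" where "E = {0..1} \<times> {0..1} \<inter> {z. snd z - fst z \<in> {0<..<1}}"
  have convD: "convex D" unfolding D_def
    by (intro convex_Int convex_Times convex_diff_vimage) auto
  have convE: "convex E" unfolding E_def
    by (intro convex_Int convex_Times convex_diff_vimage) auto
  have ED: "E \<subseteq> D" by (auto simp: D_def E_def)
  have G: "G k y = curve (of_int k + y)" if "y \<in> {0..1}" for y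
    using that by (simp add: curve_on_side[of k])
  have "continuous_on D H" unfolding H_def
    by (rule continuous_on_difference_quotient[OF deriv cont_deriv])
  then obtain M where M: "continuous_on D M" "\<And>z. z \<in> D \<Longrightarrow> H z = exp (M z)"
  proof (rule continuous_logarithm_on_contractible)
    show "contractible D" by (rule convex_imp_contractible[OF convD])
    fix z assume z: "z \<in> D"
    show "H z \<noteq> 0"
    proof (cases "fst z = snd z")
      case True
      then show ?thesis by (simp add: H_def case_prod_beta deriv_nonzero)
    next
      case False
      then have "curve (of_int k + fst z) \<noteq> curve (of_int k + snd z)"
        using z m1 by (intro curve_neq) (auto simp: D_def)
      then have "G k (fst z) \<noteq> G k (snd z)" using z by (subst (1 2) G) (auto simp: D_def)
      then show ?thesis using False by (simp add: H_def case_prod_beta)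
    qed
  qed blast
  obtain d where d: "\<And>z. z \<in> E \<Longrightarrow> L (of_int k + fst z, of_int k + snd z) = M z + of_real (ln (snd z - fst z)) + d"
  proof (rule continuous_logs_differ_by_constant)
    show "connected E" by (rule convex_connected[OF convE])
    show "continuous_on E (\<lambda>z. L (of_int k + fst z, of_int k + snd z))"
      by (intro continuous_on_compose2[OF L(1)] continuous_intros) (use m1 in \<open>auto simp: E_def\<close>)
    show "continuous_on E (\<lambda>z. M z + of_real (ln (snd z - fst z)))"
      by (intro continuous_intros continuous_on_subset[OF M(1) ED]) (auto simp: E_def)
    fix z assume z: "z \<in> E"
    then have lt: "fst z < snd z" "snd z < fst z + 1" "fst z \<in> {0..1}" "snd z \<in> {0..1}" by (auto simp: E_def)
    have "exp (L (of_int k + fst z, of_int k + snd z)) = G k (snd z) - G k (fst z)"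
      using lt m1 by (simp add: L(2) G del: curve_int)
    also have "\<dots> = H z * of_real (snd z - fst z)"
      using lt by (simp add: H_def case_prod_beta)
    also have "\<dots> = exp (M z) * of_real (exp (ln (snd z - fst z)))"
      using lt z ED by (subst M(2)) auto
    finally show "exp (L (of_int k + fst z, of_int k + snd z)) = 1 * exp (M z + of_real (ln (snd z - fst z)))"
      by (simp only: exp_add exp_of_real mult_1)
  qed auto
  have diag: "(x, x) \<in> D" if "x \<in> {0..1}" for x using that by (auto simp: D_def)
  obtain e where e: "\<And>x. x \<in> {0..1} \<Longrightarrow> M (x, x) = (of_real (ln (norm (G' k x))) + \<i> * of_real (th x)) + e"
  proof (rule continuous_logs_differ_by_constant)
    show "continuous_on {0..1} (\<lambda>x. M (x, x))"
      by (intro continuous_on_compose2[OF M(1)] continuous_intros) (use diag in auto)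
    show "continuous_on {0..1} (\<lambda>x. of_real (ln (norm (G' k x))) + \<i> * of_real (th x))"
      by (intro continuous_intros continuous_on_subset[OF cont_deriv] th) (auto simp: deriv_nonzero)
    fix x :: real assume x: "x \<in> {0..1}"
    have "exp (M (x, x)) = G' k x" using M(2)[OF diag[OF x]] by (simp add: H_def)
    also have "\<dots> = exp (of_real (ln (norm (G' k x)))) * exp (\<i> * of_real (th x))"
      by (subst th(2)[OF x]) (simp add: exp_of_real deriv_nonzero cis_conv_exp)
    finally show "exp (M (x, x)) = 1 * exp (of_real (ln (norm (G' k x))) + \<i> * of_real (th x))"
      by (simp add: exp_add)
  qed auto
  define c where "c = Im d + Im e"
  have pos: "\<forall>\<^sub>F t in at_right (0::real). t \<in> {0<..<1}"
    by (intro eventually_at_rightI[of 0 1]) auto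
  have "((\<lambda>t. Im (M (0, t)) + Im d) \<longlongrightarrow> Im (M (0, 0)) + Im d) (at_right 0)"
  proof (intro tendsto_intros continuous_on_tendsto_compose[OF M(1)])
    show "(0, 0) \<in> D" by (auto simp: D_def)
    show "\<forall>\<^sub>F t in at_right 0. (0, t) \<in> D" using pos by eventually_elim (auto simp: D_def)
  qed
  then have 1: "((\<lambda>t. Im (L (of_int k, of_int k + t))) \<longlongrightarrow> Im (M (0, 0)) + Im d) (at_right 0)"
  proof (rule Lim_transform_eventually)
    show "\<forall>\<^sub>F t in at_right 0. Im (M (0, t)) + Im d = Im (L (of_int k, of_int k + t))"
      using pos
    proof eventually_elim
      case (elim t)
      then show ?case using d[of "(0, t)"] by (simp add: E_def)
    qed
  qed
  have "((\<lambda>t. Im (M (1 - t, 1)) + Im d) \<longlongrightarrow> Im (M (1 - 0, 1)) + Im d) (at_right 0)"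
  proof (intro tendsto_intros continuous_on_tendsto_compose[OF M(1)])
    show "(1 - 0, 1) \<in> D" by (auto simp: D_def)
    show "\<forall>\<^sub>F t in at_right 0. (1 - t, 1) \<in> D" using pos by eventually_elim (auto simp: D_def)
  qed
  then have 2: "((\<lambda>t. Im (L (of_int k + 1 - t, of_int k + 1))) \<longlongrightarrow> Im (M (1 - 0, 1)) + Im d) (at_right 0)"
  proof (rule Lim_transform_eventually)
    show "\<forall>\<^sub>F t in at_right 0. Im (M (1 - t, 1)) + Im d = Im (L (of_int k + 1 - t, of_int k + 1))"
      using pos
    proof eventually_elim
      case (elim t)
      then show ?case using d[of "(1 - t, 1)"] by (simp add: E_def algebra_simps)
    qed
  qed
  show ?thesis using 1 2 e[of 0] e[of 1] by (intro exI[of _ c]) (simp add: c_def algebra_simps)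
qed

text \<open>The limit \<open>r k\<close> of the secant argument just after vertex \<open>k\<close>
  increases, up to the next vertex, by the turning of side \<open>k\<close> and the exterior angle
  at its end. Summing over one period telescopes.\<close>

theorem rotation_sum:
  assumes sl: "secant_log L W"
    and th: "\<And>k. continuous_on {0..1} (th k)"
      "\<And>k x. x \<in> {0..1} \<Longrightarrow> G' k x = of_real (norm (G' k x)) * cis (th k x)"
  shows "2 * pi * of_int W = (\<Sum>k\<in>{0..<int m}. th k 1 - th k 0 + Arg (G' (k + 1) 0 / G' k 1))"
proof -
  have "\<exists>c. \<forall>k. ((\<lambda>t. Im (L (of_int k, of_int k + t))) \<longlongrightarrow> c k + th k 0) (at_right 0) \<and>
             ((\<lambda>t. Im (L (of_int k + 1 - t, of_int k + 1))) \<longlongrightarrow> c k + th k 1) (at_right 0)"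
    using secant_log_side[OF sl th] by (intro choice allI)
  then obtain c where c1: "\<And>k. ((\<lambda>t. Im (L (of_int k, of_int k + t))) \<longlongrightarrow> c k + th k 0) (at_right 0)"
    and c2: "\<And>k. ((\<lambda>t. Im (L (of_int k + 1 - t, of_int k + 1))) \<longlongrightarrow> c k + th k 1) (at_right 0)"
    by blast
  define r where "r k = c k + th k 0" for k
  have step: "r (k + 1) - r k = th k 1 - th k 0 + Arg (G' (k + 1) 0 / G' k 1)" for k
  proof -
    define x where "x = real_of_int (k + 1)"
    have "((\<lambda>t. Im (L (x, x + t)) - Im (L (x - t, x))) \<longlongrightarrow> (c (k + 1) + th (k + 1) 0) - (c k + th k 1)) (at_right 0)"
      using c1[of "k + 1"] c2[of k] by (intro tendsto_diff) (simp_all add: x_def add_ac)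
    then have "((\<lambda>t. Arg ((curve (x + t) - curve x) / (curve x - curve (x - t)))) \<longlongrightarrow>
        (c (k + 1) + th (k + 1) 0) - (c k + th k 1)) (at_right 0)"
      by (rule Lim_transform_eventually) (rule secant_log_corner[OF sl])
    moreover have "((\<lambda>t. Arg ((curve (x + t) - curve x) / (curve x - curve (x - t)))) \<longlongrightarrow> Arg (out_dir x / in_dir x)) (at_right 0)"
    proof (rule Lim_transform_eventually)
      show "((\<lambda>t. Arg (((curve (x + t) - curve x) / of_real t) / ((curve x - curve (x - t)) / of_real t))) \<longlongrightarrow> Arg (out_dir x / in_dir x)) (at_right 0)"
        by (intro tendsto_intros out_dir_limit in_dir_limit dir_nonzero dir_no_cusp)
      show "\<forall>\<^sub>F t in at_right 0. Arg (((curve (x + t) - curve x) / of_real t) / ((curve x - curve (x - t)) / of_real t))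
          = Arg ((curve (x + t) - curve x) / (curve x - curve (x - t)))"
        using eventually_at_right_less[of "0::real"] by eventually_elim simp
    qed
    ultimately have "(c (k + 1) + th (k + 1) 0) - (c k + th k 1) = Arg (out_dir x / in_dir x)"
      by (rule tendsto_unique[rotated]) simp
    also have "out_dir x / in_dir x = G' (k + 1) 0 / G' k 1"
      unfolding x_def dir_int by simp
    finally show ?thesis by (simp add: r_def)
  qed
  \<comment> \<open>One period is two half turns, from \<open>(0, t)\<close> to
    \<open>(t, m)\<close> and on to \<open>(m, m + t)\<close>, each of which adds pi times
    \<open>W\<close>.\<close>
  have shift: "r (int m) = r 0 + 2 * pi * of_int W"
  proof -
    have "((\<lambda>t. Im (L (0, t)) + 2 * pi * of_int W) \<longlongrightarrow> (c 0 + th 0 0) + 2 * pi * of_int W) (at_right 0)"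
      using c1[of 0] by (intro tendsto_intros) simp
    then have "((\<lambda>t. Im (L (real m, real m + t))) \<longlongrightarrow> (c 0 + th 0 0) + 2 * pi * of_int W) (at_right 0)"
    proof (rule Lim_transform_eventually)
      have "\<forall>\<^sub>F t in at_right 0. t < real m" using m_pos by (intro eventually_at_rightI[of 0 "real m"]) auto
      then show "\<forall>\<^sub>F t in at_right 0. Im (L (0, t)) + 2 * pi * of_int W = Im (L (real m, real m + t))"
        using eventually_at_right_less[of "0::real"]
      proof eventually_elim
        case (elim t)
        have "L (t, 0 + real m) = L (0, t) + of_int W * pi * \<i>"
          using elim by (intro secant_logD(3)[OF sl]) auto
        moreover have "L (real m, t + real m) = L (t, 0 + real m) + of_int W * pi * \<i>"
          using elim secant_logD(3)[OF sl, of t "real m"] by simp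
        ultimately show ?case by (simp add: algebra_simps)
      qed
    qed
    moreover have "((\<lambda>t. Im (L (real m, real m + t))) \<longlongrightarrow> r (int m)) (at_right 0)"
      using c1[of "int m"] by (simp add: r_def)
    ultimately show ?thesis by (simp add: r_def tendsto_unique[OF trivial_limit_at_right_real])
  qed
  have "(\<Sum>k\<in>{0..<int n}. r (k + 1) - r k) = r (int n) - r 0" for n
  proof (induction n)
    case (Suc n)
    have "{0..<int (Suc n)} = insert (int n) {0..<int n}" by auto
    then show ?case using Suc by (simp add: add_ac)
  qed simp
  from this[of m] show ?thesis using shift by (simp add: step)
qed

end

section \<open>Winding numbers beside a loop\<close>

text \<open>Reflection in the vertical midline carries one punctured rectangle to the other, and the
  set is the intersection of both.\<close>

lemma convex_rectangle_minus_vertices: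
  "convex ({0..a} \<times> {0..b} - {(0::real, 0::real)} - {(a, 0)})"
proof -
  let ?A = "{0..a} \<times> {0..b} - {(0::real, 0::real)}"
  have "convex ((+) (a, 0) ` ((\<lambda>z. (- fst z, snd z)) ` ?A))"
    by (intro convex_translation convex_linear_image convex_square_minus_vertex linearI) auto
  also have "(+) (a, 0) ` ((\<lambda>z. (- fst z, snd z)) ` ?A) = {0..a} \<times> {0..b} - {(a, 0)}"
  proof (intro equalityI subsetI)
    fix z assume z: "z \<in> {0..a} \<times> {0..b} - {(a, 0)}"
    then have "(a - fst z, snd z) \<in> ?A" by auto
    then show "z \<in> (+) (a, 0) ` ((\<lambda>z. (- fst z, snd z)) ` ?A)"
      by (intro image_eqI[of _ _ "(- (a - fst z), snd z)"] image_eqI[of _ _ "(a - fst z, snd z)"]) auto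
  qed auto
  finally have "convex (?A \<inter> ({0..a} \<times> {0..b} - {(a, 0)}))"
    by (intro convex_Int convex_square_minus_vertex)
  moreover have "?A \<inter> ({0..a} \<times> {0..b} - {(a, 0)}) = ?A - {(a, 0)}" by auto
  ultimately show ?thesis by simp
qed

context piecewise_loop
begin

text \<open>The base point is left free so that the point beside which a winding number is computed
  can be placed at the two ends of the unit interval.\<close>

definition loop_at :: "real \<Rightarrow> real \<Rightarrow> complex" where
  "loop_at x t = curve (x + real m * t)"

lemma path_loop_at: "path (loop_at x)"
  unfolding path_def loop_at_def
  by (intro continuous_on_compose2[OF continuous_curve[of UNIV]] continuous_intros) auto

lemma loop_at_closed: "pathfinish (loop_at x) = pathstart (loop_at x)"
  by (simp add: pathfinish_def pathstart_def loop_at_def curve_period1)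

lemma path_image_loop_at: "path_image (loop_at x) = range curve"
proof (intro equalityI subsetI)
  fix z assume "z \<in> range curve"
  then obtain y where y: "z = curve y" by auto
  define t where "t = frac ((y - x) / real m)"
  have "x + real m * t = y + of_int (- \<lfloor>(y - x) / real m\<rfloor>) * real m"
    using m_pos by (simp add: t_def frac_def field_simps)
  then have "loop_at x t = z" unfolding loop_at_def y by (metis curve_period)
  moreover have "t \<in> {0..1}" by (simp add: t_def frac_ge_0 less_imp_le[OF frac_lt_1])
  ultimately show "z \<in> path_image (loop_at x)" by (auto simp: path_image_def)
qed (auto simp: path_image_def loop_at_def)

lemma simple_path_loop_at: "simple_path (loop_at x)"
  unfolding simple_path_def loop_free_def
proof (intro conjI path_loop_at ballI impI)
  fix s t :: real assume st: "s \<in> {0..1}" "t \<in> {0..1}" and eq: "loop_at x s = loop_at x t"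
  obtain n :: int where "(x + real m * s) - (x + real m * t) = of_int n * real m"
    using simple eq unfolding loop_at_def curve_def by blast
  then have "real m * (s - t) = real m * of_int n" by (simp add: algebra_simps)
  then have n: "s - t = of_int n" using m_pos by simp
  then have "n \<le> 1" "- 1 \<le> n" using st by simp_all
  then have "n = 0 \<or> n = 1 \<or> n = - 1" by auto
  then show "s = t \<or> s = 0 \<and> t = 1 \<or> s = 1 \<and> t = 0" using n st by auto
qed

text \<open>The two cones at the ends of the rectangle turn the half-turn of the secant log, which is
  \<open>pi * W\<close>, into the winding number about a point leaving the curve to either side.\<close>

lemma winding_number_beside:
  fixes \<zeta> :: "real \<Rightarrow> complex" and \<sigma> :: real
  assumes sl: "secant_log L W"
    and z: "0 < e0" "continuous_on {0..e0} \<zeta>" "\<zeta> 0 = curve x"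
    and w: "((\<lambda>t. (\<zeta> t - \<zeta> 0) / of_real t) \<longlongrightarrow> w) (at_right 0)"
    and side: "0 < \<sigma> * Im (w / in_dir x)" "0 < \<sigma> * Im (w / out_dir x)" "\<sigma> = 1 \<or> \<sigma> = - 1"
  shows "\<forall>\<^sub>F e in at_right 0. \<zeta> e \<notin> range curve \<and>
           2 * winding_number (loop_at x) (\<zeta> e) = of_real (of_int W + \<sigma>)"
proof -
  define p where "p t = curve (x + t) - curve x" for t
  define p' where "p' t = curve (x - t) - curve x" for t
  define q where "q t = - (\<zeta> t - \<zeta> 0)" for t
  have p_lim: "((\<lambda>t. p t / of_real t) \<longlongrightarrow> out_dir x) (at_right 0)"
    unfolding p_def by (rule out_dir_limit)
  have p'_lim: "((\<lambda>t. p' t / of_real t) \<longlongrightarrow> - in_dir x) (at_right 0)"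
    using tendsto_minus[OF in_dir_limit] by (simp add: p'_def minus_divide_left)
  have q_lim: "((\<lambda>t. q t / of_real t) \<longlongrightarrow> - w) (at_right 0)"
    using tendsto_minus[OF w] by (simp add: q_def minus_divide_left)
  have np: "- w / out_dir x \<notin> \<real>\<^sub>\<le>\<^sub>0" "- w / - in_dir x \<notin> \<real>\<^sub>\<le>\<^sub>0"
    using side by (auto simp: complex_nonpos_Reals_iff)
  obtain d1 where d1: "0 < d1"
    "\<And>s t. \<lbrakk>0 \<le> s; s \<le> d1; 0 \<le> t; t \<le> d1; s \<noteq> 0 \<or> t \<noteq> 0\<rbrakk> \<Longrightarrow> p s + q t \<noteq> 0"
    "\<And>(g :: real \<times> real \<Rightarrow> complex) a b s t. \<lbrakk>continuous_on ({0..a} \<times> {0..b} - {(0, 0)}) g;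
           \<And>s t. \<lbrakk>0 \<le> s; s \<le> a; 0 \<le> t; t \<le> b; s \<noteq> 0 \<or> t \<noteq> 0\<rbrakk> \<Longrightarrow> exp (g (s, t)) = p s + q t;
           0 < s; s \<le> a; 0 < t; t \<le> b; a \<le> d1; b \<le> d1\<rbrakk> \<Longrightarrow> Im (g (0, t)) - Im (g (s, 0)) = Arg (q t / p s)"
    by (rule cone_log[OF p_lim _ q_lim _ np(1)]) (auto simp: p_def q_def)
  obtain d2 where d2: "0 < d2"
    "\<And>s t. \<lbrakk>0 \<le> s; s \<le> d2; 0 \<le> t; t \<le> d2; s \<noteq> 0 \<or> t \<noteq> 0\<rbrakk> \<Longrightarrow> p' s + q t \<noteq> 0"
    "\<And>(g :: real \<times> real \<Rightarrow> complex) a b s t. \<lbrakk>continuous_on ({0..a} \<times> {0..b} - {(0, 0)}) g;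
           \<And>s t. \<lbrakk>0 \<le> s; s \<le> a; 0 \<le> t; t \<le> b; s \<noteq> 0 \<or> t \<noteq> 0\<rbrakk> \<Longrightarrow> exp (g (s, t)) = p' s + q t;
           0 < s; s \<le> a; 0 < t; t \<le> b; a \<le> d2; b \<le> d2\<rbrakk> \<Longrightarrow> Im (g (0, t)) - Im (g (s, 0)) = Arg (q t / p' s)"
    by (rule cone_log[OF p'_lim _ q_lim _ np(2)]) (auto simp: p'_def q_def)
  define d where "d = Min {d1, d2, e0, real m / 3}"
  have d: "0 < d" "d \<le> d1" "d \<le> d2" "d \<le> e0" "d \<le> real m / 3"
    using d1(1) d2(1) z(1) m_pos by (auto simp: d_def)
  let ?K = "curve ` {x + d..x + real m - d}"
  have "compact ?K" by (intro compact_continuous_image continuous_curve) auto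
  moreover have "curve x \<notin> ?K"
  proof
    assume "curve x \<in> ?K"
    then obtain y where "curve x = curve y" "x + d \<le> y" "y \<le> x + real m - d" by auto
    then show False using curve_neq[of x y] d by auto
  qed
  ultimately obtain rho where rho: "0 < rho" "\<And>y. y \<in> ?K \<Longrightarrow> rho \<le> dist (curve x) y"
    using separate_point_closed[of ?K "curve x"] by (auto intro: compact_imp_closed)
  have "continuous (at 0 within {0..e0}) \<zeta>" using z by (auto simp: continuous_on_eq_continuous_within)
  then obtain e2 where e2: "0 < e2" "\<And>t. t \<in> {0..e0} \<Longrightarrow> dist t 0 < e2 \<Longrightarrow> dist (\<zeta> t) (\<zeta> 0) < rho"
    using rho(1) unfolding continuous_within_eps_delta by blast
  define e1 where "e1 = min d (e2 / 2)"
  have e1: "0 < e1" "e1 \<le> d" "e1 < e2" using d(1) e2(1) by (auto simp: e1_def)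
  define F where "F z = curve (x + fst z) - \<zeta> (snd z)" for z
  \<comment> \<open>The removed vertices are zeros of \<open>F\<close>: both stand for the base
    point of the loop, from which \<open>\<zeta>\<close> starts.\<close>
  define R where "R = {0..real m} \<times> {0..e1} - {(0::real, 0::real)} - {(real m, 0)}"
  have convR: "convex R" unfolding R_def by (rule convex_rectangle_minus_vertices)
  have Fp: "F (s, t) = p s + q t" for s t by (simp add: F_def p_def q_def z(3))
  have Fp': "F (real m - s, t) = p' s + q t" for s t
    using curve_period1[of "x - s"] by (simp add: F_def p'_def q_def z(3) algebra_simps)
  \<comment> \<open>Loop parameters within \<open>d\<close> of either end are covered by the two
    cones. The rest of the loop keeps distance \<open>rho\<close> from the base point, while
    \<open>\<zeta> t\<close> is nearer than that for \<open>t \<le> e1\<close>.\<close>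
  have F_nz: "F z \<noteq> 0" if zR: "z \<in> R" for z
  proof -
    obtain s t where z_eq: "z = (s, t)" by (cases z)
    have st: "0 \<le> s" "s \<le> real m" "0 \<le> t" "t \<le> e1" "s \<noteq> 0 \<or> t \<noteq> 0" "s \<noteq> real m \<or> t \<noteq> 0"
      using zR by (auto simp: z_eq R_def)
    consider "s \<le> d" | "real m - s \<le> d" | "d \<le> s" "s \<le> real m - d" by linarith
    then show ?thesis
    proof cases
      case 1
      then show ?thesis using d1(2)[of s t] st d e1 by (simp add: z_eq Fp)
    next
      case 2
      then show ?thesis using d2(2)[of "real m - s" t] st d e1 Fp'[of "real m - s" t] by (simp add: z_eq)
    next
      case 3
      then have "rho \<le> dist (curve x) (curve (x + s))" by (intro rho(2)) auto
      moreover have "dist (\<zeta> t) (\<zeta> 0) < rho" using st d e1 by (intro e2(2)) auto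
      ultimately have "curve (x + s) \<noteq> \<zeta> t" using z(3) by (auto simp: dist_commute)
      then show ?thesis by (simp add: z_eq F_def)
    qed
  qed
  have "continuous_on R F" unfolding F_def
    by (intro continuous_intros continuous_on_compose2[OF continuous_curve[of UNIV]] continuous_on_compose2[OF z(2)])
      (use e1 d in \<open>auto simp: R_def\<close>)
  then obtain M where M: "continuous_on R M" "\<And>z. z \<in> R \<Longrightarrow> F z = exp (M z)"
    by (rule continuous_logarithm_on_contractible[OF _ convex_imp_contractible[OF convR] F_nz]) blast+
  have near0: "Im (M (0, t)) - Im (M (s, 0)) = Arg (q t / p s)" if "0 < s" "s \<le> d" "0 < t" "t \<le> e1" for s t
  proof (rule d1(3))
    show "continuous_on ({0..d} \<times> {0..e1} - {(0, 0)}) M"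
      by (rule continuous_on_subset[OF M(1)]) (use d m_pos in \<open>auto simp: R_def\<close>)
    show "exp (M (s, t)) = p s + q t" if "0 \<le> s" "s \<le> d" "0 \<le> t" "t \<le> e1" "s \<noteq> 0 \<or> t \<noteq> 0" for s t
      using that d m_pos by (subst Fp[symmetric], subst M(2)) (auto simp: R_def)
  qed (use that d e1 in auto)
  have nearm: "Im (M (real m, t)) - Im (M (real m - s, 0)) = Arg (q t / p' s)" if "0 < s" "s \<le> d" "0 < t" "t \<le> e1" for s t
  proof -
    have "Im ((\<lambda>z. M (real m - fst z, snd z)) (0, t)) - Im ((\<lambda>z. M (real m - fst z, snd z)) (s, 0)) = Arg (q t / p' s)"
    proof (rule d2(3))
      show "continuous_on ({0..d} \<times> {0..e1} - {(0, 0)}) (\<lambda>z. M (real m - fst z, snd z))"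
        by (intro continuous_on_compose2[OF M(1)] continuous_intros) (use d m_pos in \<open>auto simp: R_def\<close>)
      show "exp (M (real m - fst (s, t), snd (s, t))) = p' s + q t"
        if "0 \<le> s" "s \<le> d" "0 \<le> t" "t \<le> e1" "s \<noteq> 0 \<or> t \<noteq> 0" for s t
        using that d m_pos by (subst Fp'[symmetric], subst M(2)) (auto simp: R_def)
    qed (use that d e1 in auto)
    then show ?thesis by simp
  qed
  note L = secant_logD[OF sl]
  \<comment> \<open>On the bottom edge \<open>F\<close> is the secant from the base point, so there
    \<open>M\<close> is the secant logarithm up to a constant.\<close>
  obtain c where c: "\<And>s. s \<in> {0<..<real m} \<Longrightarrow> M (s, 0) = L (x, x + s) + c"
  proof (rule continuous_logs_differ_by_constant)
    show "connected {0<..<real m}" by simp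
    show "continuous_on {0<..<real m} (\<lambda>s. M (s, 0))"
      by (intro continuous_on_compose2[OF M(1)] continuous_intros) (use e1 in \<open>auto simp: R_def\<close>)
    show "continuous_on {0<..<real m} (\<lambda>s. L (x, x + s))"
      by (intro continuous_on_compose2[OF L(1)] continuous_intros) auto
    fix s :: real assume s: "s \<in> {0<..<real m}"
    then have "exp (M (s, 0)) = F (s, 0)" using e1 by (subst M(2)) (auto simp: R_def)
    also have "\<dots> = exp (L (x, x + s))" using s by (subst L(2)) (auto simp: F_def z(3))
    finally show "exp (M (s, 0)) = 1 * exp (L (x, x + s))" by simp
  qed blast
  have key: "2 * winding_number (loop_at x) (\<zeta> e) = of_real (of_int W + \<sigma>)" "\<zeta> e \<notin> range curve"
    if e: "0 < e" "e < e1" and es: "0 < \<sigma> * Im ((\<zeta> e - \<zeta> 0) / in_dir x)" "0 < \<sigma> * Im ((\<zeta> e - \<zeta> 0) / out_dir x)" for e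
  proof -
    have nz: "curve y \<noteq> \<zeta> e" for y
    proof
      assume "curve y = \<zeta> e"
      then have "\<zeta> e \<in> path_image (loop_at x)" by (metis path_image_loop_at rangeI)
      then obtain t where "t \<in> {0..1}" "\<zeta> e = loop_at x t" by (auto simp: path_image_def)
      then have "F (real m * t, e) = 0" by (simp add: F_def loop_at_def)
      moreover have "(real m * t, e) \<in> R"
        using \<open>t \<in> {0..1}\<close> e m_pos by (auto simp: R_def mult_left_le)
      ultimately show False using F_nz by blast
    qed
    then show nin: "\<zeta> e \<notin> range curve" by fastforce
    have "2 * pi * \<i> * winding_number (loop_at x) (\<zeta> e) = M (real m * 1, e) - M (real m * 0, e)"
    proof (rule winding_number_eq_log_change)
      have sub: "(real m * t, e) \<in> R" if "t \<in> {0..1}" for t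
        using that e by (auto simp: R_def mult_left_le)
      show "continuous_on {0..1} (\<lambda>t. M (real m * t, e))"
        by (intro continuous_on_compose2[OF M(1)] continuous_intros) (use sub in auto)
      show "loop_at x t = \<zeta> e + exp (M (real m * t, e))" if "t \<in> {0..1}" for t
        using M(2)[OF sub[OF that], symmetric] by (simp add: F_def loop_at_def)
    qed
    then have "Im (2 * pi * \<i> * winding_number (loop_at x) (\<zeta> e)) = Im (M (real m, e)) - Im (M (0, e))"
      by simp
    then have wn: "2 * pi * Re (winding_number (loop_at x) (\<zeta> e)) = Im (M (real m, e)) - Im (M (0, e))"
      by simp
    define w' where "w' = \<zeta> e - \<zeta> 0"
    have lim1: "((\<lambda>s. \<sigma> * Im (w' / (- (p' s / of_real s)))) \<longlongrightarrow> \<sigma> * Im (w' / (- (- in_dir x)))) (at_right 0)"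
      by (intro tendsto_intros p'_lim) (simp add: dir_nonzero)
    have lim2: "((\<lambda>s. \<sigma> * Im (w' / (p s / of_real s))) \<longlongrightarrow> \<sigma> * Im (w' / out_dir x)) (at_right 0)"
      by (intro tendsto_intros p_lim) (simp add: dir_nonzero)
    have "\<forall>\<^sub>F s in at_right 0. 0 < \<sigma> * Im (w' / (- (p' s / of_real s)))"
      by (rule order_tendstoD(1)[OF lim1]) (use es in \<open>simp add: w'_def\<close>)
    moreover have "\<forall>\<^sub>F s in at_right 0. 0 < \<sigma> * Im (w' / (p s / of_real s))"
      by (rule order_tendstoD(1)[OF lim2]) (use es in \<open>simp add: w'_def\<close>)
    moreover have "\<forall>\<^sub>F s in at_right 0. s < d" using d by (intro eventually_at_rightI[of 0 d]) auto
    moreover have "\<forall>\<^sub>F s in at_right (0::real). 0 < s" by (rule eventually_at_right_less)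
    moreover note secant_log_corner[OF sl, of x]
    ultimately have "\<forall>\<^sub>F s in at_right 0. 0 < \<sigma> * Im (w' / (- (p' s / of_real s))) \<and>
        0 < \<sigma> * Im (w' / (p s / of_real s)) \<and> s < d \<and> 0 < s \<and>
        Im (L (x, x + s)) - Im (L (x - s, x)) = Arg ((curve (x + s) - curve x) / (curve x - curve (x - s)))"
      by (intro eventually_conj)
    then obtain s where elim: "0 < \<sigma> * Im (w' / (- (p' s / of_real s)))" "0 < \<sigma> * Im (w' / (p s / of_real s))"
      "s < d" "0 < s"
      "Im (L (x, x + s)) - Im (L (x - s, x)) = Arg ((curve (x + s) - curve x) / (curve x - curve (x - s)))"
      using eventually_happens'[OF trivial_limit_at_right_real] by blast
    \<comment> \<open>The change along the top edge is found by going down through the cone at the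
      right end, along the bottom edge between \<open>s\<close> and \<open>m - s\<close>, and up
      through the cone at the left end. The bottom edge contributes pi times \<open>W\<close> minus
      the angle between the chords at the base point; together with the two cone angles the latter
      becomes \<open>\<sigma> * pi\<close>.\<close>
    have "Im (M (real m, e)) - Im (M (0, e)) = pi * (of_int W + \<sigma>)"
    proof -
      have 1: "Im (M (real m, e)) - Im (M (real m - s, 0)) = Arg (q e / p' s)"
        using nearm elim e by simp
      have 2: "Im (M (0, e)) - Im (M (s, 0)) = Arg (q e / p s)"
        using near0 elim e by simp
      have 3: "Im (M (real m - s, 0)) - Im (M (s, 0)) = Im (L (x, x + (real m - s))) - Im (L (x, x + s))"
        using c[of s] c[of "real m - s"] elim d m_pos by simp
      have 4: "L (x, x + (real m - s)) = L (x - s, x) + of_int W * pi * \<i>"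
        using L(3)[of "x - s" x] elim d m_pos by (simp add: algebra_simps)
      have 5: "Im (L (x, x + s)) - Im (L (x - s, x)) = Arg (p s / - p' s)"
        using elim(5) by (simp add: p_def p'_def)
      have pos: "0 < \<sigma> * Im (w' / - p' s)" "0 < \<sigma> * Im (w' / p s)"
      proof -
        have "\<sigma> * Im (w' / (b / of_real s)) = s * (\<sigma> * Im (w' / b))" for b
        proof -
          have "w' / (b / of_real s) = s *\<^sub>R (w' / b)" by (simp add: scaleR_conv_of_real)
          then show ?thesis by simp
        qed
        from this[of "- p' s"] this[of "p s"]
        have "0 < s * (\<sigma> * Im (w' / - p' s))" "0 < s * (\<sigma> * Im (w' / p s))"
          using elim(1,2) unfolding minus_divide_left by argo+
        then show "0 < \<sigma> * Im (w' / - p' s)" "0 < \<sigma> * Im (w' / p s)"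
          using elim(4) zero_less_mult_pos by blast+
      qed
      have "Arg (w' / - p' s) - Arg (p s / - p' s) - Arg (- w' / p s) = \<sigma> * pi"
        using side(3) pos Arg_around_left[of w' "- p' s" "p s"] Arg_around_right[of w' "- p' s" "p s"] by auto
      moreover have "q e / p' s = w' / - p' s" "q e / p s = - w' / p s" by (simp_all add: q_def w'_def minus_divide_left)
      ultimately show ?thesis using 1 2 3 4 5 by (simp add: algebra_simps)
    qed
    then have re: "2 * Re (winding_number (loop_at x) (\<zeta> e)) = of_int W + \<sigma>"
      using wn by simp
    \<comment> \<open>Imaginary parts of logarithms give only the real part of the winding number;
      integrality settles the rest.\<close>
    have "winding_number (loop_at x) (\<zeta> e) \<in> \<int>"
      by (intro integer_winding_number path_loop_at loop_at_closed) (use nin path_image_loop_at in auto)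
    then show "2 * winding_number (loop_at x) (\<zeta> e) = of_real (of_int W + \<sigma>)"
      using re by (auto simp: complex_eq_iff elim!: Ints_cases)
  qed
  have lim1: "((\<lambda>s. \<sigma> * Im ((\<zeta> s - \<zeta> 0) / of_real s / in_dir x)) \<longlongrightarrow> \<sigma> * Im (w / in_dir x)) (at_right 0)"
    by (intro tendsto_intros w) (simp add: dir_nonzero)
  have lim2: "((\<lambda>s. \<sigma> * Im ((\<zeta> s - \<zeta> 0) / of_real s / out_dir x)) \<longlongrightarrow> \<sigma> * Im (w / out_dir x)) (at_right 0)"
    by (intro tendsto_intros w) (simp add: dir_nonzero)
  have "\<forall>\<^sub>F s in at_right 0. 0 < \<sigma> * Im ((\<zeta> s - \<zeta> 0) / of_real s / in_dir x)"
    using order_tendstoD(1)[OF lim1] side by simp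
  moreover have "\<forall>\<^sub>F s in at_right 0. 0 < \<sigma> * Im ((\<zeta> s - \<zeta> 0) / of_real s / out_dir x)"
    using order_tendstoD(1)[OF lim2] side by simp
  moreover have "\<forall>\<^sub>F s in at_right 0. s < e1" using e1 by (intro eventually_at_rightI[of 0 e1]) auto
  moreover have "\<forall>\<^sub>F s in at_right (0::real). 0 < s" by (rule eventually_at_right_less)
  ultimately show ?thesis
  proof eventually_elim
    case (elim s)
    have scale: "\<sigma> * Im (a / of_real s / b) = \<sigma> * Im (a / b) / s" for a b
    proof -
      have "a / of_real s / b = (a / b) / of_real s" by (simp add: field_simps)
      then show ?thesis by (simp only: Im_divide_of_real times_divide_eq_right)
    qed
    have "0 < \<sigma> * Im ((\<zeta> s - \<zeta> 0) / in_dir x)" "0 < \<sigma> * Im ((\<zeta> s - \<zeta> 0) / out_dir x)"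
      using elim by (simp_all only: scale zero_less_divide_iff) auto
    then show ?case using key elim by blast
  qed
qed

text \<open>Straight segments are what \<open>points_to\<close> tests. Approach along a curved path
  is needed when another strand crosses the loop, in \<open>no_first_return\<close>.\<close>

lemma winding_number_beside_line:
  fixes \<sigma> :: real
  assumes sl: "secant_log L W"
    and side: "0 < \<sigma> * Im (w / in_dir x)" "0 < \<sigma> * Im (w / out_dir x)" "\<sigma> = 1 \<or> \<sigma> = - 1"
  shows "\<forall>\<^sub>F e in at_right 0. curve x + e *\<^sub>R w \<notin> range curve \<and>
           2 * winding_number (loop_at x) (curve x + e *\<^sub>R w) = of_real (of_int W + \<sigma>)"
proof (rule winding_number_beside[OF sl zero_less_one _ _ _ side])
  show "((\<lambda>t. (curve x + t *\<^sub>R w - (curve x + 0 *\<^sub>R w)) / of_real t) \<longlongrightarrow> w) (at_right 0)"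
    by (rule Lim_transform_eventually[OF tendsto_const])
      (use eventually_at_right_less[of "0::real"] in \<open>eventually_elim, simp add: scaleR_conv_of_real\<close>)
qed (auto intro!: continuous_intros)

text \<open>At the middle of a side, the left side restricts \<open>W\<close> to -3, -1, 1 and the
  right side to -1, 1, 3.\<close>

lemma secant_log_unit:
  assumes sl: "secant_log L W"
  shows "W = 1 \<or> W = - 1"
proof -
  define x where "x = 1 / (2 :: real)"
  have dir: "out_dir x = in_dir x" using dir_side[of 0 x] by (simp add: x_def)
  define w where "w = \<i> * in_dir x"
  have w: "w / in_dir x = \<i>" using dir_nonzero by (simp add: w_def)
  have half: "(of_int W + \<sigma>) / 2 \<in> {-1, 0, 1 :: real}" if \<sigma>: "\<sigma> = 1 \<or> \<sigma> = - 1" for \<sigma> :: real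
  proof -
    have "0 < \<sigma> * Im (of_real \<sigma> * w / in_dir x)" using \<sigma> w by (auto simp: times_divide_eq_right[symmetric] simp del: times_divide_eq_right)
    then obtain z where z: "z \<notin> range curve" "2 * winding_number (loop_at x) z = of_real (of_int W + \<sigma>)"
      using eventually_happens'[OF _ winding_number_beside_line[OF sl _ _ \<sigma>, of "of_real \<sigma> * w" x]] dir by auto
    have "winding_number (loop_at x) z \<in> {-1, 0, 1}"
      using simple_closed_path_winding_number_cases[OF simple_path_loop_at, of x z] z(1)
      by (auto simp: loop_at_closed path_image_loop_at)
    then have "Re (winding_number (loop_at x) z) \<in> {-1, 0, 1}" by auto
    moreover have "2 * Re (winding_number (loop_at x) z) = of_int W + \<sigma>"
      using arg_cong[OF z(2), of Re] by simp
    then have "(of_int W + \<sigma>) / 2 = Re (winding_number (loop_at x) z)" by simp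
    ultimately show ?thesis by simp
  qed
  show ?thesis using half[of 1] half[of "- 1"] by auto
qed

lemma winding_number_nonzero_iff_inside:
  assumes "z \<notin> range curve"
  shows "winding_number (loop_at x) z \<noteq> 0 \<longleftrightarrow> z \<in> inside (range curve)"
proof -
  have "z \<in> inside (range curve) \<union> outside (range curve)"
    unfolding inside_Un_outside using assms by simp
  moreover have "z \<in> outside (range curve) \<Longrightarrow> winding_number (loop_at x) z = 0"
    using winding_number_zero_in_outside[OF path_loop_at loop_at_closed, of z x]
    by (simp add: path_image_loop_at)
  moreover have "z \<in> inside (range curve) \<Longrightarrow> norm (winding_number (loop_at x) z) = 1"
    using simple_closed_path_norm_winding_number_inside[OF simple_path_loop_at, of z x]
    by (simp add: path_image_loop_at)
  ultimately show ?thesis by fastforce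
qed

text \<open>On the side given by \<open>\<sigma>\<close> the winding number is half of
  \<open>W + \<sigma>\<close>, hence nonzero in the first case and zero in the second, and it is
  nonzero exactly on the inside.\<close>

theorem points_to_inside:
  fixes \<sigma> :: real
  assumes sl: "secant_log L W"
    and side: "0 < \<sigma> * Im (w / in_dir x)" "0 < \<sigma> * Im (w / out_dir x)" "\<sigma> = 1 \<or> \<sigma> = - 1"
  shows "of_int W = \<sigma> \<Longrightarrow> points_to (curve x) w (inside (range curve))"
    and "of_int W = - \<sigma> \<Longrightarrow> points_to (curve x) w (outside (range curve))"
proof -
  note ev = winding_number_beside_line[OF sl side]
  show "points_to (curve x) w (inside (range curve))" if "of_int W = \<sigma>"
    unfolding points_to_def using ev
  proof eventually_elim
    case (elim e)
    then have "winding_number (loop_at x) (curve x + e *\<^sub>R w) \<noteq> 0" using that side(3) by auto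
    then show ?case using elim winding_number_nonzero_iff_inside by blast
  qed
  show "points_to (curve x) w (outside (range curve))" if "of_int W = - \<sigma>"
    unfolding points_to_def using ev
  proof eventually_elim
    case (elim e)
    then have "winding_number (loop_at x) (curve x + e *\<^sub>R w) = 0" using that by auto
    then have "curve x + e *\<^sub>R w \<notin> inside (range curve)"
      using elim winding_number_nonzero_iff_inside by blast
    then show ?case using elim inside_Un_outside[of "range curve"] by blast
  qed
qed

end

section \<open>Crossings and sides\<close>

context piecewise_loop
begin

text \<open>The outgoing branch and the reversed incoming branch both head into the half-plane of
  \<open>h\<close>, and the rest of the loop keeps a positive distance. The free half-disc is where
  another strand may pass a smoothed crossing without meeting the loop.\<close>

lemma half_disc_avoids_curve:
  assumes out: "0 < Re (out_dir x / h)" and in': "Re (in_dir x / h) < 0"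
  obtains rho where "0 < rho"
    and "\<And>z. dist z (curve x) < rho \<Longrightarrow> Re ((z - curve x) / h) < 0 \<Longrightarrow> z \<notin> range curve"
proof -
  obtain d1 where d1: "d1 > 0" "\<And>t. 0 < t \<Longrightarrow> t < d1 \<Longrightarrow> 0 < Re ((curve (x + t) - curve x) / h)"
    using eventually_direction_half_plane[OF out_dir_limit out] by (auto simp: eventually_at_right_field)
  have "((\<lambda>t. (curve (x - t) - curve x) / of_real t) \<longlongrightarrow> - in_dir x) (at_right 0)"
    using tendsto_minus[OF in_dir_limit] by (simp add: minus_divide_left)
  then have "\<forall>\<^sub>F t in at_right 0. 0 < Re ((curve (x - t) - curve x) / h)"
    by (rule eventually_direction_half_plane) (use in' in simp)
  then obtain d2 where d2: "d2 > 0" "\<And>t. 0 < t \<Longrightarrow> t < d2 \<Longrightarrow> 0 < Re ((curve (x - t) - curve x) / h)"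
    by (auto simp: eventually_at_right_field)
  define d where "d = Min {d1 / 2, d2 / 2, real m / 3}"
  have d: "0 < d" "d < d1" "d < d2" "d \<le> real m / 3" using d1(1) d2(1) m_pos by (auto simp: d_def)
  let ?K = "curve ` {x + d..x + real m - d}"
  have "compact ?K" by (intro compact_continuous_image continuous_curve) auto
  moreover have "curve x \<notin> ?K"
  proof
    assume "curve x \<in> ?K"
    then obtain y where "curve x = curve y" "x + d \<le> y" "y \<le> x + real m - d" by auto
    then show False using curve_neq[of x y] d by auto
  qed
  ultimately obtain rho where rho: "0 < rho" "\<And>y. y \<in> ?K \<Longrightarrow> rho \<le> dist (curve x) y"
    using separate_point_closed[of ?K "curve x"] by (auto intro: compact_imp_closed)
  show thesis
  proof (rule that[OF rho(1)], rule notI)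
    fix z assume z: "dist z (curve x) < rho" "Re ((z - curve x) / h) < 0" and "z \<in> range curve"
    then have "z \<in> path_image (loop_at x)" by (simp add: path_image_loop_at)
    then obtain t where t: "0 \<le> t" "t \<le> 1" "z = curve (x + real m * t)"
      by (auto simp: path_image_def loop_at_def)
    define s where "s = real m * t"
    have s: "0 \<le> s" "s \<le> real m" using t by (auto simp: s_def mult_left_le)
    have zs: "z = curve (x + s)" "z = curve (x - (real m - s))"
      using t curve_period1[of "x - (real m - s)"] by (auto simp: s_def algebra_simps)
    consider "s = 0 \<or> s = real m" | "0 < s" "s < d" | "0 < real m - s" "real m - s < d" | "d \<le> s" "s \<le> real m - d"
      using s by linarith
    then show False
    proof cases
      case 1
      then have "z = curve x" using zs by auto
      then show False using z by simp
    next
      case 2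
      then show False using d1(2)[of s] d z zs(1) by simp
    next
      case 3
      then show False using d2(2)[of "real m - s"] d z zs(2) by simp
    next
      case 4
      then have "rho \<le> dist (curve x) z" unfolding zs(1) by (intro rho(2)) auto
      then show False using z by (simp add: dist_commute)
    qed
  qed
qed

lemma closed_range_curve: "closed (range curve)"
  using closed_path_image[OF path_loop_at] by (simp add: path_image_loop_at)

end

section \<open>Periodic curves with transverse double points\<close>

lemma of_real_mult_in_nonpos_Reals_iff: "0 < r \<Longrightarrow> of_real r * (z :: complex) \<in> \<real>\<^sub>\<le>\<^sub>0 \<longleftrightarrow> z \<in> \<real>\<^sub>\<le>\<^sub>0"
  by (simp add: complex_nonpos_Reals_iff mult_le_0_iff)

lemma periodic_Ints:
  fixes f :: "real \<Rightarrow> 'a"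
  assumes per: "\<And>t. f (t + 1) = f t" and "s - t \<in> \<int>"
  shows "f s = f t"
proof -
  obtain n :: int where "s - t = of_int n" using assms(2) by (auto elim: Ints_cases)
  then have n: "s = t + of_int n" by simp
  have "f (t + of_int n) = f t"
  proof (induction n rule: int_induct[where k = 0])
    case (step1 i)
    then show ?case using per[of "t + of_int i"] by (simp add: add_ac)
  next
    case (step2 i)
    then show ?case using per[of "t + of_int (i - 1)"] by (simp add: add_ac)
  qed simp
  then show ?thesis by (simp add: n)
qed

lemma derivative_periodic:
  fixes f f' :: "real \<Rightarrow> complex"
  assumes d: "\<And>t. (f has_vector_derivative f' t) (at t)" and per: "\<And>t. f (t + 1) = f t"
  shows "f' (t + 1) = f' t"
proof -
  have "((\<lambda>t. t + 1) has_vector_derivative 1) (at t)" by (auto intro!: derivative_eq_intros)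
  from vector_diff_chain_at[OF this d] have "(f has_vector_derivative f' (t + 1)) (at t)"
    by (simp add: o_def per)
  then show ?thesis using d[of t] by (rule vector_derivative_unique_at)
qed

text \<open>Parameters are compared modulo \<open>\<int>\<close> rather than reduced to the unit
  interval, because \<open>next_crossing\<close> may leave it. Transversality appears as a nonreal
  quotient of tangents, the form that arguments and half-planes require.\<close>

locale transverse_curve =
  fixes P V :: "real \<Rightarrow> complex"
  assumes P_deriv: "\<And>t. (P has_vector_derivative V t) (at t)"
    and V_cont: "continuous_on UNIV V"
    and V_nonzero: "\<And>t. V t \<noteq> 0"
    and P_period: "\<And>t. P (t + 1) = P t"
    and transverse: "\<And>s t. s - t \<notin> \<int> \<Longrightarrow> P s = P t \<Longrightarrow> Im (V s / V t) \<noteq> 0"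
    and double: "\<And>r s t. \<lbrakk>s - t \<notin> \<int>; r - t \<notin> \<int>; P s = P t; P r = P t\<rbrakk> \<Longrightarrow> r - s \<in> \<int>"
    and finite_crossing_params: "finite (crossing_params P \<inter> {0..<1})"
begin

abbreviation "X \<equiv> crossing_params P"
abbreviation "X01 \<equiv> crossing_params P \<inter> {0..<1}"
abbreviation "nx \<equiv> next_crossing P"
abbreviation "os \<equiv> other_strand P"
abbreviation "st \<equiv> seifert_step P"

lemma V_period: "V (t + 1) = V t"
  using derivative_periodic P_deriv P_period by blast

lemma shift_int:
  assumes "s - t \<in> \<int>"
  shows "P s = P t" "V s = V t"
  using periodic_Ints[of P, OF P_period assms] periodic_Ints[of V, OF V_period assms] by auto

lemma X_iff_shift: "s - t \<in> \<int> \<Longrightarrow> s \<in> X \<longleftrightarrow> t \<in> X"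
proof -
  have *: "s \<in> X" if "s - t \<in> \<int>" "t \<in> X" for s t
  proof -
    from \<open>t \<in> X\<close> obtain r where r: "r - t \<notin> \<int>" "P r = P t" by (auto simp: crossing_params_def)
    have "r - s \<notin> \<int>" using r(1) that(1) Ints_add[of "r - s" "s - t"] by auto
    then show ?thesis using r shift_int(1)[OF that(1)] by (auto simp: crossing_params_def)
  qed
  assume "s - t \<in> \<int>"
  then show ?thesis using *[of s t] *[of t s] Ints_minus[of "s - t"] by auto
qed

lemma Ints_01_eq: "s \<in> {0..<1} \<Longrightarrow> t \<in> {0..<1} \<Longrightarrow> s - t \<in> \<int> \<Longrightarrow> s = (t::real)"
proof -
  assume st: "s \<in> {0..<1}" "t \<in> {0..<1}" and "s - t \<in> \<int>"
  then obtain n :: int where n: "s - t = of_int n" by (auto elim: Ints_cases)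
  then have "real_of_int n < 1" "- 1 < real_of_int n" using st by auto
  then have "n = 0" by linarith
  then show "s = t" using n by simp
qed

lemma frac_X01: "t \<in> X \<Longrightarrow> frac t \<in> X01"
proof -
  assume "t \<in> X"
  moreover have "frac t - t \<in> \<int>" by (simp add: frac_def)
  ultimately have "frac t \<in> X" using X_iff_shift by blast
  then show ?thesis by (simp add: frac_ge_0 frac_lt_1)
qed

lemma finite_X_interval: "finite (X \<inter> {a..b})"
proof -
  have "X \<inter> {a..b} \<subseteq> (\<lambda>(x, n). x + of_int n) ` (X01 \<times> {\<lfloor>a\<rfloor>..\<lfloor>b\<rfloor>})"
  proof
    fix t assume t: "t \<in> X \<inter> {a..b}"
    then have "(frac t, \<lfloor>t\<rfloor>) \<in> X01 \<times> {\<lfloor>a\<rfloor>..\<lfloor>b\<rfloor>}" using frac_X01 by (auto intro: floor_mono)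
    then show "t \<in> (\<lambda>(x, n). x + of_int n) ` (X01 \<times> {\<lfloor>a\<rfloor>..\<lfloor>b\<rfloor>})"
      by (intro image_eqI[of _ _ "(frac t, \<lfloor>t\<rfloor>)"]) (auto simp: frac_def)
  qed
  then show ?thesis by (rule finite_subset) (use finite_crossing_params in auto)
qed

text \<open>A half-open interval of length 1 contains a translate of each crossing parameter, but
  only finitely many crossing parameters, so the \<open>LEAST\<close> in the definition is
  attained.\<close>

lemma next_crossing:
  assumes "X \<noteq> {}"
  shows "nx t \<in> X" "t < nx t" "nx t \<le> t + 1" "\<And>s. s \<in> X \<Longrightarrow> t < s \<Longrightarrow> nx t \<le> s"
proof -
  obtain x where x: "x \<in> X" using assms by blast
  define y where "y = x + of_int (\<lfloor>t - x\<rfloor> + 1)"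
  have y: "y \<in> X" using X_iff_shift[of y x] x by (simp add: y_def)
  have ty: "t < y" "y \<le> t + 1" unfolding y_def by simp_all linarith+
  define A where "A = X \<inter> {t<..t + 1}"
  have fA: "finite A" unfolding A_def by (rule finite_subset[OF _ finite_X_interval[of t "t + 1"]]) auto
  have neA: "A \<noteq> {}" using y ty by (auto simp: A_def)
  have least: "Min A \<le> s" if "s \<in> X" "t < s" for s
  proof (cases "s \<le> t + 1")
    case True
    then show ?thesis using that fA by (auto simp: A_def intro!: Min_le)
  next
    case False
    then show ?thesis using Min_in[OF fA neA] by (auto simp: A_def)
  qed
  have eq: "nx t = Min A" unfolding next_crossing_def
    by (rule Least_equality) (use Min_in[OF fA neA] least in \<open>auto simp: A_def\<close>)
  then show "nx t \<in> X" "t < nx t" "nx t \<le> t + 1" using Min_in[OF fA neA] by (auto simp: A_def)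
  show "\<And>s. s \<in> X \<Longrightarrow> t < s \<Longrightarrow> nx t \<le> s" using least eq by simp
qed

lemma other_strand:
  assumes "t \<in> X"
  shows "os t \<in> X01" "os t - t \<notin> \<int>" "P (os t) = P t"
    and other_strand_unique: "\<And>r. r - t \<notin> \<int> \<Longrightarrow> P r = P t \<Longrightarrow> r - os t \<in> \<int>"
proof -
  obtain r where r: "r - t \<notin> \<int>" "P r = P t" using assms by (auto simp: crossing_params_def)
  have fr: "frac r - t \<notin> \<int>"
    using r(1) Ints_add[of "frac r - t" "of_int \<lfloor>r\<rfloor>"] by (auto simp: frac_def)
  have Pr: "P (frac r) = P t" using shift_int(1)[of "frac r" r] r(2) by (simp add: frac_def)
  have eq: "os t = frac r" unfolding other_strand_def
  proof (rule the_equality)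
    show "frac r \<in> {0..<1} \<and> frac r - t \<notin> \<int> \<and> P (frac r) = P t"
      using fr Pr by (simp add: frac_ge_0 frac_lt_1)
    show "s = frac r" if s: "s \<in> {0..<1} \<and> s - t \<notin> \<int> \<and> P s = P t" for s
      by (rule Ints_01_eq) (use s double[of "frac r" t s] fr Pr in \<open>auto simp: frac_ge_0 frac_lt_1\<close>)
  qed
  show 1: "os t - t \<notin> \<int>" "P (os t) = P t" using fr Pr by (simp_all add: eq)
  have "t - os t \<notin> \<int>" using 1(1) Ints_minus[of "t - os t"] by auto
  then have "os t \<in> X" using 1(2) by (auto simp: crossing_params_def intro!: exI[of _ t])
  then show "os t \<in> X01" by (simp add: eq frac_ge_0 frac_lt_1)
  show "r' - os t \<in> \<int>" if "r' - t \<notin> \<int>" "P r' = P t" for r'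
    using double[of "os t" t r'] 1 that by auto
qed

lemma other_strand_other:
  assumes "t \<in> X"
  shows "os (os t) - t \<in> \<int>"
proof -
  have "os t \<in> X" using other_strand(1)[OF assms] by auto
  have "t - os t \<notin> \<int>" using other_strand(2)[OF assms] Ints_minus[of "t - os t"] by auto
  then have "t - os (os t) \<in> \<int>"
    using other_strand_unique[OF \<open>os t \<in> X\<close>, of t] other_strand(3)[OF assms] by simp
  then show ?thesis using Ints_minus[of "t - os (os t)"] by simp
qed

lemma other_strand_X01: "t \<in> X01 \<Longrightarrow> os (os t) = t"
  using other_strand_other[of t] other_strand(1)[of "os t"] other_strand(1)[of t]
  by (intro Ints_01_eq) auto

lemma no_crossing_between:
  assumes "X \<noteq> {}" "t < s" "s < nx t"
  shows "s \<notin> X"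
  using next_crossing(4)[OF assms(1), of s t] assms by auto

text \<open>Open arcs with different starting points are disjoint modulo 1: if translates
  overlapped, the later starting point would be a crossing inside the other arc, unless both
  starting points coincide modulo 1.\<close>

lemma next_crossing_inj:
  assumes "t \<in> X01" "t' \<in> X01" "t < s" "s < nx t" "t' < s'" "s' < nx t'" "s - s' \<in> \<int>"
  shows "t = t'"
proof -
  have ne: "X \<noteq> {}" using assms by auto
  have *: "t' - t \<le> s' - s"
    if "t \<in> X01" "t' \<in> X01" "t < s" "s < nx t" "t' < s'" "s' < nx t'" "s - s' \<in> \<int>" for t t' s s'
  proof (rule ccontr)
    assume "\<not> t' - t \<le> s' - s"
    then have lt: "t < t' + (s - s')" "t' + (s - s') < s" using that by auto
    have "t' + (s - s') \<in> X" using X_iff_shift[of "t' + (s - s')" t'] that by auto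
    then show False using no_crossing_between[OF ne lt(1)] lt(2) that by auto
  qed
  have "s' - s \<in> \<int>" using assms(7) Ints_minus[of "s - s'"] by simp
  then have "t' - t = s' - s" using *[of t t' s s'] *[of t' t s' s] assms by auto
  then have "t' - t \<in> \<int>" using \<open>s' - s \<in> \<int>\<close> by simp
  then show ?thesis using Ints_01_eq[of t' t] assms by auto
qed

lemma next_crossing_frac_inj:
  assumes "t \<in> X01" "t' \<in> X01" "nx t - nx t' \<in> \<int>"
  shows "t = t'"
proof -
  have ne: "X \<noteq> {}" using assms by auto
  \<comment> \<open>Going back from both ends by half the shorter length yields congruent interior
    points of the two arcs.\<close>
  define e where "e = min (nx t - t) (nx t' - t') / 2"
  have e: "0 < e" "e < nx t - t" "e < nx t' - t'"
    using next_crossing(2)[OF ne, of t] next_crossing(2)[OF ne, of t'] by (auto simp: e_def)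
  show ?thesis
    by (rule next_crossing_inj[OF assms(1,2), of "nx t - e" "nx t' - e"]) (use e assms(3) in auto)
qed

lemma seifert_step_X01: "t \<in> X01 \<Longrightarrow> st t \<in> X01"
  unfolding seifert_step_def using other_strand(1) next_crossing(1)[of t] by auto

text \<open>The other strand of the other strand is the original one modulo 1, so a step determines
  the end of its arc modulo 1, and the end determines the arc. On the finite set \<open>X01\<close>
  the step is therefore a permutation.\<close>

lemma seifert_step_inj: "inj_on st X01"
proof (rule inj_onI)
  fix t t' assume t: "t \<in> X01" "t' \<in> X01" and eq: "st t = st t'"
  have ne: "X \<noteq> {}" using t by auto
  note X = next_crossing(1)[OF ne]
  have "os (os (nx t)) = os (os (nx t'))" using eq by (simp add: seifert_step_def)
  then have "nx t - nx t' \<in> \<int>"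
    using Ints_diff[OF other_strand_other[OF X[of t']] other_strand_other[OF X[of t]]] by simp
  then show "t = t'" using next_crossing_frac_inj t by blast
qed

definition side :: "(int \<Rightarrow> real) \<Rightarrow> int \<Rightarrow> real \<Rightarrow> complex" where
  "side a k x = P (a k + (nx (a k) - a k) * x)"

definition side_deriv :: "(int \<Rightarrow> real) \<Rightarrow> int \<Rightarrow> real \<Rightarrow> complex" where
  "side_deriv a k x = of_real (nx (a k) - a k) * V (a k + (nx (a k) - a k) * x)"

text \<open>Interior points of arcs with the same image are congruent modulo 1 and so belong to the
  same arc; only coincidences of vertices remain, and \<open>inj\<close> controls these. The joints
  are assumed for consecutive \<open>a k\<close>, not derived from \<open>st\<close>, because the
  loop cut off by an early return is closed up where no smoothing takes place.\<close>

lemma piecewise_loop_sides: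
  assumes m: "0 < m" and per: "\<And>k. a (k + int m) = a k" and aX: "\<And>k. a k \<in> X01"
    and joint: "\<And>k. P (nx (a k)) = P (a (k + 1))"
    and cusp: "\<And>k. V (a (k + 1)) / V (nx (a k)) \<notin> \<real>\<^sub>\<le>\<^sub>0"
    and inj: "\<And>k l. P (a k) = P (a l) \<Longrightarrow> \<exists>n. k - l = n * int m"
  shows "piecewise_loop (side a) (side_deriv a) m"
proof
  have ne: "X \<noteq> {}" using aX[of 0] by auto
  have len: "0 < nx (a k) - a k" for k using next_crossing(2)[OF ne, of "a k"] by simp
  show "0 < m" by fact
  show "(side a k has_vector_derivative side_deriv a k x) (at x)" for k x
  proof -
    have "((\<lambda>x. a k + (nx (a k) - a k) * x) has_vector_derivative (nx (a k) - a k)) (at x)"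
      by (auto intro!: derivative_eq_intros)
    from vector_diff_chain_at[OF this P_deriv] show ?thesis
      by (simp add: o_def side_def[abs_def] side_deriv_def scaleR_conv_of_real)
  qed
  show "continuous_on UNIV (side_deriv a k)" for k
    unfolding side_deriv_def[abs_def]
    by (intro continuous_intros continuous_on_compose2[OF V_cont]) auto
  show "side_deriv a k x \<noteq> 0" for k x
    using len[of k] V_nonzero by (auto simp: side_deriv_def simp flip: of_real_diff)
  show "side a (k + int m) = side a k" "side_deriv a (k + int m) = side_deriv a k" for k
    by (auto simp: side_def[abs_def] side_deriv_def[abs_def] per)
  show "side a k 1 = side a (k + 1) 0" for k by (simp add: side_def joint)
  show "side_deriv a (k + 1) 0 / side_deriv a k 1 \<notin> \<real>\<^sub>\<le>\<^sub>0" for k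
  proof -
    have "side_deriv a (k + 1) 0 / side_deriv a k 1
        = of_real ((nx (a (k + 1)) - a (k + 1)) / (nx (a k) - a k)) * (V (a (k + 1)) / V (nx (a k)))"
      by (simp add: side_deriv_def)
    moreover have "0 < (nx (a (k + 1)) - a (k + 1)) / (nx (a k) - a k)" using len by simp
    ultimately show ?thesis using cusp[of k] of_real_mult_in_nonpos_Reals_iff by metis
  qed
  fix x y :: real
  assume eq: "side a \<lfloor>x\<rfloor> (frac x) = side a \<lfloor>y\<rfloor> (frac y)"
  define p where "p x = a \<lfloor>x\<rfloor> + (nx (a \<lfloor>x\<rfloor>) - a \<lfloor>x\<rfloor>) * frac x" for x
  have Pp: "P (p x) = P (p y)" using eq by (simp add: side_def p_def)
  have p_bounds: "a \<lfloor>x\<rfloor> \<le> p x" "p x < nx (a \<lfloor>x\<rfloor>)" for x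
  proof -
    have "(nx (a \<lfloor>x\<rfloor>) - a \<lfloor>x\<rfloor>) * frac x < (nx (a \<lfloor>x\<rfloor>) - a \<lfloor>x\<rfloor>) * 1"
      using len by (intro mult_strict_left_mono) (auto simp: frac_lt_1)
    then show "p x < nx (a \<lfloor>x\<rfloor>)" by (simp add: p_def)
    show "a \<lfloor>x\<rfloor> \<le> p x" using len[of "\<lfloor>x\<rfloor>"] by (simp add: p_def frac_ge_0)
  qed
  have p_X: "frac x = 0" if "p x \<in> X" for x
  proof -
    have "p x = a \<lfloor>x\<rfloor>"
      using p_bounds[of x] no_crossing_between[OF ne, of "a \<lfloor>x\<rfloor>" "p x"] that by force
    then show ?thesis using len[of "\<lfloor>x\<rfloor>"] by (simp add: p_def)
  qed
  have conv: "\<exists>n::int. x - y = of_int n * real m" if k: "\<lfloor>x\<rfloor> - \<lfloor>y\<rfloor> = n * int m" and f: "frac x = frac y" for n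
  proof -
    have "x - y = of_int (\<lfloor>x\<rfloor> - \<lfloor>y\<rfloor>)" using f by (simp add: frac_def)
    then show ?thesis using k by (auto intro!: exI[of _ n])
  qed
  show "\<exists>n::int. x - y = of_int n * real m"
  proof (cases "p x \<in> X")
    case True
    have "p y \<in> X"
    proof (cases "p x - p y \<in> \<int>")
      case True
      then show ?thesis using X_iff_shift \<open>p x \<in> X\<close> by blast
    next
      case False
      then show ?thesis using Pp by (auto simp: crossing_params_def)
    qed
    then have f: "frac x = 0" "frac y = 0" using True p_X by auto
    then have "P (a \<lfloor>x\<rfloor>) = P (a \<lfloor>y\<rfloor>)" using Pp unfolding p_def f by simp
    then show ?thesis using inj conv f by metis
  next
    case False
    then have int: "p y - p x \<in> \<int>" using Pp by (auto simp: crossing_params_def)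
    then have int': "p x - p y \<in> \<int>" using Ints_minus[of "p y - p x"] by simp
    have "p y \<notin> X" using False X_iff_shift[OF int] by simp
    have "a \<lfloor>x\<rfloor> \<noteq> p x" "a \<lfloor>y\<rfloor> \<noteq> p y" using False \<open>p y \<notin> X\<close> aX by (metis IntD1)+
    then have b: "a \<lfloor>x\<rfloor> < p x" "a \<lfloor>y\<rfloor> < p y" using p_bounds by (simp_all add: order_less_le)
    have a_eq: "a \<lfloor>x\<rfloor> = a \<lfloor>y\<rfloor>"
      by (rule next_crossing_inj[OF aX aX b(1) p_bounds(2) b(2) p_bounds(2) int'])
    have "\<bar>p x - p y\<bar> < 1"
      using p_bounds[of x] p_bounds[of y] b next_crossing(3)[OF ne, of "a \<lfloor>x\<rfloor>"] a_eq by auto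
    moreover obtain n :: int where n: "p x - p y = of_int n" using int' by (auto elim: Ints_cases)
    ultimately have "n = 0" by linarith
    then have "p x = p y" using n by simp
    then have "frac x = frac y" using len[of "\<lfloor>y\<rfloor>"] by (simp add: p_def a_eq)
    moreover obtain n where "\<lfloor>x\<rfloor> - \<lfloor>y\<rfloor> = n * int m" using inj a_eq by metis
    ultimately show ?thesis using conv by blast
  qed
qed

end

section \<open>Seifert circles are simple\<close>

lemma Re_scaleR_divide: "Re (r *\<^sub>R z / h) = r * Re (z / h)"
proof -
  have "r *\<^sub>R z / h = r *\<^sub>R (z / h)" by (simp add: scaleR_conv_of_real)
  then show ?thesis by simp
qed

context transverse_curve
begin

lemma difference_quotient_right: "((\<lambda>t. (P (x + t) - P x) / of_real t) \<longlongrightarrow> V x) (at_right 0)"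
  using has_vector_derivative_difference_quotient[OF P_deriv] filterlim_at_split by blast

lemma difference_quotient_left: "((\<lambda>t. (P x - P (x - t)) / of_real t) \<longlongrightarrow> V x) (at_right 0)"
proof -
  have "((\<lambda>t. (P (x + t) - P x) / of_real t) \<longlongrightarrow> V x) (at_left 0)"
    using has_vector_derivative_difference_quotient[OF P_deriv] filterlim_at_split by blast
  then have "((\<lambda>t. (P (x + - t) - P x) / of_real (- t)) \<longlongrightarrow> V x) (at_right 0)"
    by (simp add: filterlim_at_left_to_right)
  then show ?thesis by (simp add: minus_divide_left flip: minus_divide_right)
qed

lemma continuous_P: "continuous_on S P"
  using P_deriv by (meson continuous_at_imp_continuous_on has_vector_derivative_continuous)

lemma same_crossing_cases:
  assumes "s \<in> X01" "t \<in> X01" "P s = P t"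
  shows "s = t \<or> s = os t"
proof (cases "s - t \<in> \<int>")
  case True
  then show ?thesis using Ints_01_eq[of s t] assms by auto
next
  case False
  then have "s - os t \<in> \<int>" using other_strand_unique[of t s] assms by auto
  then show ?thesis using Ints_01_eq[of s "os t"] assms other_strand(1)[of t] by auto
qed

text \<open>The arc from \<open>t\<close> ends on the strand that its successor does not use, so the
  arrival tangent can be read off at the other strand of the next vertex.\<close>

lemma next_crossing_other:
  assumes "X \<noteq> {}"
  shows "nx t - os (st t) \<in> \<int>" "P (nx t) = P (st t)" "V (nx t) = V (os (st t))"
proof -
  show 1: "nx t - os (st t) \<in> \<int>"
    using other_strand_other[OF next_crossing(1)[OF assms, of t]] Ints_minus[of "os (st t) - nx t"]
    by (simp add: seifert_step_def)
  show "P (nx t) = P (st t)"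
    using other_strand(3)[OF next_crossing(1)[OF assms, of t]] by (simp add: seifert_step_def)
  show "V (nx t) = V (os (st t))" using shift_int(2)[OF 1] .
qed

lemma transverse_other: "t \<in> X \<Longrightarrow> Im (V (os t) / V t) \<noteq> 0"
  using transverse other_strand(2,3) by blast

lemma Seifert_corner_no_cusp:
  assumes "X \<noteq> {}"
  shows "V (st t) / V (nx t) \<notin> \<real>\<^sub>\<le>\<^sub>0"
  using transverse_other[OF next_crossing(1)[OF assms, of t]]
  by (auto simp: complex_nonpos_Reals_iff seifert_step_def)

text \<open>A Seifert circle cannot return to a crossing along the other strand: the part between two
  consecutive visits would be a simple loop that is smooth at that crossing, hence crossed there by
  the remaining part, while at every other common crossing the two parts stay on their own side.\<close>

lemma no_first_return:
  assumes step: "\<And>k. a (k + 1) = st (a k)" and per: "\<And>k. a (k + int m) = a k" and aX: "\<And>k. a k \<in> X01"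
    and inj: "\<And>k l. a k = a l \<Longrightarrow> int m dvd k - l"
    and j: "0 < j" "j < m" "P (a 0) = P (a (int j))"
    and minimal: "\<And>i d. 0 < d \<Longrightarrow> d < j \<Longrightarrow> P (a i) \<noteq> P (a (i + int d))"
  shows False
proof -
  have ne: "X \<noteq> {}" using aX[of 0] by auto
  have m: "0 < m" using j by simp
  note nx = next_crossing[OF ne]
  have neq: "a k \<noteq> a l" if "0 < k - l" "k - l < int m" for k l
    using inj[of k l] that zdvd_not_zless by auto
  have other: "a k = os (a l)" if "P (a k) = P (a l)" "a k \<noteq> a l" for k l
    using same_crossing_cases[OF aX aX that(1)] that(2) by auto
  have nxo: "nx (a k) - os (a (k + 1)) \<in> \<int>" "P (nx (a k)) = P (a (k + 1))" "V (nx (a k)) = V (os (a (k + 1)))" for k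
    using next_crossing_other[OF ne, of "a k"] by (simp_all add: step)
  have a0j: "a 0 = os (a (int j))" "a (int j) = os (a 0)"
    using other[OF j(3)] other[OF j(3)[symmetric]] neq[of "int j" 0] j by auto
  \<comment> \<open>The arcs between the two visits are closed up. The last of them ends on the
    strand on which \<open>a 0\<close> starts, so the loop has equal tangent directions on both
    sides of this joint.\<close>
  define b where "b k = a (k mod int j)" for k
  have jpos: "0 < int j" using j by simp
  have b_in: "b k = a k" if "0 \<le> k" "k < int j" for k
    using that by (simp add: b_def)
  have mod_range: "0 \<le> k mod int j" "k mod int j < int j" for k using jpos by simp_all
  have mod_step: "(k + 1) mod int j = (if k mod int j = int j - 1 then 0 else k mod int j + 1)" for k
  proof -
    have "(k + 1) mod int j = (k mod int j + 1) mod int j" by (simp add: mod_add_left_eq)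
    then show ?thesis using mod_range[of k] by auto
  qed
  have wrap: "nx (a (int j - 1)) - a 0 \<in> \<int>" "V (nx (a (int j - 1))) = V (a 0)"
    using nxo(1,3)[of "int j - 1"] by (simp_all add: a0j(1)[symmetric])
  interpret L1: piecewise_loop "side b" "side_deriv b" j
  proof (rule piecewise_loop_sides)
    show "0 < j" by fact
    show "b (k + int j) = b k" for k by (simp add: b_def)
    show "b k \<in> X01" for k using aX by (simp add: b_def)
    show "P (nx (b k)) = P (b (k + 1))" for k
      using nxo(2)[of "k mod int j"] j(3) by (auto simp: b_def mod_step)
    show "V (b (k + 1)) / V (nx (b k)) \<notin> \<real>\<^sub>\<le>\<^sub>0" for k
    proof (cases "k mod int j = int j - 1")
      case True
      then show ?thesis using wrap(2) V_nonzero[of "a 0"] by (simp add: b_def mod_step complex_nonpos_Reals_iff)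
    next
      case False
      then show ?thesis using Seifert_corner_no_cusp[OF ne, of "a (k mod int j)"] by (simp add: b_def mod_step step)
    qed
    show "\<exists>n. k - l = n * int j" if eq: "P (b k) = P (b l)" for k l
    proof -
      \<comment> \<open>Minimality of the return makes the cut-off loop simple: two of its vertices
        at one crossing would be a shorter return.\<close>
      have "\<not> k mod int j < l mod int j" if "P (b k) = P (b l)" for k l
      proof
        assume lt: "k mod int j < l mod int j"
        define d where "d = nat (l mod int j - k mod int j)"
        have d: "0 < d" "d < j" "k mod int j + int d = l mod int j"
          using lt mod_range(1)[of k] mod_range(2)[of l] unfolding d_def by linarith+
        show False using minimal[OF d(1,2), of "k mod int j"] that unfolding d(3) b_def by simp
      qed
      from this[OF eq] this[OF eq[symmetric]] have "k mod int j = l mod int j" by simp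
      then have "int j dvd k - l" by (simp add: mod_eq_dvd_iff)
      then show ?thesis by (auto simp: dvd_def mult.commute)
    qed
  qed
  let ?C = "range L1.curve"
  obtain L W where sl: "L1.secant_log L W" using L1.ex_secant_log by blast
  define wn where "wn z = winding_number (L1.loop_at 0) z" for z
  have wn_eq: "wn y = wn z" if "y \<in> S" "z \<in> S" "connected S" "S \<inter> ?C = {}" for y z S
    unfolding wn_def using that
    by (intro winding_number_eq[OF L1.path_loop_at L1.loop_at_closed, of _ S]) (auto simp: L1.path_image_loop_at)
  have len: "0 < nx (a k) - a k" for k using nx(2)[of "a k"] by simp
  have rangeD: "\<exists>l s. 0 \<le> l \<and> l < int j \<and> a l \<le> s \<and> s < nx (a l) \<and> z = P s" if zC: "z \<in> ?C" for z
  proof -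
    obtain x where x: "z = L1.curve x" using zC by auto
    define l where "l = \<lfloor>x\<rfloor> mod int j"
    have bl: "b \<lfloor>x\<rfloor> = a l" by (simp add: b_def l_def)
    have "(nx (a l) - a l) * frac x < (nx (a l) - a l) * 1"
      using len by (intro mult_strict_left_mono) (auto simp: frac_lt_1)
    moreover have "0 \<le> (nx (a l) - a l) * frac x" using len[of l] by (simp add: frac_ge_0)
    ultimately show ?thesis using mod_range[of "\<lfloor>x\<rfloor>"]
      by (intro exI[of _ l] exI[of _ "a l + (nx (a l) - a l) * frac x"])
        (auto simp: x L1.curve_def side_def bl l_def[symmetric])
  qed
  \<comment> \<open>An interior point of an arc is no crossing, so meeting the loop would mean being
    in one of its own arcs.\<close>
  have off: "P t \<notin> ?C" if k: "int j \<le> k" "k < int m" and t: "a k < t" "t < nx (a k)" for k t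
  proof
    assume "P t \<in> ?C"
    then obtain l s where ls: "0 \<le> l" "l < int j" "a l \<le> s" "s < nx (a l)" "P t = P s" using rangeD by blast
    have tX: "t \<notin> X" using no_crossing_between[OF ne t] .
    then have "s - t \<in> \<int>" using ls(5) by (auto simp: crossing_params_def)
    then have "s \<notin> X" using X_iff_shift tX by blast
    then have "a l < s" using ls(3) aX[of l] by (metis IntD1 order_less_le)
    have "a l = a k" by (rule next_crossing_inj[OF aX aX \<open>a l < s\<close> ls(4) t \<open>s - t \<in> \<int>\<close>])
    then show False using neq[of k l] ls k by simp
  qed
  have const: "wn (P s) = wn (P t)"
    if k: "int j \<le> k" "k < int m" and st: "s \<in> {a k<..<nx (a k)}" "t \<in> {a k<..<nx (a k)}" for k s t
  proof (rule wn_eq[of _ "P ` {a k<..<nx (a k)}"])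
    show "connected (P ` {a k<..<nx (a k)})"
      by (intro connected_continuous_image continuous_P) simp
    show "P ` {a k<..<nx (a k)} \<inter> ?C = {}" using off[OF k] by fastforce
  qed (use st in auto)
  have small: "\<forall>\<^sub>F e in at_right 0. 0 < e \<and> e < nx (a k) - a k" for k
    using len[of k] by (intro eventually_at_rightI[of 0 "nx (a k) - a k"]) auto
  \<comment> \<open>The winding number is unchanged when the remaining part passes a vertex. If the
    loop misses the vertex, a small ball connects the two arcs; otherwise the loop has the other
    smoothed corner of the same crossing, and the free half-disc connects them.\<close>
  have transition: "\<exists>s\<in>{a k<..<nx (a k)}. \<exists>t\<in>{a (k + 1)<..<nx (a (k + 1))}. wn (P s) = wn (P t)"
    if k: "int j \<le> k" "k + 1 < int m" for k
  proof -
    define q where "q = P (a (k + 1))"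
    have q': "q = P (nx (a k))" using nxo(2) by (simp add: q_def)
    have lim1: "((\<lambda>e. P (nx (a k) - e)) \<longlongrightarrow> P (nx (a k) - 0)) (at_right 0)"
      by (intro tendsto_intros continuous_on_tendsto_compose[OF continuous_P[of UNIV]]) auto
    have lim2: "((\<lambda>e. P (a (k + 1) + e)) \<longlongrightarrow> P (a (k + 1) + 0)) (at_right 0)"
      by (intro tendsto_intros continuous_on_tendsto_compose[OF continuous_P[of UNIV]]) auto
    obtain N where N: "connected N" "N \<inter> ?C = {}"
      "\<forall>\<^sub>F e in at_right 0. P (nx (a k) - e) \<in> N" "\<forall>\<^sub>F e in at_right 0. P (a (k + 1) + e) \<in> N"
    proof (cases "q \<in> ?C")
      case False
      then have "q \<in> - ?C" "open (- ?C)" using L1.closed_range_curve by auto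
      then obtain r where r: "0 < r" "ball q r \<subseteq> - ?C" using openE by blast
      show thesis
      proof (rule that[of "ball q r"])
        show "\<forall>\<^sub>F e in at_right 0. P (nx (a k) - e) \<in> ball q r"
          using topological_tendstoD[OF lim1, of "ball q r"] r q' by simp
        show "\<forall>\<^sub>F e in at_right 0. P (a (k + 1) + e) \<in> ball q r"
          using topological_tendstoD[OF lim2, of "ball q r"] r q_def by simp
      qed (use r in auto)
    next
      case True
      then obtain l s where ls: "0 \<le> l" "l < int j" "a l \<le> s" "s < nx (a l)" "q = P s" using rangeD by blast
      have ak1: "a (k + 1) \<in> X" using aX by blast
      have "s \<in> X"
      proof (cases "s - a (k + 1) \<in> \<int>")
        case True
        then show ?thesis using X_iff_shift ak1 by blast
      next
        case False
        then have "a (k + 1) - s \<notin> \<int>" using Ints_minus[of "a (k + 1) - s"] by auto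
        then show ?thesis using ls(5) by (auto simp: q_def crossing_params_def)
      qed
      then have "s = a l" using no_crossing_between[OF ne, of "a l" s] ls by force
      then have Pl: "P (a l) = P (a (k + 1))" using ls by (simp add: q_def)
      have alk: "a l \<noteq> a (k + 1)" using neq[of "k + 1" l] ls k by simp
      have ol: "a l = os (a (k + 1))" "a (k + 1) = os (a l)"
        using other[OF Pl alk] other[OF Pl[symmetric] alk[symmetric]] by auto
      \<comment> \<open>Vertex 0 is the one place where the loop goes straight through a crossing.
        Its other visit is \<open>a (int j)\<close>, which is not the vertex \<open>k + 1\<close>
        considered here.\<close>
      have "l \<noteq> 0"
      proof
        assume "l = 0"
        then have "a (k + 1) = a (int j)" using ol(2) a0j(2) by simp
        then show False using neq[of "k + 1" "int j"] k by simp
      qed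
      then have l1: "0 \<le> l - 1" "l - 1 < int j" using ls by auto
      define u v where "u = V (a (k + 1))" and "v = V (a l)"
      have vk: "V (nx (a k)) = v" using nxo(3)[of k] by (simp add: v_def ol(1)[symmetric])
      have ul: "V (nx (a (l - 1))) = u" using nxo(3)[of "l - 1"] by (simp add: u_def ol(2)[symmetric])
      have "Im (v / u) \<noteq> 0" using transverse_other[OF ak1] by (simp add: u_def v_def ol(1)[symmetric])
      \<comment> \<open>The loop arrives with tangent \<open>u\<close> and leaves with
        \<open>v\<close>, while the remaining part arrives with \<open>v\<close> and leaves with
        \<open>u\<close>. If \<open>- u\<close> and \<open>v\<close> point to the positive side of
        \<open>h\<close>, then near the crossing the loop lies on the positive side and the
        remaining part on the negative side.\<close>
      then have "v / - u \<notin> \<real>\<^sub>\<le>\<^sub>0" by (auto simp: complex_nonpos_Reals_iff)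
      then obtain h where h: "0 < Re (- u / h)" "0 < Re (v / h)" "h \<noteq> 0"
        using half_plane_containing_two by blast
      have dirs: "L1.out_dir (of_int l) = of_real (nx (a l) - a l) * v"
        "L1.in_dir (of_int l) = of_real (nx (a (l - 1)) - a (l - 1)) * u"
        using ls l1 ul by (simp_all add: L1.dir_int side_deriv_def b_in v_def)
      have "0 < Re (L1.out_dir (of_int l) / h)" "Re (L1.in_dir (of_int l) / h) < 0"
      proof -
        show "0 < Re (L1.out_dir (of_int l) / h)" "Re (L1.in_dir (of_int l) / h) < 0"
          unfolding dirs scaleR_conv_of_real[symmetric] Re_scaleR_divide
          using h len by (simp_all add: mult_less_0_iff)
      qed
      then obtain rho where rho: "0 < rho"
        "\<And>z. dist z (L1.curve (of_int l)) < rho \<Longrightarrow> Re ((z - L1.curve (of_int l)) / h) < 0 \<Longrightarrow> z \<notin> ?C"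
        using L1.half_disc_avoids_curve[of "of_int l" h] by blast
      have cl: "L1.curve (of_int l) = q" using ls Pl by (simp add: side_def b_in q_def)
      define N where "N = ball q rho \<inter> (\<lambda>z. Re (z / h)) -` {..<Re (q / h)}"
      show thesis
      proof (rule that[of N])
        show "connected N" unfolding N_def
          by (intro convex_connected convex_Int convex_linear_vimage linearI)
            (auto simp: add_divide_distrib Re_scaleR_divide)
        show "N \<inter> ?C = {}"
        proof (rule ccontr)
          assume "N \<inter> ?C \<noteq> {}"
          then obtain z where "z \<in> N" "z \<in> ?C" by blast
          then show False using rho(2)[of z] unfolding cl by (simp add: N_def diff_divide_distrib dist_commute)
        qed
        have "\<forall>\<^sub>F e in at_right 0. P (nx (a k) - e) \<in> ball q rho"
          using topological_tendstoD[OF lim1, of "ball q rho"] rho q' by simp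
        moreover have "\<forall>\<^sub>F e in at_right 0. 0 < Re ((P (nx (a k)) - P (nx (a k) - e)) / h)"
          using eventually_direction_half_plane[OF difference_quotient_left] h(2) vk by metis
        ultimately show "\<forall>\<^sub>F e in at_right 0. P (nx (a k) - e) \<in> N"
          by eventually_elim (simp add: N_def q' diff_divide_distrib)
        have "\<forall>\<^sub>F e in at_right 0. P (a (k + 1) + e) \<in> ball q rho"
          using topological_tendstoD[OF lim2, of "ball q rho"] rho q_def by simp
        moreover have "\<forall>\<^sub>F e in at_right 0. 0 < Re ((P (a (k + 1) + e) - P (a (k + 1))) / - h)"
          using eventually_direction_half_plane[OF difference_quotient_right, of "a (k + 1)" "- h"] h(1) u_def by simp
        ultimately show "\<forall>\<^sub>F e in at_right 0. P (a (k + 1) + e) \<in> N"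
          by eventually_elim (simp add: N_def q_def diff_divide_distrib)
      qed
    qed
    have "\<forall>\<^sub>F e in at_right 0. P (nx (a k) - e) \<in> N \<and> P (a (k + 1) + e) \<in> N
        \<and> (0 < e \<and> e < nx (a k) - a k) \<and> (0 < e \<and> e < nx (a (k + 1)) - a (k + 1))"
      by (intro eventually_conj N(3,4) small)
    then obtain e where e: "P (nx (a k) - e) \<in> N" "P (a (k + 1) + e) \<in> N" "0 < e" "e < nx (a k) - a k"
      "e < nx (a (k + 1)) - a (k + 1)"
      using eventually_happens'[OF trivial_limit_at_right_real] by blast
    have "wn (P (nx (a k) - e)) = wn (P (a (k + 1) + e))" by (rule wn_eq[OF e(1,2) N(1,2)])
    then show ?thesis
      using e by (intro bexI[of _ "nx (a k) - e"] bexI[of _ "a (k + 1) + e"]) auto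
  qed
  have all: "\<forall>s\<in>{a (int j)<..<nx (a (int j))}. \<forall>t\<in>{a (int j + int n)<..<nx (a (int j + int n))}. wn (P s) = wn (P t)"
    if "int j + int n < int m" for n
    using that
  proof (induction n)
    case 0
    have "int j + int 0 = int j" by simp
    then show ?case using const[of "int j"] j(2) by (metis of_nat_less_iff order_refl)
  next
    case (Suc n)
    then have lt: "int j + int n + 1 < int m" by simp
    obtain s t where st: "s \<in> {a (int j + int n)<..<nx (a (int j + int n))}"
      "t \<in> {a (int j + int n + 1)<..<nx (a (int j + int n + 1))}" "wn (P s) = wn (P t)"
      using transition[of "int j + int n"] lt by auto
    have eq: "int j + int (Suc n) = int j + int n + 1" by simp
    show ?case unfolding eq
    proof (intro ballI)
      fix s' t'
      assume s': "s' \<in> {a (int j)<..<nx (a (int j))}"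
        and t': "t' \<in> {a (int j + int n + 1)<..<nx (a (int j + int n + 1))}"
      have "wn (P s') = wn (P s)" using Suc.IH lt s' st(1) by fastforce
      moreover have "wn (P t) = wn (P t')" by (rule const[OF _ lt st(2) t']) simp
      ultimately show "wn (P s') = wn (P t')" using st(3) by argo
    qed
  qed
  \<comment> \<open>The remaining part leaves the first crossing and finally comes back to it along
    one strand, with tangent \<open>w\<close> transverse to the loop. It starts on the side
    \<open>\<sigma>\<close> and ends on the opposite side, where the winding numbers differ by 1,
    although the winding number is constant along it.\<close>
  define w where "w = V (a (int j))"
  define \<sigma> where "\<sigma> = sgn (Im (w / V (a 0)))"
  have "Im (w / V (a 0)) \<noteq> 0" using transverse_other[of "a 0"] aX[of 0] by (simp add: w_def a0j(2)[symmetric])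
  then have \<sigma>: "0 < \<sigma> * Im (w / V (a 0))" "\<sigma> = 1 \<or> \<sigma> = - 1"
    by (auto simp: \<sigma>_def sgn_if)
  have Im_scale: "Im (z / (of_real r * y)) = Im (z / y) / r" for z r y
  proof -
    have "z / (of_real r * y) = (z / y) / of_real r" by simp
    then show ?thesis by (simp only: Im_divide_of_real)
  qed
  have dirs: "L1.out_dir 0 = of_real (nx (a 0) - a 0) * V (a 0)"
    "L1.in_dir 0 = of_real (nx (a (int j - 1)) - a (int j - 1)) * V (a 0)"
    using L1.dir_int[of 0] jpos wrap(2) mod_range
    by (simp_all add: side_deriv_def b_def zmod_minus1)
  have pos: "0 < \<tau> * Im (y / L1.in_dir 0)" "0 < \<tau> * Im (y / L1.out_dir 0)" if "0 < \<tau> * Im (y / V (a 0))" for \<tau> y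
    using that len unfolding dirs Im_scale by (simp_all add: zero_less_divide_iff)
  have c0: "L1.curve 0 = P (a (int j))" using L1.curve_int[of 0] j(3) jpos by (simp add: side_def b_def)
  have ev1: "\<forall>\<^sub>F e in at_right 0. P (a (int j) + e) \<notin> ?C \<and> 2 * wn (P (a (int j) + e)) = of_real (of_int W + \<sigma>)"
    unfolding wn_def
  proof (rule L1.winding_number_beside[OF sl zero_less_one])
    show "((\<lambda>t. (P (a (int j) + t) - P (a (int j) + 0)) / of_real t) \<longlongrightarrow> w) (at_right 0)"
      using difference_quotient_right[of "a (int j)"] by (simp add: w_def)
    show "continuous_on {0..1} (\<lambda>e. P (a (int j) + e))"
      by (intro continuous_on_compose2[OF continuous_P[of UNIV]] continuous_intros) auto
  qed (use pos[OF \<sigma>(1)] \<sigma>(2) c0 in auto)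
  define z where "z = nx (a (int m - 1))"
  have am: "a (int m - 1 + 1) = a 0" using per[of 0] by simp
  have zj: "z - a (int j) \<in> \<int>" using nxo(1)[of "int m - 1"] unfolding am z_def by (simp add: a0j(2)[symmetric])
  have ev2: "\<forall>\<^sub>F e in at_right 0. P (z - e) \<notin> ?C \<and> 2 * wn (P (z - e)) = of_real (of_int W + - \<sigma>)"
    unfolding wn_def
  proof (rule L1.winding_number_beside[OF sl zero_less_one])
    have "((\<lambda>t. - ((P z - P (z - t)) / of_real t)) \<longlongrightarrow> - V z) (at_right 0)"
      by (intro tendsto_minus difference_quotient_left)
    then show "((\<lambda>t. (P (z - t) - P (z - 0)) / of_real t) \<longlongrightarrow> - w) (at_right 0)"
      using shift_int(2)[OF zj] by (simp add: w_def minus_divide_left)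
    show "continuous_on {0..1} (\<lambda>e. P (z - e))"
      by (intro continuous_on_compose2[OF continuous_P[of UNIV]] continuous_intros) auto
    show "P (z - 0) = L1.curve 0" using shift_int(1)[OF zj] c0 by simp
    have \<sigma>': "0 < - \<sigma> * Im (- w / V (a 0))" using \<sigma>(1) by simp
    show "0 < - \<sigma> * Im (- w / L1.in_dir 0)" "0 < - \<sigma> * Im (- w / L1.out_dir 0)"
      using pos[OF \<sigma>'] by simp_all
    show "- \<sigma> = 1 \<or> - \<sigma> = - 1" using \<sigma>(2) by auto
  qed
  have "\<forall>\<^sub>F e in at_right 0. (P (a (int j) + e) \<notin> ?C \<and> 2 * wn (P (a (int j) + e)) = of_real (of_int W + \<sigma>))
      \<and> (P (z - e) \<notin> ?C \<and> 2 * wn (P (z - e)) = of_real (of_int W + - \<sigma>))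
      \<and> (0 < e \<and> e < nx (a (int j)) - a (int j)) \<and> (0 < e \<and> e < nx (a (int m - 1)) - a (int m - 1))"
    by (intro eventually_conj ev1 ev2 small)
  then obtain e where e: "2 * wn (P (a (int j) + e)) = of_real (of_int W + \<sigma>)"
    "2 * wn (P (z - e)) = of_real (of_int W + - \<sigma>)"
    "0 < e" "e < nx (a (int j)) - a (int j)" "e < nx (a (int m - 1)) - a (int m - 1)"
    using eventually_happens'[OF trivial_limit_at_right_real] by blast
  have mj: "int j + int (m - 1 - j) = int m - 1" using j by simp
  have "wn (P (a (int j) + e)) = wn (P (z - e))"
    using all[of "m - 1 - j"] e unfolding mj by (auto simp: z_def)
  then have "complex_of_real (of_int W + \<sigma>) = of_real (of_int W + - \<sigma>)" using e(1,2) by simp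
  then have "of_int W + \<sigma> = of_int W + - \<sigma>" by (simp only: of_real_eq_iff)
  then show False using \<sigma>(2) by auto
qed

text \<open>Among all pairs of visits to one crossing a pair with the least index distance is
  chosen, and the indices are shifted to put its first visit at 0. This supplies the minimality in
  \<open>no_first_return\<close>.\<close>

lemma Seifert_vertices_distinct:
  assumes step: "\<And>k. a (k + 1) = st (a k)" and per: "\<And>k. a (k + int m) = a k" and aX: "\<And>k. a k \<in> X01"
    and inj: "\<And>k l. a k = a l \<Longrightarrow> int m dvd k - l" and m: "0 < m"
    and eq: "P (a k) = P (a l)"
  shows "int m dvd k - l"
proof (rule ccontr)
  assume ndvd: "\<not> int m dvd k - l"
  define Q where "Q d \<longleftrightarrow> 0 < d \<and> d < m \<and> (\<exists>i. P (a i) = P (a (i + int d)))" for d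
  have per': "a (i + n * int m) = a i" for i n
  proof (induction n rule: int_induct[where k = 0])
    case (step1 n)
    then show ?case using per[of "i + n * int m"] by (simp add: algebra_simps)
  next
    case (step2 n)
    then show ?case using per[of "i + (n - 1) * int m"] by (simp add: algebra_simps)
  qed simp
  define d where "d = nat ((k - l) mod int m)"
  have "(k - l) mod int m \<noteq> 0" using ndvd by (simp add: dvd_eq_mod_eq_0)
  then have d: "0 < d" "d < m" "int d = (k - l) mod int m"
  proof -
    have "0 \<le> (k - l) mod int m" "(k - l) mod int m < int m" using m by simp_all
    then show "0 < d" "d < m" "int d = (k - l) mod int m"
      using \<open>(k - l) mod int m \<noteq> 0\<close> unfolding d_def by linarith+
  qed
  have "l + int d + (k - l) div int m * int m = k"
    using div_mult_mod_eq[of "k - l" "int m"] d(3) by simp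
  then have "a (l + int d) = a k" by (metis per')
  then have "P (a l) = P (a (l + int d))" using eq by simp
  then have "Q d" unfolding Q_def using d(1,2) by blast
  then obtain j where j: "Q j" "\<And>d. d < j \<Longrightarrow> \<not> Q d" using exists_least_iff[of Q] by blast
  then obtain i where i: "0 < j" "j < m" "P (a i) = P (a (i + int j))" by (auto simp: Q_def)
  show False
  proof (rule no_first_return[where a = "\<lambda>k. a (i + k)" and m = m and j = j])
    show "a (i + (k + 1)) = st (a (i + k))" for k using step[of "i + k"] by (simp add: add_ac)
    show "a (i + (k + int m)) = a (i + k)" for k using per[of "i + k"] by (simp add: add_ac)
    show "int m dvd k - l" if "a (i + k) = a (i + l)" for k l using inj[OF that] by simp
    show "P (a (i + i')) \<noteq> P (a (i + (i' + int d)))" if "0 < d" "d < j" for i' d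
    proof -
      have "P (a x) \<noteq> P (a (x + int d))" for x using j(2)[OF that(2)] that i(2) by (auto simp: Q_def)
      from this[of "i + i'"] show ?thesis by (simp add: add.assoc)
    qed
  qed (use i aX in auto)
qed

end

section \<open>The turning of all Seifert circles\<close>

lemma points_to_unique:
  assumes "points_to z v A" "points_to z v B" "A \<inter> B = {}"
  shows False
proof -
  have "\<forall>\<^sub>F e in at_right 0. z + e *\<^sub>R v \<in> A \<and> z + e *\<^sub>R v \<in> B"
    using assms(1,2) unfolding points_to_def by (rule eventually_conj)
  then show False using eventually_happens'[OF trivial_limit_at_right_real] assms(3) by blast
qed

text \<open>The curvature vector lies to the left of the tangent for positive curvature and to the
  right for negative curvature, so \<open>\<sigma>\<close> is its side at every point where the
  curvature is nonzero. The point \<open>t0\<close> gives the converse directions: there the vector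
  cannot point to the inside and the outside at once.\<close>

lemma (in piecewise_loop) circle_iff_rotation:
  fixes \<sigma> :: real
  assumes sl: "secant_log L W" and trace: "circle_trace P S = range curve"
    and sides: "\<And>I t. I \<in> S \<Longrightarrow> t \<in> I \<Longrightarrow> \<exists>x r. 0 < r \<and> curve x = P t \<and>
        out_dir x = of_real r * velocity P t \<and> in_dir x = of_real r * velocity P t"
    and \<sigma>: "\<sigma> = 1 \<or> \<sigma> = - 1" and curv: "\<And>t. 0 \<le> \<sigma> * signed_curvature P t"
    and ne: "I0 \<in> S" "t0 \<in> I0" "signed_curvature P t0 \<noteq> 0"
  shows "o_circle P S \<longleftrightarrow> of_int W = \<sigma>" "i_circle P S \<longleftrightarrow> of_int W = - \<sigma>"
proof -
  have pt: "of_int W = \<sigma> \<Longrightarrow> points_to (P t) (curvature_vector P t) (inside (range curve))"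
    "of_int W = - \<sigma> \<Longrightarrow> points_to (P t) (curvature_vector P t) (outside (range curve))"
    if It: "I \<in> S" "t \<in> I" "signed_curvature P t \<noteq> 0" for I t
  proof -
    obtain x r where x: "0 < r" "curve x = P t" "out_dir x = of_real r * velocity P t"
      "in_dir x = of_real r * velocity P t" using sides[OF It(1,2)] by blast
    have V: "velocity P t \<noteq> 0" using dir_nonzero(1)[of x] x(3) by auto
    have "curvature_vector P t / (of_real r * velocity P t)
        = of_real (signed_curvature P t / (r * norm (velocity P t))) * \<i>"
      using V x(1) by (simp add: curvature_vector_def unit_tangent_def sgn_eq scaleR_conv_of_real)
    then have "Im (curvature_vector P t / (of_real r * velocity P t)) = signed_curvature P t / (r * norm (velocity P t))"
      by simp
    moreover have "0 < \<sigma> * signed_curvature P t" using curv[of t] It(3) \<sigma> by auto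
    ultimately have "0 < \<sigma> * Im (curvature_vector P t / (of_real r * velocity P t))"
      using x(1) V by simp
    then have side: "0 < \<sigma> * Im (curvature_vector P t / in_dir x)" "0 < \<sigma> * Im (curvature_vector P t / out_dir x)"
      using x by simp_all
    show "of_int W = \<sigma> \<Longrightarrow> points_to (P t) (curvature_vector P t) (inside (range curve))"
      "of_int W = - \<sigma> \<Longrightarrow> points_to (P t) (curvature_vector P t) (outside (range curve))"
      using points_to_inside[OF sl side \<sigma>] x(2) by simp_all
  qed
  have W: "of_int W = \<sigma> \<or> of_int W = - \<sigma>" using secant_log_unit[OF sl] \<sigma> by auto
  have disj: "inside (range curve) \<inter> outside (range curve) = {}" by (rule inside_Int_outside)
  show "o_circle P S \<longleftrightarrow> of_int W = \<sigma>"
  proof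
    assume "o_circle P S"
    then have "points_to (P t0) (curvature_vector P t0) (inside (range curve))"
      using ne by (auto simp: o_circle_def trace)
    then show "of_int W = \<sigma>" using W pt(2)[OF ne] points_to_unique disj by blast
  qed (use pt in \<open>auto simp: o_circle_def trace\<close>)
  show "i_circle P S \<longleftrightarrow> of_int W = - \<sigma>"
  proof
    assume "i_circle P S"
    then have "points_to (P t0) (curvature_vector P t0) (outside (range curve))"
      using ne by (auto simp: i_circle_def trace)
    then show "of_int W = - \<sigma>" using W pt(1)[OF ne] points_to_unique disj by blast
  qed (use pt in \<open>auto simp: i_circle_def trace\<close>)
qed

section \<open>Orbits of the smoothing step and their turning\<close>

context transverse_curve
begin

text \<open>An \<open>orbit\<close> starts with the first image, so containing its own base point
  expresses that the step permutes the finite set \<open>X01\<close>. Extending the step by the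
  identity turns it into a permutation of all reals.\<close>

lemma self_in_orbit: "t \<in> X01 \<Longrightarrow> t \<in> orbit st t"
proof -
  assume t: "t \<in> X01"
  define f where "f x = (if x \<in> X01 then st x else x)" for x
  have f_st: "f x = st x" if "x \<in> X01" for x using that by (simp add: f_def)
  have img: "f ` X01 \<subseteq> X01" using f_st seifert_step_X01 by auto
  have inj: "inj_on f X01" using seifert_step_inj f_st by (simp add: inj_on_def)
  have "bij_betw f X01 X01"
    unfolding bij_betw_def using endo_inj_surj[OF finite_crossing_params img inj] inj by blast
  then have "f permutes X01"
  proof (rule bij_imp_permutes)
    show "f x = x" if "x \<notin> X01" for x
      unfolding f_def using that by (rule if_not_P)
  qed
  then have "permutation f" using finite_crossing_params permutation_permutes by blast
  then have "t \<in> orbit f t" by (rule permutation_self_in_orbit)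
  also have "orbit f t = orbit st t"
    by (rule orbit_cong0[OF t]) (use seifert_step_X01 in \<open>auto simp: f_def\<close>)
  finally show ?thesis .
qed

lemma orbit_subset_X01: "t \<in> X01 \<Longrightarrow> orbit st t \<subseteq> X01"
proof
  fix s assume t: "t \<in> X01" and "s \<in> orbit st t"
  from this(2) show "s \<in> X01"
    by induction (use t seifert_step_X01 in auto)
qed

lemma orbit_eq: "t \<in> X01 \<Longrightarrow> s \<in> orbit st t \<Longrightarrow> orbit st s = orbit st t"
  using orbit_swap[OF self_in_orbit, of t s] orbit_trans by (metis subsetI subset_antisym)

definition arc :: "real \<Rightarrow> real set" where
  "arc s = {s<..<nx s}"

text \<open>The turning of the tangent along the arc from \<open>s\<close>, plus the exterior angle
  of its Seifert circle at the end of the arc.\<close>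

definition turn :: "(real \<Rightarrow> real) \<Rightarrow> real \<Rightarrow> real" where
  "turn th s = th (nx s) - th s + Arg (V (st s) / V (nx s))"

text \<open>By \<open>Seifert_vertices_distinct\<close> the arcs of an orbit form a simple loop once
  each is rescaled to unit length. The rescaling multiplies tangents by positive numbers, which
  affects neither tangent angles nor exterior angles.\<close>

lemma Seifert_circle_rotation:
  fixes \<sigma> :: real
  assumes t0: "t0 \<in> X01"
    and th: "continuous_on UNIV th" "\<And>t. V t = of_real (norm (V t)) * cis (th t)"
    and vel: "velocity P = V" and \<sigma>: "\<sigma> = 1 \<or> \<sigma> = - 1" and curv: "\<And>t. 0 \<le> \<sigma> * signed_curvature P t"
    and ne: "\<And>a b. a < b \<Longrightarrow> \<exists>t\<in>{a<..<b}. signed_curvature P t \<noteq> 0"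
  shows "\<exists>W::int. (W = 1 \<or> W = - 1) \<and> 2 * pi * of_int W = (\<Sum>s\<in>orbit st t0. turn th s) \<and>
           (o_circle P (arc ` orbit st t0) \<longleftrightarrow> of_int W = \<sigma>) \<and>
           (i_circle P (arc ` orbit st t0) \<longleftrightarrow> of_int W = - \<sigma>)"
proof -
  have X: "X \<noteq> {}" using t0 by auto
  define m where "m = funpow_dist1 st t0 t0"
  have m: "0 < m" by (simp add: m_def)
  have ret: "(st ^^ m) t0 = t0" unfolding m_def by (rule funpow_dist1_prop[OF self_in_orbit[OF t0]])
  have orb: "orbit st t0 = (\<lambda>n. (st ^^ n) t0) ` {0..<m}"
    unfolding m_def by (rule orbit_conv_funpow_dist1[OF self_in_orbit[OF t0]])
  have inj0: "inj_on (\<lambda>n. (st ^^ n) t0) {0..<m}"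
    unfolding m_def by (rule inj_on_funpow_dist1[OF self_in_orbit[OF t0]])
  \<comment> \<open>The orbit is listed periodically over all integers, with its length
    \<open>m\<close> as the period.\<close>
  define a where "a k = (st ^^ nat (k mod int m)) t0" for k
  have mpos: "0 < int m" using m by simp
  have rng: "0 \<le> k mod int m" "k mod int m < int m" for k using mpos by simp_all
  have a_orb: "a k \<in> orbit st t0" for k
  proof -
    have "nat (k mod int m) \<in> {0..<m}" using rng[of k] by (simp add: nat_less_iff)
    then show ?thesis by (auto simp: orb a_def)
  qed
  have aX: "a k \<in> X01" for k using a_orb orbit_subset_X01[OF t0] by blast
  have per: "a (k + int m) = a k" for k by (simp add: a_def)
  have step: "a (k + 1) = st (a k)" for k
  proof -
    have "(k + 1) mod int m = (k mod int m + 1) mod int m" by (simp add: mod_add_left_eq)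
    also have "\<dots> = (if k mod int m + 1 = int m then 0 else k mod int m + 1)"
      using rng[of k] by auto
    finally have e: "(k + 1) mod int m = (if k mod int m + 1 = int m then 0 else k mod int m + 1)" .
    have s: "Suc (nat (k mod int m)) = nat (k mod int m + 1)" using rng[of k] by simp
    have "st (a k) = (st ^^ Suc (nat (k mod int m))) t0" by (simp add: a_def)
    also have "\<dots> = (st ^^ nat (k mod int m + 1)) t0" unfolding s ..
    also have "\<dots> = a (k + 1)" using ret by (auto simp: a_def e)
    finally show ?thesis by simp
  qed
  have inj: "int m dvd k - l" if "a k = a l" for k l
  proof -
    have "nat (k mod int m) \<in> {0..<m}" "nat (l mod int m) \<in> {0..<m}"
      using rng[of k] rng[of l] by (simp_all add: nat_less_iff)
    then have "nat (k mod int m) = nat (l mod int m)"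
      using that inj0 by (auto simp: a_def dest: inj_onD)
    then have "k mod int m = l mod int m" using rng[of k] rng[of l] by (simp add: eq_nat_nat_iff)
    then show ?thesis by (simp add: mod_eq_dvd_iff)
  qed
  have bij: "bij_betw a {0..<int m} (orbit st t0)"
    unfolding bij_betw_def
  proof
    show "inj_on a {0..<int m}"
    proof (rule inj_onI)
      fix k l assume kl: "k \<in> {0..<int m}" "l \<in> {0..<int m}" "a k = a l"
      have "k mod int m = l mod int m" by (simp only: mod_eq_dvd_iff inj[OF kl(3)])
      then show "k = l" using kl(1,2) by (metis atLeastLessThan_iff mod_pos_pos_trivial)
    qed
    show "a ` {0..<int m} = orbit st t0"
    proof
      show "orbit st t0 \<subseteq> a ` {0..<int m}"
      proof
        fix s assume "s \<in> orbit st t0"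
        then obtain n where "n < m" "s = (st ^^ n) t0" by (auto simp: orb)
        then show "s \<in> a ` {0..<int m}" by (intro image_eqI[of _ _ "int n"]) (auto simp: a_def)
      qed
    qed (use a_orb in auto)
  qed
  have len: "0 < nx (a k) - a k" for k using next_crossing(2)[OF X, of "a k"] by simp
  interpret S: piecewise_loop "side a" "side_deriv a" m
  proof (rule piecewise_loop_sides)
    show "0 < m" "a (k + int m) = a k" "a k \<in> X01" for k using m per aX by blast+
    show "P (nx (a k)) = P (a (k + 1))" for k using next_crossing_other(2)[OF X] by (simp add: step)
    show "V (a (k + 1)) / V (nx (a k)) \<notin> \<real>\<^sub>\<le>\<^sub>0" for k
      using Seifert_corner_no_cusp[OF X] by (simp add: step)
    show "\<exists>n. k - l = n * int m" if "P (a k) = P (a l)" for k l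
      using Seifert_vertices_distinct[OF step per aX inj m that] by (auto simp: dvd_def mult.commute)
  qed
  obtain L W where sl: "S.secant_log L W" using S.ex_secant_log by blast
  have param: "\<exists>y\<in>{0..1}. t = a k + (nx (a k) - a k) * y \<and> (a k < t \<and> t < nx (a k) \<longrightarrow> 0 < y \<and> y < 1)"
    if "a k \<le> t" "t \<le> nx (a k)" for k t
    using that len[of k] by (intro bexI[of _ "(t - a k) / (nx (a k) - a k)"]) (auto simp: divide_le_eq)
  have trace: "circle_trace P (arc ` orbit st t0) = range S.curve"
  proof (intro equalityI subsetI)
    fix z assume "z \<in> circle_trace P (arc ` orbit st t0)"
    then obtain s t where s: "s \<in> orbit st t0" "t \<in> closure {s<..<nx s}" "z = P t"
      by (auto simp: circle_trace_def arc_def)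
    then obtain k where k: "s = a k" using bij by (auto simp: bij_betw_def)
    have "a k \<le> t" "t \<le> nx (a k)"
      using s(2) len[of k] by (simp_all add: k)
    then obtain y where y: "y \<in> {0..1}" "t = a k + (nx (a k) - a k) * y" using param by blast
    then have "S.curve (of_int k + y) = z" using S.curve_on_side[of k "of_int k + y"] by (simp add: side_def s(3))
    then show "z \<in> range S.curve" by auto
  next
    fix z assume "z \<in> range S.curve"
    then obtain x where x: "z = side a \<lfloor>x\<rfloor> (frac x)" by (auto simp: S.curve_def)
    define k where "k = \<lfloor>x\<rfloor>"
    define y where "y = (nx (a k) - a k) * frac x"
    have "y \<le> (nx (a k) - a k) * 1" unfolding y_def
      using len by (intro mult_left_mono) (auto simp: less_imp_le frac_lt_1)
    moreover have "0 \<le> y" using len[of k] by (simp add: y_def frac_ge_0)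
    ultimately have "a k + (nx (a k) - a k) * frac x \<in> {a k..nx (a k)}"
      by (simp add: y_def[symmetric])
    then have "a k + (nx (a k) - a k) * frac x \<in> closure {a k<..<nx (a k)}"
      using len[of k] by (simp only: closure_greaterThanLessThan diff_gt_0_iff_gt)
    then show "z \<in> circle_trace P (arc ` orbit st t0)"
      using a_orb[of k] unfolding circle_trace_def arc_def x side_def k_def[symmetric] by blast
  qed
  have curvature: "o_circle P (arc ` orbit st t0) \<longleftrightarrow> of_int W = \<sigma>" "i_circle P (arc ` orbit st t0) \<longleftrightarrow> of_int W = - \<sigma>"
  proof -
    have sides: "\<exists>x r. 0 < r \<and> S.curve x = P t \<and> S.out_dir x = of_real r * velocity P t \<and> S.in_dir x = of_real r * velocity P t"
      if I: "I \<in> arc ` orbit st t0" "t \<in> I" for I t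
    proof -
      obtain s where s: "s \<in> orbit st t0" "I = {s<..<nx s}" using I by (auto simp: arc_def)
      then obtain k where k: "s = a k" using bij by (auto simp: bij_betw_def)
      obtain y where y: "t = a k + (nx (a k) - a k) * y" "0 < y" "y < 1"
        using I(2) s(2) k param[of k t] by auto
      show ?thesis
        using S.curve_on_side[of k "of_int k + y"] S.dir_side[of k "of_int k + y"] y len[of k]
        by (intro exI[of _ "of_int k + y"] exI[of _ "nx (a k) - a k"]) (simp add: side_def side_deriv_def vel)
    qed
    have "t0 < nx t0" using next_crossing(2)[OF X] .
    then obtain t1 where t1: "t1 \<in> arc t0" "signed_curvature P t1 \<noteq> 0" using ne unfolding arc_def by blast
    have "arc t0 \<in> arc ` orbit st t0" using self_in_orbit[OF t0] by simp
    from S.circle_iff_rotation[OF sl trace sides \<sigma> curv this t1]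
    show "o_circle P (arc ` orbit st t0) \<longleftrightarrow> of_int W = \<sigma>" "i_circle P (arc ` orbit st t0) \<longleftrightarrow> of_int W = - \<sigma>"
      by auto
  qed
  have "2 * pi * of_int W = (\<Sum>k\<in>{0..<int m}. th (a k + (nx (a k) - a k) * 1) - th (a k + (nx (a k) - a k) * 0)
      + Arg (side_deriv a (k + 1) 0 / side_deriv a k 1))"
  proof (rule S.rotation_sum[OF sl])
    show "continuous_on {0..1} (\<lambda>x. th (a k + (nx (a k) - a k) * x))" for k
      by (intro continuous_on_compose2[OF th(1)] continuous_intros) auto
    fix k x
    define y where "y = a k + (nx (a k) - a k) * x"
    have "side_deriv a k x = of_real (nx (a k) - a k) * (of_real (norm (V y)) * cis (th y))"
      by (subst th(2)[of y, symmetric]) (simp add: side_deriv_def y_def)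
    also have "\<dots> = of_real (norm (side_deriv a k x)) * cis (th y)"
      using len[of k] by (simp add: side_deriv_def norm_mult y_def del: of_real_diff)
    finally show "side_deriv a k x = of_real (norm (side_deriv a k x)) * cis (th (a k + (nx (a k) - a k) * x))"
      by (simp only: y_def)
  qed
  also have "\<dots> = (\<Sum>k\<in>{0..<int m}. turn th (a k))"
  proof (rule sum.cong[OF refl])
    fix k
    have "side_deriv a (k + 1) 0 / side_deriv a k 1
        = of_real ((nx (a (k + 1)) - a (k + 1)) / (nx (a k) - a k)) * (V (a (k + 1)) / V (nx (a k)))"
      by (simp add: side_deriv_def)
    moreover have "0 < (nx (a (k + 1)) - a (k + 1)) / (nx (a k) - a k)" using len by simp
    ultimately have "Arg (side_deriv a (k + 1) 0 / side_deriv a k 1) = Arg (V (a (k + 1)) / V (nx (a k)))"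
      by (simp only: Arg_times_of_real)
    then show "th (a k + (nx (a k) - a k) * 1) - th (a k + (nx (a k) - a k) * 0)
      + Arg (side_deriv a (k + 1) 0 / side_deriv a k 1) = turn th (a k)"
      by (simp add: turn_def step)
  qed
  also have "\<dots> = (\<Sum>s\<in>orbit st t0. turn th s)" by (rule sum.reindex_bij_betw[OF bij])
  finally show ?thesis using S.secant_log_unit[OF sl] curvature by blast
qed

text \<open>Taking the end of each arc modulo 1 permutes \<open>X01\<close>, so the differences of
  \<open>th\<close> cancel except for the arc from the largest parameter: it alone reaches or passes
  an integer and contributes the full period. The exterior angles cancel because exchanging the
  strands at a crossing inverts the quotient of tangents.\<close>

lemma sum_turn:
  assumes X: "X \<noteq> {}" and th: "\<And>t. th (t + 1) = th t + 2 * pi * of_int R"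
  shows "(\<Sum>s\<in>X01. turn th s) = 2 * pi * of_int R"
proof -
  have th_int: "th (t + of_int n) = th t + 2 * pi * of_int R * of_int n" for t n
  proof (induction n rule: int_induct[where k = 0])
    case (step1 i)
    then show ?case using th[of "t + of_int i"] by (simp add: algebra_simps)
  next
    case (step2 i)
    then show ?case using th[of "t + of_int (i - 1)"] by (simp add: algebra_simps)
  qed simp
  define f where "f s = frac (nx s)" for s
  have fX: "f ` X01 \<subseteq> X01" using frac_X01[OF next_crossing(1)[OF X]] by (auto simp: f_def)
  have f_int: "f s - nx s \<in> \<int>" for s by (simp add: f_def frac_def)
  have "inj_on f X01"
  proof (rule inj_onI)
    fix s t assume st: "s \<in> X01" "t \<in> X01" "f s = f t"
    then have "nx s - nx t = of_int (\<lfloor>nx s\<rfloor> - \<lfloor>nx t\<rfloor>)" by (simp add: f_def frac_def)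
    then have "nx s - nx t \<in> \<int>" by (metis Ints_of_int)
    then show "s = t" using next_crossing_frac_inj st by blast
  qed
  then have bij: "bij_betw f X01 X01"
    unfolding bij_betw_def using endo_inj_surj[OF finite_crossing_params fX] by blast
  have neX01: "X01 \<noteq> {}" using X frac_X01 by blast
  define M where "M = Max X01"
  have M: "M \<in> X01" "\<And>s. s \<in> X01 \<Longrightarrow> s \<le> M"
    using Max_in[OF finite_crossing_params neX01] Max_ge[OF finite_crossing_params] by (auto simp: M_def)
  have floor: "\<lfloor>nx s\<rfloor> = (if s = M then 1 else 0)" if s: "s \<in> X01" for s
  proof (cases "s = M")
    case True
    have "\<not> nx M < 1"
    proof
      assume "nx M < 1"
      then have "nx M \<in> X01" using next_crossing(1,2)[OF X, of M] M(1) by auto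
      then show False using M(2) next_crossing(2)[OF X, of M] by fastforce
    qed
    moreover have "nx M < 2" using next_crossing(3)[OF X, of M] M(1) by auto
    ultimately show ?thesis using True by (simp add: floor_eq_iff)
  next
    case False
    then have "s < M" using M(2)[OF s] by simp
    then have "nx s \<le> M" using next_crossing(4)[OF X] M(1) by blast
    then have "0 \<le> nx s" "nx s < 1" using M(1) s next_crossing(2)[OF X, of s] by auto
    then show ?thesis using False by (simp add: floor_eq_iff)
  qed
  have "(\<Sum>s\<in>X01. th (nx s)) = (\<Sum>s\<in>X01. th (f s) + (if s = M then 2 * pi * of_int R else 0))"
  proof (rule sum.cong[OF refl])
    fix s assume s: "s \<in> X01"
    have "nx s = f s + of_int \<lfloor>nx s\<rfloor>" by (simp add: f_def frac_def)
    then have "th (nx s) = th (f s) + 2 * pi * of_int R * of_int \<lfloor>nx s\<rfloor>" by (metis th_int)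
    then show "th (nx s) = th (f s) + (if s = M then 2 * pi * of_int R else 0)" using floor[OF s] by simp
  qed
  also have "\<dots> = (\<Sum>s\<in>X01. th s) + 2 * pi * of_int R"
    using M(1) sum.reindex_bij_betw[OF bij, of th] finite_crossing_params by (simp add: sum.distrib)
  finally have 1: "(\<Sum>s\<in>X01. th (nx s)) = (\<Sum>s\<in>X01. th s) + 2 * pi * of_int R" .
  have os_bij: "bij_betw os X01 X01"
    by (rule bij_betwI[where g = os]) (use other_strand(1) other_strand_X01 in auto)
  have corner: "Arg (V (st s) / V (nx s)) = Arg (V (os (f s)) / V (f s))" for s
  proof -
    have nX: "nx s \<in> X" "f s \<in> X" using next_crossing(1)[OF X, of s] X_iff_shift[OF f_int[of s]] by auto
    have "os (nx s) - f s \<notin> \<int>"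
      using other_strand(2)[OF nX(1)] f_int[of s] Ints_add[of "os (nx s) - f s" "f s - nx s"] by auto
    then have "os (nx s) - os (f s) \<in> \<int>"
      using other_strand_unique[OF nX(2)] other_strand(3)[OF nX(1)] shift_int(1)[OF f_int[of s]] by simp
    then have "os (nx s) = os (f s)" using Ints_01_eq other_strand(1)[OF nX(1)] other_strand(1)[OF nX(2)] by blast
    then show ?thesis using shift_int(2)[OF f_int[of s]] by (simp add: seifert_step_def)
  qed
  define A where "A = (\<Sum>u\<in>X01. Arg (V (os u) / V u))"
  have "A = (\<Sum>u\<in>X01. Arg (V (os (os u)) / V (os u)))"
    unfolding A_def by (rule sum.reindex_bij_betw[OF os_bij, symmetric])
  also have "\<dots> = (\<Sum>u\<in>X01. - Arg (V (os u) / V u))"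
  proof (rule sum.cong[OF refl])
    fix u assume u: "u \<in> X01"
    \<comment> \<open>On the negative reals \<open>Arg\<close> is pi and inversion does not negate
      it; transversality excludes this case.\<close>
    have "V (os u) / V u \<notin> \<real>" using transverse_other[of u] u by (auto simp: complex_is_Real_iff)
    then have "Arg (inverse (V (os u) / V u)) = - Arg (V (os u) / V u)" by (simp only: Arg_inverse if_False)
    moreover have "V (os (os u)) / V (os u) = inverse (V (os u) / V u)" by (simp add: other_strand_X01[OF u])
    ultimately show "Arg (V (os (os u)) / V (os u)) = - Arg (V (os u) / V u)" by (simp only:)
  qed
  also have "\<dots> = - A" by (simp add: A_def sum_negf)
  finally have "A = 0" by simp
  moreover have "(\<Sum>s\<in>X01. Arg (V (st s) / V (nx s))) = A"
    unfolding corner A_def by (rule sum.reindex_bij_betw[OF bij, of "\<lambda>u. Arg (V (os u) / V u)"])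
  ultimately have 2: "(\<Sum>s\<in>X01. Arg (V (st s) / V (nx s))) = 0" by simp
  show ?thesis using 1 2 by (simp add: turn_def sum.distrib sum_subtractf)
qed

theorem Seifert_circle_count:
  fixes \<sigma> :: real and R :: int
  assumes th: "continuous_on UNIV th" "\<And>t. V t = of_real (norm (V t)) * cis (th t)"
      "\<And>t. th (t + 1) = th t + 2 * pi * of_int R"
    and vel: "velocity P = V" and \<sigma>: "\<sigma> = 1 \<or> \<sigma> = - 1" and curv: "\<And>t. 0 \<le> \<sigma> * signed_curvature P t"
    and ne: "\<And>a b. a < b \<Longrightarrow> \<exists>t\<in>{a<..<b}. signed_curvature P t \<noteq> 0"
  shows "real (card {S \<in> seifert_circles P. o_circle P S}) - real (card {S \<in> seifert_circles P. i_circle P S})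
           = \<sigma> * of_int R"
proof (cases "X = {}")
  case True
  \<comment> \<open>Without crossings the whole curve is a loop with one side; the corner at the
    joint has exterior angle 0.\<close>
  interpret S: piecewise_loop "\<lambda>k. P" "\<lambda>k. V" 1
  proof
    show "P 1 = P 0" using P_period[of 0] by simp
    show "V 0 / V 1 \<notin> \<real>\<^sub>\<le>\<^sub>0" using V_period[of 0] V_nonzero[of 0] by (simp add: complex_nonpos_Reals_iff)
    fix x y :: real assume "P (frac x) = P (frac y)"
    then have "frac x - frac y \<in> \<int>" using True by (auto simp: crossing_params_def)
    then have "(frac x - frac y) + of_int (\<lfloor>x\<rfloor> - \<lfloor>y\<rfloor>) \<in> \<int>" by (intro Ints_add) auto
    then have "x - y \<in> \<int>" by (simp add: frac_def)
    then show "\<exists>n::int. x - y = of_int n * real 1" by (auto elim: Ints_cases)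
  qed (use P_deriv V_cont V_nonzero in auto)
  obtain L W where sl: "S.secant_log L W" using S.ex_secant_log by blast
  have fr: "frac x - x \<in> \<int>" for x :: real by (simp add: frac_def)
  have curve: "S.curve x = P x" for x unfolding S.curve_def by (rule shift_int(1)[OF fr])
  have dirs: "S.out_dir x = V x" "S.in_dir x = V x" for x
    unfolding S.out_dir_def S.in_dir_def by (rule shift_int(2), simp add: frac_def)+
  obtain t0 where t0: "signed_curvature P t0 \<noteq> 0" using ne[of 0 1] by auto
  have "2 * pi * of_int W = (\<Sum>k\<in>{0..<int 1}. th 1 - th 0 + Arg (V 0 / V 1))"
    by (rule S.rotation_sum[OF sl]) (use th(2) in \<open>auto intro: continuous_on_subset[OF th(1)]\<close>)
  also have "\<dots> = 2 * pi * of_int R"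
    using th(3)[of 0] V_period[of 0] V_nonzero[of 0] by simp
  finally have WR: "W = R" by simp
  have "o_circle P {UNIV} \<longleftrightarrow> of_int W = \<sigma>" "i_circle P {UNIV} \<longleftrightarrow> of_int W = - \<sigma>"
  proof -
    have trace: "circle_trace P {UNIV} = range S.curve" by (simp add: circle_trace_def curve)
    have sides: "\<exists>x r. 0 < r \<and> S.curve x = P t \<and> S.out_dir x = of_real r * velocity P t \<and> S.in_dir x = of_real r * velocity P t" for t
      by (intro exI[of _ t] exI[of _ "1::real"]) (simp add: curve dirs vel)
    show "o_circle P {UNIV} \<longleftrightarrow> of_int W = \<sigma>" "i_circle P {UNIV} \<longleftrightarrow> of_int W = - \<sigma>"
      by (rule S.circle_iff_rotation[OF sl trace sides \<sigma> curv singletonI UNIV_I t0])+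
  qed
  moreover have "seifert_circles P = {{UNIV}}" using True by (simp add: seifert_circles_def)
  moreover have "{S \<in> {{UNIV}}. Q S} = (if Q {UNIV} then {{UNIV}} else {})" for Q :: "real set set \<Rightarrow> bool" by auto
  ultimately show ?thesis using S.secant_log_unit[OF sl] \<sigma> WR by auto
next
  case False
  define orbs where "orbs = orbit st ` X01"
  have finO: "finite orbs" using finite_crossing_params by (simp add: orbs_def)
  have sc: "seifert_circles P = (`) arc ` orbs"
    using False by (simp add: seifert_circles_def orbs_def image_image arc_def[abs_def])
  \<comment> \<open>An arc determines its starting parameter, so different orbits are different
    Seifert circles and can be counted in their place.\<close>
  have arc_inj: "inj arc"
  proof (rule injI)
    fix s t assume "arc s = arc t"
    moreover have "Inf (arc s) = s" for s
      unfolding arc_def using next_crossing(2)[OF False, of s] by (rule cInf_greaterThanLessThan)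
    ultimately show "s = t" by metis
  qed
  then have inj: "inj_on ((`) arc) orbs" by (simp add: inj_on_def inj_image_eq_iff)
  have "\<exists>W. \<forall>Q\<in>orbs. (W Q = 1 \<or> W Q = - 1) \<and> 2 * pi * of_int (W Q) = (\<Sum>s\<in>Q. turn th s) \<and>
           (o_circle P (arc ` Q) \<longleftrightarrow> of_int (W Q) = \<sigma>) \<and> (i_circle P (arc ` Q) \<longleftrightarrow> of_int (W Q) = - \<sigma>)"
    using Seifert_circle_rotation[OF _ th(1,2) vel \<sigma> curv ne] by (intro bchoice) (auto simp: orbs_def)
  then obtain W :: "real set \<Rightarrow> int" where W: "\<And>Q. Q \<in> orbs \<Longrightarrow> W Q = 1 \<or> W Q = - 1"
    "\<And>Q. Q \<in> orbs \<Longrightarrow> 2 * pi * of_int (W Q) = (\<Sum>s\<in>Q. turn th s)"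
    "\<And>Q. Q \<in> orbs \<Longrightarrow> o_circle P (arc ` Q) \<longleftrightarrow> of_int (W Q) = \<sigma>"
    "\<And>Q. Q \<in> orbs \<Longrightarrow> i_circle P (arc ` Q) \<longleftrightarrow> of_int (W Q) = - \<sigma>" by blast
  have card: "real (card {S \<in> seifert_circles P. C S}) = (\<Sum>Q\<in>orbs. if C (arc ` Q) then 1 else 0)" for C
  proof -
    have "{S \<in> seifert_circles P. C S} = (`) arc ` {Q \<in> orbs. C (arc ` Q)}" by (auto simp: sc)
    then have "card {S \<in> seifert_circles P. C S} = card {Q \<in> orbs. C (arc ` Q)}"
      using inj by (simp add: card_image inj_on_subset[OF inj])
    then show ?thesis using finO by (simp add: sum.If_cases Int_def)
  qed
  have "2 * pi * (real (card {S \<in> seifert_circles P. o_circle P S}) - real (card {S \<in> seifert_circles P. i_circle P S}))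
      = (\<Sum>Q\<in>orbs. \<sigma> * (2 * pi * of_int (W Q)))"
    unfolding card sum_subtractf[symmetric] sum_distrib_left
  proof (rule sum.cong[OF refl])
    fix Q assume Q: "Q \<in> orbs"
    show "2 * pi * ((if o_circle P (arc ` Q) then 1 else 0) - (if i_circle P (arc ` Q) then 1 else 0))
        = \<sigma> * (2 * pi * of_int (W Q))"
      using W(1,3,4)[OF Q] \<sigma> by auto
  qed
  also have "\<dots> = \<sigma> * (\<Sum>Q\<in>orbs. \<Sum>s\<in>Q. turn th s)"
    by (simp add: sum_distrib_left[symmetric] W(2))
  also have "(\<Sum>Q\<in>orbs. \<Sum>s\<in>Q. turn th s) = (\<Sum>s\<in>\<Union>orbs. turn th s)"
  proof -
    have "Q \<inter> Q' = {}" if Q: "Q \<in> orbs" "Q' \<in> orbs" "Q \<noteq> Q'" for Q Q'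
    proof (rule ccontr)
      assume "Q \<inter> Q' \<noteq> {}"
      then obtain s where "s \<in> Q" "s \<in> Q'" by blast
      moreover obtain t t' where "t \<in> X01" "t' \<in> X01" "Q = orbit st t" "Q' = orbit st t'"
        using Q(1,2) unfolding orbs_def by blast
      ultimately show False using orbit_eq Q(3) by blast
    qed
    moreover have "finite Q" if "Q \<in> orbs" for Q
      using that finite_subset[OF orbit_subset_X01 finite_crossing_params] by (auto simp: orbs_def)
    ultimately have "sum (turn th) (\<Union>orbs) = (sum \<circ> sum) (turn th) orbs"
      by (intro sum.Union_disjoint) blast+
    then show ?thesis by simp
  qed
  also have "\<Union>orbs = X01" unfolding orbs_def using orbit_subset_X01 self_in_orbit by blast
  also have "(\<Sum>s\<in>X01. turn th s) = 2 * pi * of_int R" by (rule sum_turn[OF False]) (rule th(3))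
  finally show ?thesis by simp
qed

end

section \<open>The tangent angle and local maxima\<close>

text \<open>The value 1 of \<open>\<epsilon>\<close> gives strict maxima and -1 strict minima. The
  height has derivative \<open>norm (V s) * cos (th s - \<beta>)\<close>; times
  \<open>\<epsilon>\<close> this is \<open>- norm (V s) * sin (th s - th t)\<close>, whose sign near
  \<open>t\<close> is decided by the monotonicity of \<open>th\<close>.\<close>

lemma local_maxima_tangent_angle:
  fixes P V :: "real \<Rightarrow> complex" and \<epsilon> :: real
  assumes d: "\<And>t. (P has_vector_derivative V t) (at t)" and nz: "\<And>t. V t \<noteq> 0"
    and th: "continuous_on UNIV th" "strict_mono th" "\<And>t. V t = of_real (norm (V t)) * cis (th t)"
    and \<epsilon>: "\<epsilon> = 1 \<or> \<epsilon> = - 1" and t: "th t = \<beta> + \<epsilon> * pi / 2 + 2 * pi * of_int n"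
  shows "\<forall>\<^sub>F s in at t. \<epsilon> * (P s \<bullet> cis \<beta>) < \<epsilon> * (P t \<bullet> cis \<beta>)"
proof -
  have deriv: "((\<lambda>s. \<epsilon> * (P s \<bullet> cis \<beta>)) has_real_derivative \<epsilon> * (norm (V s) * cos (th s - \<beta>))) (at s)" for s
  proof -
    have "((\<lambda>s. P s \<bullet> cis \<beta>) has_vector_derivative V s \<bullet> cis \<beta>) (at s)"
      by (rule bounded_linear.has_vector_derivative[OF bounded_linear_inner_left d])
    moreover have "V s \<bullet> cis \<beta> = norm (V s) * cos (th s - \<beta>)"
      by (subst th(3)) (simp add: inner_complex_def cos_diff algebra_simps)
    ultimately have "((\<lambda>s. P s \<bullet> cis \<beta>) has_real_derivative norm (V s) * cos (th s - \<beta>)) (at s)"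
      by (simp add: has_real_derivative_iff_has_vector_derivative)
    then show ?thesis by (rule DERIV_cmult)
  qed
  have slope: "\<epsilon> * (norm (V s) * cos (th s - \<beta>)) = - norm (V s) * sin (th s - th t)" for s
  proof -
    have "th s - \<beta> = (\<epsilon> * pi / 2 + (th s - th t)) + 2 * pi * of_int n" using t by simp
    then have "cos (th s - \<beta>) = cos (\<epsilon> * pi / 2 + (th s - th t))"
      using sin_cos_eq_iff[of "th s - \<beta>" "\<epsilon> * pi / 2 + (th s - th t)"]
      by (simp add: cos_add cos_int_2pin sin_int_2pin)
    also have "\<epsilon> * \<dots> = - sin (th s - th t)" using \<epsilon> by (auto simp: cos_add cos_diff)
    finally have "\<epsilon> * cos (th s - \<beta>) = - sin (th s - th t)" .
    moreover have "\<epsilon> * (norm (V s) * cos (th s - \<beta>)) = norm (V s) * (\<epsilon> * cos (th s - \<beta>))" by simp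
    ultimately show ?thesis by simp
  qed
  have cont: "continuous_on S (\<lambda>s. \<epsilon> * (P s \<bullet> cis \<beta>))" for S
    using deriv DERIV_isCont by (blast intro: continuous_at_imp_continuous_on)
  have "continuous (at t) th" using th(1) by (simp add: continuous_on_eq_continuous_at)
  then obtain e where e: "0 < e" "\<And>s. dist s t < e \<Longrightarrow> dist (th s) (th t) < pi"
    unfolding continuous_at_eps_delta using pi_gt_zero by blast
  have "\<epsilon> * (P s \<bullet> cis \<beta>) < \<epsilon> * (P t \<bullet> cis \<beta>)" if s: "dist s t < e" "s \<noteq> t" for s
  proof (cases "s < t")
    case True
    show ?thesis
    proof (rule DERIV_pos_imp_increasing_open[OF True _ cont])
      fix x assume x: "s < x" "x < t"
      have "th x < th t" using th(2) x by (simp add: strict_mono_def)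
      moreover have "dist (th x) (th t) < pi" using x s by (intro e(2)) (auto simp: dist_real_def)
      ultimately have "sin (th t - th x) > 0" by (intro sin_gt_zero) (auto simp: dist_real_def)
      then have "- norm (V x) * sin (th x - th t) > 0"
        using nz[of x] sin_minus[of "th t - th x"] by simp
      then show "\<exists>y. ((\<lambda>s. \<epsilon> * (P s \<bullet> cis \<beta>)) has_real_derivative y) (at x) \<and> 0 < y"
        using deriv[of x] slope[of x] by metis
    qed
  next
    case False
    then have ts: "t < s" using s by simp
    show ?thesis
    proof (rule DERIV_neg_imp_decreasing_open[OF ts _ cont])
      fix x assume x: "t < x" "x < s"
      have "th t < th x" using th(2) x by (simp add: strict_mono_def)
      moreover have "dist (th x) (th t) < pi" using x s by (intro e(2)) (auto simp: dist_real_def)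
      ultimately have "sin (th x - th t) > 0" by (intro sin_gt_zero) (auto simp: dist_real_def)
      then have "- norm (V x) * sin (th x - th t) < 0" using nz[of x] by simp
      then show "\<exists>y. ((\<lambda>s. \<epsilon> * (P s \<bullet> cis \<beta>)) has_real_derivative y) (at x) \<and> y < 0"
        using deriv[of x] slope[of x] by metis
    qed
  qed
  then show ?thesis using e(1) by (auto simp: eventually_at)
qed

text \<open>Maxima are the parameters with tangent angle \<open>c\<close> modulo 2 pi. Since
  \<open>th\<close> is continuous and strictly increasing, those in the half-open unit interval
  correspond to the numbers \<open>c + 2 * pi * n\<close> in a half-open interval of length 2 pi
  R.\<close>

lemma card_local_maxima:
  fixes P V :: "real \<Rightarrow> complex" and R :: int
  assumes d: "\<And>t. (P has_vector_derivative V t) (at t)" and nz: "\<And>t. V t \<noteq> 0"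
    and th: "continuous_on UNIV th" "strict_mono th" "\<And>t. V t = of_real (norm (V t)) * cis (th t)"
      "th 1 = th 0 + 2 * pi * of_int R"
    and w: "norm w = 1"
  shows "finite (local_maxima P w) \<and> card (local_maxima P w) = nat R"
proof -
  obtain \<beta> where \<beta>: "w = cis \<beta>" using w by (metis complex_norm_eq_1_exp cis_conv_exp)
  define c where "c = \<beta> + pi / 2"
  have iff: "(\<forall>\<^sub>F s in at t. P s \<bullet> w \<le> P t \<bullet> w) \<longleftrightarrow> (\<exists>n::int. th t = c + 2 * pi * of_int n)" for t
  proof
    assume "\<exists>n::int. th t = c + 2 * pi * of_int n"
    then obtain n :: int where "th t = \<beta> + 1 * pi / 2 + 2 * pi * of_int n" by (auto simp: c_def)
    from local_maxima_tangent_angle[OF d nz th(1-3) _ this]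
    have "\<forall>\<^sub>F s in at t. P s \<bullet> w < P t \<bullet> w" by (simp add: \<beta>)
    then show "\<forall>\<^sub>F s in at t. P s \<bullet> w \<le> P t \<bullet> w" by eventually_elim simp
  next
    assume max: "\<forall>\<^sub>F s in at t. P s \<bullet> w \<le> P t \<bullet> w"
    then obtain e where e: "0 < e" "\<And>s. s \<noteq> t \<Longrightarrow> dist s t < e \<Longrightarrow> P s \<bullet> w \<le> P t \<bullet> w"
      by (auto simp: eventually_at)
    have "((\<lambda>s. P s \<bullet> w) has_real_derivative V t \<bullet> w) (at t)"
      unfolding has_real_derivative_iff_has_vector_derivative
      by (rule bounded_linear.has_vector_derivative[OF bounded_linear_inner_left d])
    then have "V t \<bullet> w = 0"
      by (rule DERIV_local_max[OF _ e(1)]) (metis abs_minus_commute dist_real_def e(2) order_refl)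
    moreover have "V t \<bullet> w = norm (V t) * cos (th t - \<beta>)"
      by (subst th(3)) (simp add: \<beta> inner_complex_def cos_diff algebra_simps)
    ultimately have "cos (th t - \<beta>) = 0" using nz[of t] by simp
    \<comment> \<open>A critical point has tangent angle an odd multiple of pi/2 away from
      \<open>\<beta>\<close>. Residue 1 modulo 4 is the desired angle; residue 3 would make
      \<open>t\<close> a strict local minimum.\<close>
    then obtain i :: int where i: "odd i" "th t - \<beta> = of_int i * (pi / 2)" by (auto simp: cos_zero_iff_int)
    show "\<exists>n::int. th t = c + 2 * pi * of_int n"
    proof (cases "i mod 4 = 1")
      case True
      then have "i = 4 * (i div 4) + 1" by presburger
      then have "real_of_int i = 4 * of_int (i div 4) + 1" by linarith
      then show ?thesis using i(2) by (intro exI[of _ "i div 4"]) (simp add: c_def field_simps)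
    next
      case False
      then have "i = 4 * (i div 4 + 1) - 1" using i(1) by presburger
      then have "real_of_int i = 4 * of_int (i div 4 + 1) - 1" by linarith
      then have "th t = \<beta> + - 1 * pi / 2 + 2 * pi * of_int (i div 4 + 1)" using i(2) by (simp add: field_simps)
      from local_maxima_tangent_angle[OF d nz th(1-3) _ this]
      have "\<forall>\<^sub>F s in at t. P t \<bullet> w < P s \<bullet> w" by (simp add: \<beta>)
      with max have "\<forall>\<^sub>F s in at t. False" by eventually_elim simp
      then show ?thesis by (simp add: eventually_False)
    qed
  qed
  \<comment> \<open>The possibly fractional index \<open>n\<close> at which
    \<open>c + 2 * pi * n\<close> equals \<open>th 0\<close>. The admissible indices start at its
    ceiling, and \<open>th 1\<close> lies \<open>R\<close> periods further on.\<close>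
  define \<alpha> where "\<alpha> = (th 0 - c) / (2 * pi)"
  have \<alpha>: "th 0 \<le> c + 2 * pi * of_int n \<longleftrightarrow> \<lceil>\<alpha>\<rceil> \<le> n"
    "c + 2 * pi * of_int n < th 1 \<longleftrightarrow> n < \<lceil>\<alpha>\<rceil> + R" for n
  proof -
    have "th 0 \<le> c + 2 * pi * of_int n \<longleftrightarrow> \<alpha> \<le> of_int n" by (simp add: \<alpha>_def field_simps)
    then show "th 0 \<le> c + 2 * pi * of_int n \<longleftrightarrow> \<lceil>\<alpha>\<rceil> \<le> n" by (simp add: ceiling_le_iff)
    have "c + 2 * pi * of_int n < th 1 \<longleftrightarrow> of_int (n - R) < \<alpha>"
      by (simp add: \<alpha>_def th(4) field_simps)
    then show "c + 2 * pi * of_int n < th 1 \<longleftrightarrow> n < \<lceil>\<alpha>\<rceil> + R" by (simp add: less_ceiling_iff[symmetric] algebra_simps)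
  qed
  have less: "th s < th t \<longleftrightarrow> s < t" for s t using strict_mono_less[OF th(2)] .
  have le: "th s \<le> th t \<longleftrightarrow> s \<le> t" for s t using strict_mono_less_eq[OF th(2)] .
  have img: "th ` local_maxima P w = (\<lambda>n. c + 2 * pi * of_int n) ` {\<lceil>\<alpha>\<rceil>..<\<lceil>\<alpha>\<rceil> + R}"
  proof (intro equalityI subsetI)
    fix y assume "y \<in> th ` local_maxima P w"
    then obtain t n where t: "0 \<le> t" "t < 1" "y = th t" "th t = c + 2 * pi * of_int n"
      by (auto simp: local_maxima_def iff)
    then have "n \<in> {\<lceil>\<alpha>\<rceil>..<\<lceil>\<alpha>\<rceil> + R}"
      using le[of 0 t] less[of t 1] unfolding atLeastLessThan_iff \<alpha>[symmetric] by simp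
    then show "y \<in> (\<lambda>n. c + 2 * pi * of_int n) ` {\<lceil>\<alpha>\<rceil>..<\<lceil>\<alpha>\<rceil> + R}" using t by auto
  next
    fix y assume "y \<in> (\<lambda>n. c + 2 * pi * of_int n) ` {\<lceil>\<alpha>\<rceil>..<\<lceil>\<alpha>\<rceil> + R}"
    then obtain n where n: "y = c + 2 * pi * of_int n" "th 0 \<le> y" "y < th 1"
      using \<alpha> by auto
    obtain t where t: "0 \<le> t" "t \<le> 1" "th t = y"
      using IVT'[of th 0 y 1] n(2,3) continuous_on_subset[OF th(1)] by auto
    then have "t < 1" using less[of t 1] n(3) by simp
    then show "y \<in> th ` local_maxima P w" using t n(1) by (auto simp: local_maxima_def iff intro!: image_eqI[of _ _ t])
  qed
  have inj: "inj_on th (local_maxima P w)" using strict_mono_imp_inj_on[OF th(2)] inj_on_subset by blast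
  have "finite (th ` local_maxima P w)" unfolding img by simp
  then have "finite (local_maxima P w)" using inj by (simp add: finite_image_iff)
  moreover have "card (local_maxima P w) = nat R"
  proof -
    have "card (local_maxima P w) = card (th ` local_maxima P w)" by (simp add: card_image inj)
    also have "\<dots> = card {\<lceil>\<alpha>\<rceil>..<\<lceil>\<alpha>\<rceil> + R}"
      unfolding img by (rule card_image) (simp add: inj_on_def)
    finally show ?thesis by simp
  qed
  ultimately show ?thesis by blast
qed

text \<open>Reflection preserves heights and reverses the sense of turning, which reduces a
  decreasing tangent angle to an increasing one.\<close>

lemma local_maxima_cnj: "local_maxima (\<lambda>t. cnj (P t)) (cnj w) = local_maxima P w"
  by (simp add: local_maxima_def inner_complex_def)

lemma spiral_number_eq:
  assumes "\<And>w. norm w = 1 \<Longrightarrow> finite (local_maxima P w) \<and> card (local_maxima P w) = n"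
  shows "spiral_number P = n"
  unfolding spiral_number_def
proof (rule the_equality)
  show "n' = n" if "\<forall>w. norm w = 1 \<longrightarrow> finite (local_maxima P w) \<and> card (local_maxima P w) = n'" for n'
    using that assms[of 1] by (metis norm_one)
qed (use assms in blast)

text \<open>The angle is the imaginary part of a continuous logarithm \<open>g\<close> of
  \<open>V\<close>. Near \<open>t\<close> the imaginary part of \<open>g s - g t\<close> is below pi
  in modulus, so \<open>g s\<close> equals \<open>g t + Ln (V s / V t)\<close> there and inherits
  the derivative of the principal logarithm.\<close>

lemma ex_tangent_angle:
  fixes V V' :: "real \<Rightarrow> complex"
  assumes d: "\<And>t. (V has_vector_derivative V' t) (at t)" and nz: "\<And>t. V t \<noteq> 0"
  obtains th where "\<And>t. V t = of_real (norm (V t)) * cis (th t)"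
    and "\<And>t. (th has_real_derivative Im (V' t / V t)) (at t)"
proof -
  have contV: "continuous_on UNIV V"
    using d by (meson continuous_at_imp_continuous_on has_vector_derivative_continuous)
  obtain g where g: "continuous_on UNIV g" "\<And>t. V t = exp (g t)"
    by (rule continuous_logarithm_on_contractible[OF contV convex_imp_contractible[OF convex_UNIV]])
      (use nz in auto)
  have "V t = of_real (norm (V t)) * cis (Im (g t))" for t
    unfolding g(2) norm_exp_eq_Re by (rule exp_eq_polar)
  moreover have "((\<lambda>t. Im (g t)) has_real_derivative Im (V' t / V t)) (at t)" for t
  proof -
    have "((\<lambda>s. V s / V t) has_vector_derivative V' t / V t) (at t)"
      using bounded_linear.has_vector_derivative[OF bounded_linear_divide d] .
    moreover have "(Ln has_field_derivative 1) (at (V t / V t))"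
      using nz[of t] by (auto intro!: derivative_eq_intros simp: complex_nonpos_Reals_iff)
    ultimately have "((\<lambda>s. Ln (V s / V t)) has_vector_derivative V' t / V t * 1) (at t)"
      using field_vector_diff_chain_at[of "\<lambda>s. V s / V t" "V' t / V t" t Ln 1] by (simp add: o_def)
    then have "((\<lambda>s. g t + Ln (V s / V t)) has_vector_derivative 0 + V' t / V t) (at t)"
      by (intro has_vector_derivative_add has_vector_derivative_const) simp
    moreover have ev: "\<forall>\<^sub>F s in nhds t. g t + Ln (V s / V t) = g s"
    proof -
      have "continuous (at t) g" using g(1) by (simp add: continuous_on_eq_continuous_at)
      then obtain e where e: "0 < e" "\<And>s. dist s t < e \<Longrightarrow> dist (g s) (g t) < pi"
        unfolding continuous_at_eps_delta using pi_gt_zero by blast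
      have "g t + Ln (V s / V t) = g s" if "dist s t < e" for s
      proof -
        have "\<bar>Im (g s - g t)\<bar> < pi" using e(2)[OF that] abs_Im_le_cmod[of "g s - g t"] by (simp add: dist_norm)
        then have "Ln (exp (g s - g t)) = g s - g t" by (intro Ln_exp) auto
        then show ?thesis by (simp add: g(2) exp_diff)
      qed
      then show ?thesis using e(1) by (auto simp: eventually_nhds_metric)
    qed
    moreover have "((\<lambda>s. g t + Ln (V s / V t)) has_vector_derivative V' t / V t) (at t)
        \<longleftrightarrow> (g has_vector_derivative V' t / V t) (at t)"
      by (rule has_vector_derivative_cong_ev) (use ev eventually_nhds_x_imp_x[OF ev] in auto)
    ultimately have "(g has_vector_derivative V' t / V t) (at t)"
      by simp
    then show ?thesis
      unfolding has_real_derivative_iff_has_vector_derivative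
      by (rule bounded_linear.has_vector_derivative[OF bounded_linear_Im])
  qed
  ultimately show thesis by (rule that)
qed

text \<open>The point is the infimum of the parameters in \<open>{x..y}\<close> with negative value.
  No negative value precedes it, and negative values occur arbitrarily close after it. As zeros are
  isolated, the sign is strict on the left, and by the intermediate value theorem a single negative
  value fixes it on the right.\<close>

lemma sign_change_point:
  fixes g :: "real \<Rightarrow> real"
  assumes cont: "continuous_on UNIV g" and disc: "discrete {t. g t = 0}"
    and xy: "x < y" "0 < g x" "g y < 0"
  shows "\<exists>t. g t = 0 \<and> (\<exists>\<epsilon>>0. \<forall>r\<in>{t-\<epsilon><..<t}. \<forall>s\<in>{t<..<t+\<epsilon>}. g r * g s < 0)"
proof -
  define S where "S = {s \<in> {x..y}. g s < 0}"
  define t where "t = Inf S"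
  have S: "y \<in> S" "bdd_below S" using xy by (auto simp: S_def intro!: bdd_belowI[of _ x])
  have "x \<le> t" unfolding t_def by (rule cInf_greatest) (use S(1) in \<open>auto simp: S_def\<close>)
  moreover have "t \<le> y" unfolding t_def by (rule cInf_lower[OF S])
  ultimately have t: "x \<le> t" "t \<le> y" by auto
  have before: "0 \<le> g s" if "x \<le> s" "s < t" for s
  proof (rule ccontr)
    assume "\<not> 0 \<le> g s"
    then have "s \<in> S" using that t by (auto simp: S_def)
    then show False using cInf_lower[of s S] S that by (simp add: t_def)
  qed
  have after: "\<exists>s\<in>S. t \<le> s \<and> s < t + e" if e: "0 < e" for e
  proof -
    have "Inf S < t + e" using e by (simp add: t_def)
    then obtain s where "s \<in> S" "s < t + e" using cInf_lessD[of S "t + e"] S(1) by blast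
    then show ?thesis using cInf_lower[OF _ S(2), of s] by (auto simp: t_def)
  qed
  have gt: "isCont g t" using cont by (simp add: continuous_on_eq_continuous_at)
  have t0: "g t = 0"
  proof (rule antisym)
    show "0 \<le> g t"
    proof (rule ccontr)
      assume neg: "\<not> 0 \<le> g t"
      then have "x < t" using t xy by (cases "x = t") auto
      obtain e where e: "0 < e" "\<And>s. dist s t < e \<Longrightarrow> dist (g s) (g t) < - g t"
        using gt neg unfolding continuous_at_eps_delta by (metis neg_0_less_iff_less not_le)
      define s where "s = max x (t - e / 2)"
      have "x \<le> s" "s < t" "dist s t < e" using \<open>x < t\<close> e(1) by (auto simp: s_def dist_real_def)
      then show False using before[of s] e(2)[of s] by (auto simp: dist_real_def)
    qed
    show "g t \<le> 0"
    proof (rule ccontr)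
      assume pos: "\<not> g t \<le> 0"
      obtain e where e: "0 < e" "\<And>s. dist s t < e \<Longrightarrow> dist (g s) (g t) < g t"
        using gt pos unfolding continuous_at_eps_delta by (metis not_le)
      obtain s where s: "s \<in> S" "t \<le> s" "s < t + e" using after[OF e(1)] by blast
      then have "dist (g s) (g t) < g t" by (intro e(2)) (simp add: dist_real_def)
      then show False using s(1) by (auto simp: S_def dist_real_def)
    qed
  qed
  have "x < t" using t xy t0 by (cases "x = t") auto
  have "\<forall>\<^sub>F s in at t. s \<notin> {t. g t = 0}" using disc t0 by (simp add: discrete_altdef)
  then obtain e where e: "0 < e" "\<And>s. s \<noteq> t \<Longrightarrow> dist s t < e \<Longrightarrow> g s \<noteq> 0"
    by (auto simp: eventually_at)
  define d where "d = min e (t - x)"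
  have d: "0 < d" "d \<le> e" "d \<le> t - x" using e(1) \<open>x < t\<close> by (auto simp: d_def)
  have nz: "g s \<noteq> 0" if "t < s" "s < t + d" for s
    using that d by (intro e(2)) (auto simp: dist_real_def)
  have left: "0 < g r" if "t - d < r" "r < t" for r
  proof -
    have "g r \<noteq> 0" using that d by (intro e(2)) (auto simp: dist_real_def)
    moreover have "0 \<le> g r" using that d by (intro before) auto
    ultimately show ?thesis by simp
  qed
  obtain s0 where s0: "s0 \<in> S" "t \<le> s0" "s0 < t + d" using after[OF d(1)] by blast
  then have "g s0 < 0" "t < s0" using t0 by (auto simp: S_def order_less_le)
  have right: "g s < 0" if s: "t < s" "s < t + d" for s
  proof (rule ccontr)
    assume "\<not> g s < 0"
    then have "0 \<le> g s" by simp
    have c: "continuous_on A g" for A using cont continuous_on_subset by blast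
    have "\<exists>z. min s s0 \<le> z \<and> z \<le> max s s0 \<and> g z = 0"
    proof (cases "s \<le> s0")
      case True
      then show ?thesis using IVT2'[of g s0 0 s] \<open>0 \<le> g s\<close> \<open>g s0 < 0\<close> c by auto
    next
      case False
      then show ?thesis using IVT'[of g s0 0 s] \<open>0 \<le> g s\<close> \<open>g s0 < 0\<close> c by auto
    qed
    then obtain z where "min s s0 \<le> z" "z \<le> max s s0" "g z = 0" by blast
    then show False using nz[of z] s \<open>t < s0\<close> s0(3) by linarith
  qed
  show ?thesis using t0 d(1) left right
    by (intro exI[of _ t] conjI exI[of _ d]) (auto intro: mult_pos_neg)
qed

lemma constant_sign:
  fixes g :: "real \<Rightarrow> real"
  assumes cont: "continuous_on UNIV g" and disc: "discrete {t. g t = 0}"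
    and no: "\<nexists>t. g t = 0 \<and> (\<exists>\<epsilon>>0. \<forall>r\<in>{t-\<epsilon><..<t}. \<forall>s\<in>{t<..<t+\<epsilon>}. g r * g s < 0)"
  shows "(\<forall>t. 0 \<le> g t) \<or> (\<forall>t. g t \<le> 0)"
proof (rule ccontr)
  assume "\<not> ?thesis"
  then obtain a b where ab: "g a < 0" "0 < g b" by (auto simp: not_le)
  then consider "b < a" | "a < b" by fastforce
  then show False
  proof cases
    case 1
    then show ?thesis using sign_change_point[OF cont disc] ab no by blast
  next
    case 2
    have "continuous_on UNIV (\<lambda>t. - g t)" "discrete {t. - g t = 0}"
      using cont disc by (auto intro: continuous_intros)
    from sign_change_point[OF this 2] ab no show ?thesis by simp
  qed
qed

theorem theorem2p3:
  fixes K :: "real \<Rightarrow> real^3" and P :: "real \<Rightarrow> complex"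
  assumes "knot K"
    and "smooth_projection K P"
    and "spiral_form P"
  shows "int (spiral_number P) =
           int (card {S \<in> seifert_circles P. o_circle P S})
           - int (card {S \<in> seifert_circles P. i_circle P S})"
proof -
  obtain D where D: "D 0 = K" "\<And>n t. (D n has_vector_derivative D (Suc n) t) (at t)"
    using assms(1) by (auto simp: knot_def smooth_def)
  obtain a u v where P: "P = (\<lambda>t. Complex ((K t - a) \<bullet> u) ((K t - a) \<bullet> v))"
    using assms(2) by (auto simp: smooth_projection_def orthogonal_projection_of_def)
  define pr where "pr x = Complex (x \<bullet> u) (x \<bullet> v)" for x :: "real^3"
  have pr: "bounded_linear pr"
  proof -
    have "bounded_linear (\<lambda>x. of_real (x \<bullet> u) + \<i> * of_real (x \<bullet> v) :: complex)"
      by (intro bounded_linear_add bounded_linear_const_mult bounded_linear_compose[OF bounded_linear_of_real]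
          bounded_linear_inner_left)
    moreover have "pr = (\<lambda>x. of_real (x \<bullet> u) + \<i> * of_real (x \<bullet> v))"
      by (simp add: fun_eq_iff pr_def complex_eq_iff)
    ultimately show ?thesis by simp
  qed
  define V where "V t = pr (D 1 t)" for t
  define A where "A t = pr (D 2 t)" for t
  have P_deriv: "(P has_vector_derivative V t) (at t)" for t
  proof -
    have "((\<lambda>t. K t - a) has_vector_derivative D 1 t - 0) (at t)"
      using D(2)[of 0 t] D(1) by (intro has_vector_derivative_diff has_vector_derivative_const) simp
    from bounded_linear.has_vector_derivative[OF pr this] show ?thesis by (simp add: P pr_def[abs_def] V_def)
  qed
  have V_deriv: "(V has_vector_derivative A t) (at t)" for t
    unfolding V_def A_def using bounded_linear.has_vector_derivative[OF pr D(2)[of 1 t]]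
    by (simp add: numeral_2_eq_2)
  \<comment> \<open>The third derivative supplies continuity of \<open>A\<close>, and with it of the
    curvature.\<close>
  have A_deriv: "(A has_vector_derivative pr (D 3 t)) (at t)" for t
    unfolding A_def using bounded_linear.has_vector_derivative[OF pr D(2)[of 2 t]]
    by (simp add: numeral_3_eq_3 numeral_2_eq_2)
  have contV: "continuous_on UNIV V" and contA: "continuous_on UNIV A"
    using V_deriv A_deriv by (meson continuous_at_imp_continuous_on has_vector_derivative_continuous)+
  have velP: "velocity P = V" and velV: "velocity V = A"
    using P_deriv V_deriv by (auto simp: fun_eq_iff velocity_def vector_derivative_at)
  have V_nz: "V t \<noteq> 0" for t using assms(2) by (auto simp: smooth_projection_def velP)
  have P_per: "P (t + 1) = P t" for t using assms(1) by (simp add: knot_def P)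
  have V_per: "V (t + 1) = V t" for t by (rule derivative_periodic[OF P_deriv P_per])
  have A_per: "A (t + 1) = A t" for t by (rule derivative_periodic[OF V_deriv V_per])
  have mult: "finite (multiple_points P)" "\<And>z. z \<in> multiple_points P \<Longrightarrow> transverse_double_point P z"
    and disc: "discrete (inflection_points P)"
    using assms(2) by (auto simp: smooth_projection_def)
  have frac_Ints: "frac t - t \<in> \<int>" for t :: real by (simp add: frac_def)
  have P_frac: "P (frac t) = P t" and V_frac: "V (frac t) = V t" for t
    using periodic_Ints[of P, OF P_per frac_Ints] periodic_Ints[of V, OF V_per frac_Ints] by auto
  have frac_neq: "frac s \<noteq> frac t" if "s - t \<notin> \<int>" for s t :: real
  proof
    assume "frac s = frac t"
    then have "s - t = of_int (\<lfloor>s\<rfloor> - \<lfloor>t\<rfloor>)" by (simp add: frac_def)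
    then show False using that by (metis Ints_of_int)
  qed
  have frac01: "frac t \<in> {0..<1}" for t :: real by (simp add: frac_ge_0 frac_lt_1)
  have multI: "P t \<in> multiple_points P" if "s - t \<notin> \<int>" "P s = P t" for s t
    unfolding multiple_points_def using frac01 frac_neq[OF that(1)] P_frac that(2) by (metis (mono_tags, lifting) mem_Collect_eq)
  have fib: "card {r \<in> {0..<1}. P r = P t} = 2" if "s - t \<notin> \<int>" "P s = P t" for s t
    using mult(2)[OF multI[OF that]] by (simp add: transverse_double_point_def)
  interpret transverse_curve P V
  proof
    show "Im (V s / V t) \<noteq> 0" if st: "s - t \<notin> \<int>" "P s = P t" for s t
    proof
      assume "Im (V s / V t) = 0"
      then have "V s / V t = of_real (Re (V s / V t))" by (simp add: complex_eq_iff)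
      then have "V s = Re (V s / V t) *\<^sub>R V t" using V_nz[of t] by (simp add: scaleR_conv_of_real field_simps)
      then have "V (frac s) \<in> span {V (frac t)}"
        unfolding V_frac by (metis singletonI span_base span_scale)
      moreover have "V (frac s) \<notin> span {V (frac t)}"
        using mult(2)[OF multI[OF st]] frac01[of s] frac01[of t] frac_neq[OF st(1)] P_frac st(2)
        unfolding transverse_double_point_def velP by metis
      ultimately show False by simp
    qed
    show "r - s \<in> \<int>" if rst: "s - t \<notin> \<int>" "r - t \<notin> \<int>" "P s = P t" "P r = P t" for r s t
    proof (rule ccontr)
      assume rs: "r - s \<notin> \<int>"
      have "card {frac r, frac s, frac t} = 3"
        using frac_neq[OF rs] frac_neq[OF rst(1)] frac_neq[OF rst(2)] by simp
      moreover have "{frac r, frac s, frac t} \<subseteq> {r \<in> {0..<1}. P r = P t}"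
        using rst(3,4) frac01 P_frac by auto
      moreover have "finite {r \<in> {0..<1}. P r = P t}"
        using fib[OF rst(1,3)] by (intro card_ge_0_finite) simp
      ultimately have "3 \<le> card {r \<in> {0..<1}. P r = P t}" by (metis card_mono)
      then show False unfolding fib[OF rst(1,3)] by simp
    qed
    have "crossing_params P \<inter> {0..<1} \<subseteq> (\<Union>z\<in>multiple_points P. {r \<in> {0..<1}. P r = z})"
      using multI by (auto simp: crossing_params_def)
    moreover have "finite {r \<in> {0..<1}. P r = z}" if "z \<in> multiple_points P" for z
      using mult(2)[OF that] by (intro card_ge_0_finite) (simp add: transverse_double_point_def)
    ultimately show "finite (crossing_params P \<inter> {0..<1})"
      using mult(1) finite_subset by (metis (no_types, lifting) finite_UN_I)
  qed (use P_deriv contV V_nz P_per in auto)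
  define k where "k = signed_curvature P"
  have k: "k t = (Re (V t) * Im (A t) - Im (V t) * Re (A t)) / norm (V t) ^ 3" for t
    by (simp add: k_def signed_curvature_def velP velV)
  have k_cont: "continuous_on UNIV k"
    unfolding k[abs_def] by (intro continuous_intros contV contA) (simp add: V_nz)
  have infl: "inflection_points P = {t. k t = 0}" by (simp add: inflection_points_def k_def)
  have "(\<forall>t. 0 \<le> k t) \<or> (\<forall>t. k t \<le> 0)"
    using constant_sign[OF k_cont] disc assms(3)
    unfolding spiral_form_def s_inflection_point_def infl mem_Collect_eq k_def[symmetric] by blast
  then obtain \<sigma> :: real where \<sigma>: "\<sigma> = 1 \<or> \<sigma> = - 1" "\<And>t. 0 \<le> \<sigma> * k t"
    by (metis minus_mult_commute mult_1 neg_0_le_iff_le)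
  \<comment> \<open>If the curvature vanished on an interval, its midpoint would be an inflection
    point that is not isolated.\<close>
  have ne: "\<exists>t\<in>{a<..<b}. k t \<noteq> 0" if "a < b" for a b
  proof (rule ccontr)
    assume *: "\<not> (\<exists>t\<in>{a<..<b}. k t \<noteq> 0)"
    define t where "t = (a + b) / 2"
    have t: "a < t" "t < b" using that by (auto simp: t_def)
    then have "\<forall>\<^sub>F s in at t. k s \<noteq> 0" using disc * by (auto simp: infl discrete_altdef)
    moreover have "\<forall>\<^sub>F s in at t. s \<in> {a<..<b}"
      using t by (intro eventually_at_in_open') auto
    ultimately have "\<forall>\<^sub>F s in at t. False" by eventually_elim (use * in auto)
    then show False by (simp add: eventually_False)
  qed
  obtain th where th: "\<And>t. V t = of_real (norm (V t)) * cis (th t)"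
    "\<And>t. (th has_real_derivative Im (A t / V t)) (at t)"
    using ex_tangent_angle[OF V_deriv V_nz] by blast
  \<comment> \<open>The rate of change of the tangent angle with respect to arc length is the signed
    curvature; the factor \<open>norm (V t)\<close> is the speed.\<close>
  have th_deriv: "(th has_real_derivative k t * norm (V t)) (at t)" for t
  proof -
    have "Im (A t / V t) = (Im (A t) * Re (V t) - Re (A t) * Im (V t)) / (norm (V t))\<^sup>2"
      by (simp add: Im_divide cmod_power2)
    also have "\<dots> = k t * norm (V t)" using V_nz[of t] by (simp add: k power2_eq_square power3_eq_cube field_simps)
    finally show ?thesis using th(2)[of t] by simp
  qed
  have th_cont: "continuous_on UNIV th"
    using th(2) DERIV_isCont by (blast intro: continuous_at_imp_continuous_on)
  have \<sigma>th_deriv: "((\<lambda>t. \<sigma> * th t) has_real_derivative \<sigma> * (k t * norm (V t))) (at t)" for t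
    by (rule DERIV_cmult[OF th_deriv])
  have th_mono: "strict_mono (\<lambda>t. \<sigma> * th t)"
  proof (rule strict_monoI)
    fix x y :: real assume xy: "x < y"
    have mono: "\<sigma> * th x \<le> \<sigma> * th y" if "x \<le> y" for x y
    proof (rule DERIV_nonneg_imp_nondecreasing[OF that])
      show "\<exists>d. ((\<lambda>t. \<sigma> * th t) has_real_derivative d) (at t) \<and> 0 \<le> d" for t
        using \<sigma>th_deriv[of t] \<sigma>(2)[of t] by (metis mult.assoc mult_nonneg_nonneg norm_ge_zero)
    qed
    obtain t where t: "x < t" "t < y" "k t \<noteq> 0" using ne[OF xy] by auto
    show "\<sigma> * th x < \<sigma> * th y"
    \<comment> \<open>A weakly monotone angle with equal end values is constant in between,
      contradicting nonzero curvature at \<open>t\<close>.\<close>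
    proof (rule ccontr)
      assume "\<not> \<sigma> * th x < \<sigma> * th y"
      then have const: "\<sigma> * th s = \<sigma> * th x" if "x \<le> s" "s \<le> y" for s
        using mono[of x s] mono[of s y] that by linarith
      have "\<sigma> * (k t * norm (V t)) = 0"
      proof (rule DERIV_local_const[OF \<sigma>th_deriv])
        show "0 < min (t - x) (y - t)" using t by simp
        show "\<forall>s. \<bar>t - s\<bar> < min (t - x) (y - t) \<longrightarrow> \<sigma> * th t = \<sigma> * th s"
        proof (intro allI impI)
          fix s assume "\<bar>t - s\<bar> < min (t - x) (y - t)"
          then show "\<sigma> * th t = \<sigma> * th s" using const[of s] const[of t] t by auto
        qed
      qed
      then show False using \<sigma>(1) t(3) V_nz[of t] by auto
    qed
  qed
  \<comment> \<open>The derivative of \<open>th\<close> is periodic, so its increment over a period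
    is constant; periodicity of \<open>V\<close> makes the increment a multiple of 2 pi.\<close>
  have "\<exists>c. \<forall>t. th (t + 1) - th t = c"
  proof -
    have "((\<lambda>t. th (t + 1) - th t) has_real_derivative 0) (at t)" for t
    proof -
      have "((\<lambda>t. th (t + 1)) has_real_derivative Im (A (t + 1) / V (t + 1))) (at t)"
        using th(2)[of "t + 1"] DERIV_shift by blast
      then have "((\<lambda>t. th (t + 1) - th t) has_real_derivative Im (A (t + 1) / V (t + 1)) - Im (A t / V t)) (at t)"
        by (intro DERIV_diff th(2))
      then show ?thesis by (simp add: A_per V_per)
    qed
    then show ?thesis using DERIV_isconst_all[of "\<lambda>t. th (t + 1) - th t"] by blast
  qed
  then obtain c where c: "\<And>t. th (t + 1) - th t = c" by blast
  have "cis (th 1) = cis (th 0)"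
    using th(1)[of 0] th(1)[of 1] V_per[of 0] V_nz[of 0]
    by (metis add_0 mult_left_cancel norm_eq_zero of_real_eq_0_iff)
  then have "cis (th 1 - th 0) = 1" by (simp add: cis_divide[symmetric])
  then have "cos (th 1 - th 0) = 1" by (metis cis.simps(1) one_complex.simps(1))
  then obtain R :: int where "th 1 - th 0 = of_int R * 2 * pi" by (auto simp: cos_one_2pi_int)
  then have R: "th (t + 1) = th t + 2 * pi * of_int R" for t
    using c[of 0] c[of t] by (simp add: algebra_simps)
  have count: "real (card {S \<in> seifert_circles P. o_circle P S}) - real (card {S \<in> seifert_circles P. i_circle P S})
      = \<sigma> * of_int R"
    by (rule Seifert_circle_count[OF th_cont th(1) R velP \<sigma>(1)])
      (use \<sigma>(2) ne in \<open>auto simp: k_def\<close>)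
  have "\<sigma> * th 0 < \<sigma> * th 1" using strict_monoD[OF th_mono, of 0 1] by simp
  \<comment> \<open>Positivity ensures that the conversion by \<open>nat\<close> of \<open>R\<close>
    or \<open>- R\<close> loses nothing.\<close>
  then have \<sigma>R: "0 < \<sigma> * of_int R" using R[of 0] pi_gt_zero
    by (simp add: distrib_left mult.left_commute zero_less_mult_iff mult_less_0_iff)
  from \<sigma>(1) show ?thesis
  proof
    assume 1: "\<sigma> = 1"
    then have "strict_mono th" using th_mono by simp
    then have "spiral_number P = nat R"
      by (intro spiral_number_eq card_local_maxima[OF P_deriv V_nz th_cont _ th(1)]) (use R[of 0] in auto)
    then show ?thesis using count \<sigma>R 1 by simp
  next
    assume 1: "\<sigma> = - 1"
    then have mono: "strict_mono (\<lambda>t. - th t)" using th_mono by simp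
    \<comment> \<open>For clockwise turning the maxima are counted on the conjugate curve, whose
      tangent angle \<open>- th\<close> is increasing and gains \<open>- R\<close> full
      turns.\<close>
    have "spiral_number P = nat (- R)"
    proof (rule spiral_number_eq)
      fix w :: complex assume "norm w = 1"
      have "finite (local_maxima (\<lambda>t. cnj (P t)) (cnj w)) \<and> card (local_maxima (\<lambda>t. cnj (P t)) (cnj w)) = nat (- R)"
      proof (rule card_local_maxima)
        show "((\<lambda>t. cnj (P t)) has_vector_derivative cnj (V t)) (at t)" for t
          by (rule bounded_linear.has_vector_derivative[OF bounded_linear_cnj P_deriv])
        show "strict_mono (\<lambda>t. - th t)" by fact
        show "cnj (V t) = of_real (norm (cnj (V t))) * cis (- th t)" for t
          using arg_cong[OF th(1)[of t], of cnj]
          unfolding complex_mod_cnj complex_cnj_mult complex_cnj_complex_of_real cis_cnj .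
        show "- th 1 = - th 0 + 2 * pi * of_int (- R)" using R[of 0] by simp
      qed (use \<open>norm w = 1\<close> V_nz in \<open>auto intro: continuous_intros th_cont\<close>)
      then show "finite (local_maxima P w) \<and> card (local_maxima P w) = nat (- R)"
        by (simp only: local_maxima_cnj)
    qed
    then show ?thesis using count \<sigma>R 1 by simp
  qed
qed

end
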